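(* Let $m,n\in\mathbb{N}$, let $T\subseteq\mathbb{R}^m$, let $\boldsymbol X=\{\boldsymbol X(\boldsymbol t):\boldsymbol t\in T\}$, $\boldsymbol X(\boldsymbol t)=(X_1(\boldsymbol t),\ldots,X_n(\boldsymbol t))'$, be a separable centered $\mathbb{R}^n$-valued Gaussian process whose covariance matrix $\Sigma_{\boldsymbol t}$ of $\boldsymbol X(\boldsymbol t)$ is invertible for every $\boldsymbol t\in T$, and let $\boldsymbol d=(d_1,\ldots,d_n)':T\to\mathbb{R}^n$ be a function. Assume that (A1) $\sup_{\boldsymbol t\in T}k_{i,j}(\boldsymbol t)<1$ for all $i\neq j$, $i,j\in\{1,\ldots,n\}$; (A2) $\sup_{\boldsymbol t\in T}\left(X_i(\boldsymbol t)-\varepsilon d_i(\boldsymbol t)\right)<\infty$ almost surely, for all $i=1,\ldots,n$ and all $\varepsilon\in(0,1]$. Then for any $\boldsymbol q\in\mathbb{R}^n$ with $\boldsymbol q>\boldsymbol 0$, $$\log\mathbb{P}\left(\exists\,\boldsymbol t\in T:\ \boldsymbol X(\boldsymbol t)-\boldsymbol d(\boldsymbol t)>u\boldsymbol q\right)\sim -M_{\boldsymbol X,\boldsymbol d,\boldsymbol q}(u;T)\quad\text{as } u\to\infty.$$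
   Context: Inequalities between vectors are understood coordinatewise. $\langle\cdot,\cdot\rangle$ is the Euclidean inner product. $f(u)\sim g(u)$ means $\lim_{u\to\infty}f(u)/g(u)=1$. Write $\Sigma_{\boldsymbol t}^{-1}=(\partial_{i,j}(\boldsymbol t))_{i,j\le n}$ for the entries of the inverse covariance matrix, and define $$k_{i,j}(\boldsymbol t):=\frac{\partial_{i,j}(\boldsymbol t)}{\sqrt{\partial_{i,i}(\boldsymbol t)\,\partial_{j,j}(\boldsymbol t)}}.$$ For $\boldsymbol t\in T$ and $\boldsymbol q>\boldsymbol 0$ define $$M_{\boldsymbol X,\boldsymbol d,\boldsymbol q}(u,\boldsymbol t):=\inf_{\boldsymbol v\ge u\boldsymbol q}\left\langle \boldsymbol v+\boldsymbol d(\boldsymbol t),\Sigma_{\boldsymbol t}^{-1}(\boldsymbol v+\boldsymbol d(\boldsymbol t))\right\rangle,\qquad M_{\boldsymbol X,\boldsymbol d,\boldsymbol q}(u;T):=\frac12\inf_{\boldsymbol t\in T}M_{\boldsymbol X,\boldsymbol d,\boldsymbol q}(u,\boldsymbol t).$$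
   Formalization: Separability is assumed of the drifted process X − d as well as of X (automatic for continuous d, or for X with continuous paths), since for arbitrary d separability of X alone does not suffice; T is assumed non-empty. *)

theory Defs
  imports "HOL-Probability.Probability"
begin

text \<open>A univariate Gaussian random variable; degenerate (a.s. constant) ones are included.\<close>

definition gaussian_rv :: "'a measure \<Rightarrow> ('a \<Rightarrow> real) \<Rightarrow> bool" where
  "gaussian_rv M Y \<longleftrightarrow> Y \<in> borel_measurable M \<and>
     ((\<exists>\<mu> \<sigma>. \<sigma> > 0 \<and> distributed M lborel Y (normal_density \<mu> \<sigma>)) \<or>
      (\<exists>c. AE \<omega> in M. Y \<omega> = c))"

text \<open>Finite-dimensional distributions are jointly Gaussian iff every finite linear combination of
  the coordinates \<open>X t \<omega> $ i\<close> is univariate Gaussian.\<close>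

definition gaussian_process ::
    "'a measure \<Rightarrow> 't set \<Rightarrow> ('t \<Rightarrow> 'a \<Rightarrow> real ^ 'n) \<Rightarrow> bool" where
  "gaussian_process M T X \<longleftrightarrow>
     (\<forall>t\<in>T. X t \<in> borel_measurable M) \<and>
     (\<forall>F a. finite F \<and> F \<subseteq> T \<longrightarrow> gaussian_rv M (\<lambda>\<omega>. \<Sum>t\<in>F. a t \<bullet> X t \<omega>))"

definition centered_process ::
    "'a measure \<Rightarrow> 't set \<Rightarrow> ('t \<Rightarrow> 'a \<Rightarrow> real ^ 'n) \<Rightarrow> bool" where
  "centered_process M T X \<longleftrightarrow> (\<forall>t\<in>T. \<forall>i. (LINT \<omega>|M. X t \<omega> $ i) = 0)"

text \<open>Separability in the sense of Doob: outside one null set, the events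
  \<open>X t \<in> F for all t \<in> T \<inter> I\<close> and \<open>X s \<in> F for all s \<in> S \<inter> I\<close> agree, for all open \<open>I\<close> and closed \<open>F\<close>
  simultaneously. The case \<open>F = {}\<close> makes \<open>S\<close> dense in \<open>T\<close>.\<close>

definition separable_process ::
    "'a measure \<Rightarrow> 't::topological_space set \<Rightarrow> ('t \<Rightarrow> 'a \<Rightarrow> 'b::topological_space) \<Rightarrow> bool" where
  "separable_process M T X \<longleftrightarrow>
     (\<exists>S. countable S \<and> S \<subseteq> T \<and>
        (AE \<omega> in M. \<forall>I F. open I \<and> closed F \<longrightarrow>
           ((\<forall>t\<in>T \<inter> I. X t \<omega> \<in> F) \<longleftrightarrow> (\<forall>s\<in>S \<inter> I. X s \<omega> \<in> F))))"

text \<open>Separability of \<open>X\<close> passes to \<open>X - d\<close> when \<open>d\<close> is continuous, but not for arbitrary \<open>d\<close>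
  (a separable \<open>X\<close> may be modified at a random point of a set on which \<open>d\<close> is small, without
  changing its finite-dimensional distributions). Exceedance probabilities of \<open>X - d\<close> are
  therefore not determined by separability of \<open>X\<close> alone. When the sample paths of \<open>X\<close> are a.s. continuous, \<open>X - d\<close> is separable for every function \<open>d\<close>.\<close>

lemma separable_process_diff_continuous:
  fixes X :: "'t::topological_space \<Rightarrow> 'a \<Rightarrow> 'b::real_normed_vector"
  assumes sep: "separable_process M T X" and d: "continuous_on T d"
  shows "separable_process M T (\<lambda>t \<omega>. X t \<omega> - d t)"
proof -
  from sep obtain S where S: "countable S" "S \<subseteq> T"
    and ae: "AE \<omega> in M. \<forall>I F. open I \<and> closed F \<longrightarrow>
           ((\<forall>t\<in>T \<inter> I. X t \<omega> \<in> F) \<longleftrightarrow> (\<forall>s\<in>S \<inter> I. X s \<omega> \<in> F))"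
    unfolding separable_process_def by blast
  have "AE \<omega> in M. \<forall>I F. open I \<and> closed F \<longrightarrow>
           ((\<forall>t\<in>T \<inter> I. X t \<omega> - d t \<in> F) \<longleftrightarrow> (\<forall>s\<in>S \<inter> I. X s \<omega> - d s \<in> F))"
    using ae
  proof (eventually_elim, intro allI impI iffI)
    fix \<omega> and I :: "'t set" and F :: "'b set"
    assume "open I \<and> closed F" "\<forall>t\<in>T \<inter> I. X t \<omega> - d t \<in> F"
    then show "\<forall>s\<in>S \<inter> I. X s \<omega> - d s \<in> F" using S by blast
  next
    fix \<omega> and I :: "'t set" and F :: "'b set"
    assume H: "\<forall>I F. open I \<and> closed F \<longrightarrow>
           ((\<forall>t\<in>T \<inter> I. X t \<omega> \<in> F) \<longleftrightarrow> (\<forall>s\<in>S \<inter> I. X s \<omega> \<in> F))"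
      and IF: "open I \<and> closed F" and sF: "\<forall>s\<in>S \<inter> I. X s \<omega> - d s \<in> F"
    show "\<forall>t\<in>T \<inter> I. X t \<omega> - d t \<in> F"
    proof
      fix t assume t: "t \<in> T \<inter> I"
      have "S \<inter> I \<noteq> {}" using H[THEN spec, THEN spec, THEN mp, of I "{}"] IF t by auto
      then have F0: "F \<noteq> {}" using sF by blast
      have le: "infdist (X t \<omega> - d t) F \<le> e" if e: "e > 0" for e
      proof -
        obtain A where A: "open A" "A \<inter> T = d -` ball (d t) e \<inter> T"
          using d[unfolded continuous_on_open_invariant, rule_format, OF open_ball] by blast
        define G where "G = {x. infdist (x - d t) F \<le> e}"
        have "closed G" unfolding G_def by (intro closed_Collect_le continuous_intros)
        moreover have "\<forall>s\<in>S \<inter> (I \<inter> A). X s \<omega> \<in> G"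
        proof
          fix s assume s: "s \<in> S \<inter> (I \<inter> A)"
          then have "d s \<in> ball (d t) e" using A S by blast
          then have "norm (d s - d t) < e" by (simp add: dist_norm norm_minus_commute)
          moreover have "infdist (X s \<omega> - d t) F \<le> dist (X s \<omega> - d t) (X s \<omega> - d s)"
            using sF s by (intro infdist_le) auto
          ultimately show "X s \<omega> \<in> G" by (simp add: G_def dist_norm)
        qed
        moreover have "t \<in> T \<inter> (I \<inter> A)" proof -
          have "t \<in> d -` ball (d t) e \<inter> T" using t e by simp
          then show ?thesis using t A(2) by blast
        qed
        ultimately have "X t \<omega> \<in> G"
          using H[THEN spec, THEN spec, THEN mp, of "I \<inter> A" G] IF A(1) by (meson open_Int)
        then show ?thesis by (simp add: G_def)
      qed
      have "infdist (X t \<omega> - d t) F \<le> 0" by (rule field_le_epsilon) (simp add: le)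
      then have "infdist (X t \<omega> - d t) F = 0" using infdist_nonneg[of "X t \<omega> - d t" F] by linarith
      then show "X t \<omega> - d t \<in> F"
        using IF F0 by (simp add: in_closed_iff_infdist_zero)
    qed
  qed
  then show ?thesis unfolding separable_process_def using S by blast
qed

lemma separable_process_diff_continuous_paths:
  fixes X :: "'t::second_countable_topology \<Rightarrow> 'a \<Rightarrow> 'b::{real_normed_vector, second_countable_topology}"
  assumes cont: "AE \<omega> in M. continuous_on T (\<lambda>t. X t \<omega>)"
  shows "separable_process M T (\<lambda>t \<omega>. X t \<omega> - d t)"
proof -
  let ?g = "\<lambda>t. (t, d t)"
  obtain D where D: "countable D" "D \<subseteq> ?g ` T"
    "\<And>U. open U \<Longrightarrow> U \<inter> ?g ` T \<noteq> {} \<Longrightarrow> U \<inter> D \<noteq> {}"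
  proof -
    obtain B :: "('t \<times> 'b) set set" where B: "countable B" "topological_basis B"
      using ex_countable_basis by blast
    define p where "p b = (SOME x. x \<in> b \<inter> ?g ` T)" for b
    define D where "D = p ` {b \<in> B. b \<inter> ?g ` T \<noteq> {}}"
    have p: "p b \<in> b \<inter> ?g ` T" if "b \<inter> ?g ` T \<noteq> {}" for b
      unfolding p_def by (rule someI_ex) (use that in blast)
    show ?thesis
    proof (rule that[of D])
      show "countable D" using B by (simp add: D_def)
      show "D \<subseteq> ?g ` T" unfolding D_def using p by blast
      fix U :: "('t \<times> 'b) set" assume "open U" "U \<inter> ?g ` T \<noteq> {}"
      then obtain x where x: "x \<in> U" "x \<in> ?g ` T" by blast
      obtain b where "b \<in> B" "x \<in> b" "b \<subseteq> U"
        using topological_basisE[OF B(2) \<open>open U\<close> x(1)] by blast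
      with x p[of b] have "p b \<in> U" "p b \<in> D" unfolding D_def by blast+
      then show "U \<inter> D \<noteq> {}" by blast
    qed
  qed
  define S where "S = fst ` D"
  have S: "countable S" "S \<subseteq> T" using D by (auto simp: S_def)
  have gS: "\<exists>s\<in>S. (s, d s) \<in> U" if "open U" "t \<in> T" "(t, d t) \<in> U" for U t
  proof -
    have "U \<inter> D \<noteq> {}" using that by (intro D(3)) auto
    then show ?thesis using D(2) by (force simp: S_def)
  qed
  have "AE \<omega> in M. \<forall>I F. open I \<and> closed F \<longrightarrow>
           ((\<forall>t\<in>T \<inter> I. X t \<omega> - d t \<in> F) \<longleftrightarrow> (\<forall>s\<in>S \<inter> I. X s \<omega> - d s \<in> F))"
    using cont
  proof (eventually_elim, intro allI impI iffI)
    fix \<omega> and I :: "'t set" and F :: "'b set"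
    assume "open I \<and> closed F" "\<forall>t\<in>T \<inter> I. X t \<omega> - d t \<in> F"
    then show "\<forall>s\<in>S \<inter> I. X s \<omega> - d s \<in> F" using S by blast
  next
    fix \<omega> and I :: "'t set" and F :: "'b set"
    assume c: "continuous_on T (\<lambda>t. X t \<omega>)"
      and IF: "open I \<and> closed F" and sF: "\<forall>s\<in>S \<inter> I. X s \<omega> - d s \<in> F"
    show "\<forall>t\<in>T \<inter> I. X t \<omega> - d t \<in> F"
    proof (rule ballI, rule ccontr)
      fix t assume t: "t \<in> T \<inter> I" and nF: "X t \<omega> - d t \<notin> F"
      have "continuous_on (T \<times> UNIV) (\<lambda>x. X (fst x) \<omega> - snd x)"
        by (intro continuous_on_diff continuous_on_compose2[OF c] continuous_intros) auto
      then obtain A where A: "open A"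
        "A \<inter> (T \<times> UNIV) = (\<lambda>x. X (fst x) \<omega> - snd x) -` (- F) \<inter> (T \<times> UNIV)"
        using IF unfolding continuous_on_open_invariant by (meson open_Compl)
      have "(t, d t) \<in> A" proof -
        have "(t, d t) \<in> (\<lambda>x. X (fst x) \<omega> - snd x) -` (- F) \<inter> (T \<times> UNIV)" using t nF by simp
        then show ?thesis using A(2) by blast
      qed
      then obtain s where s: "s \<in> S" "(s, d s) \<in> A \<inter> (I \<times> UNIV)"
        using gS[OF open_Int[OF A(1) open_Times[of I UNIV]], of t] IF t by auto
      then have "X s \<omega> - d s \<notin> F" proof -
        have "(s, d s) \<in> A \<inter> (T \<times> UNIV)" using s S by auto
        then have "(s, d s) \<in> (\<lambda>x. X (fst x) \<omega> - snd x) -` (- F)" using A(2) by blast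
        then show ?thesis by simp
      qed
      then show False using sF s by auto
    qed
  qed
  then show ?thesis unfolding separable_process_def using S by blast
qed

definition cov_matrix :: "'a measure \<Rightarrow> ('a \<Rightarrow> real ^ 'n) \<Rightarrow> real ^ 'n ^ 'n" where
  "cov_matrix M Y =
     (\<chi> i j. LINT \<omega>|M. (Y \<omega> $ i - (LINT \<omega>'|M. Y \<omega>' $ i)) * (Y \<omega> $ j - (LINT \<omega>'|M. Y \<omega>' $ j)))"

definition inv_cov :: "'a measure \<Rightarrow> ('t \<Rightarrow> 'a \<Rightarrow> real ^ 'n) \<Rightarrow> 't \<Rightarrow> real ^ 'n ^ 'n" where
  "inv_cov M X t = matrix_inv (cov_matrix M (X t))"

definition k_coeff :: "'a measure \<Rightarrow> ('t \<Rightarrow> 'a \<Rightarrow> real ^ 'n) \<Rightarrow> 'n \<Rightarrow> 'n \<Rightarrow> 't \<Rightarrow> real" where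
  "k_coeff M X i j t =
     inv_cov M X t $ i $ j / sqrt (inv_cov M X t $ i $ i * inv_cov M X t $ j $ j)"

text \<open>Vector inequalities are spelled out coordinatewise, since \<open><\<close> on \<open>real ^ 'n\<close> is not the
  coordinatewise strict order.\<close>

definition M_point ::
    "'a measure \<Rightarrow> ('t \<Rightarrow> 'a \<Rightarrow> real ^ 'n) \<Rightarrow> ('t \<Rightarrow> real ^ 'n) \<Rightarrow> real ^ 'n \<Rightarrow> real \<Rightarrow> 't \<Rightarrow> real" where
  "M_point M X d q u t =
     (INF v\<in>{v. \<forall>i. v $ i \<ge> u * q $ i}. (v + d t) \<bullet> (inv_cov M X t *v (v + d t)))"

definition M_set ::
    "'a measure \<Rightarrow> ('t \<Rightarrow> 'a \<Rightarrow> real ^ 'n) \<Rightarrow> ('t \<Rightarrow> real ^ 'n) \<Rightarrow> real ^ 'n \<Rightarrow> real \<Rightarrow> 't set \<Rightarrow> real" where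
  "M_set M X d q u T = 1 / 2 * (INF t\<in>T. M_point M X d q u t)"

text \<open>Under separability the exceedance event differs from a measurable one only by a subset of a
  null set, so its probability is taken in the completion of the underlying space.\<close>

definition exceed_prob ::
    "'a measure \<Rightarrow> ('t \<Rightarrow> 'a \<Rightarrow> real ^ 'n) \<Rightarrow> ('t \<Rightarrow> real ^ 'n) \<Rightarrow> real ^ 'n \<Rightarrow> 't set \<Rightarrow> real \<Rightarrow> real" where
  "exceed_prob M X d q T u =
     measure (completion M) {\<omega> \<in> space M. \<exists>t\<in>T. \<forall>i. X t \<omega> $ i - d t $ i > u * q $ i}"

end

theory Submission
  imports Defs "HOL-Real_Asymp.Real_Asymp"
begin

text \<open>
  Fix \<open>u\<close>, write \<open>b = u q + d t\<close>, and let \<open>x \<ge> b\<close> minimise \<open>x \<bullet> P x\<close>, where \<open>P\<close> is the inverse covariance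
  of \<open>X t\<close>. The dual vector \<open>w = P x\<close> satisfies \<open>w \<ge> 0\<close> and \<open>w \<bullet> b \<ge> w \<bullet> x = x \<bullet> P x\<close>, so exceedance at \<open>t\<close> forces
  \<open>Z t = (w \<bullet> X t) / (w \<bullet> b) > 1\<close>, a scalar Gaussian variable of variance at most \<open>1 / (x \<bullet> P x)\<close>. By (A2)
  the supremum of \<open>Z\<close> tends to 0 in probability as \<open>u\<close> grows, whatever the nonnegative weights, and
  a dimension-free Gaussian concentration bound gives the upper estimate. Concentration is derived
  from the Prekopa-Leindler inequality with weights \<open>l\<close> and \<open>1 - l\<close>, whose exponent becomes sharp as
  \<open>l\<close> tends to 1.

  For the lower estimate choose a nearly optimal \<open>t\<close> and condition on \<open>W = w \<bullet> X t\<close>. (A2) also shows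
  that every component of \<open>b\<close> is much larger than the standard deviation of the same component of
  \<open>X t\<close>, so Chebyshev's inequality controls the residuals of \<open>X t\<close> given \<open>W\<close>, uniformly in \<open>t\<close>.
\<close>

section \<open>The Gaussian Prekopa-Leindler inequality\<close>

text \<open>The weights in \<open>Z t\<close> depend on \<open>t\<close> and \<open>u\<close>
  through a minimiser, so nothing is known about how \<open>Z\<close> varies with \<open>t\<close>.
  The upper estimate therefore rests on what survives arbitrary nonnegative weights: the variance
  bound, and one event, \<open>X s $ i \<le> \<eta> * b u s $ i\<close> for all \<open>s\<close> and
  \<open>i\<close>, on which every \<open>Z s\<close> is at most \<eta>. Its probability is
  eventually at least 1/2, and this is the only location information that the concentration bound
  asks for. Concentration is proved for finite index sets with constants free of their size, so it
  passes to the countable separant. The price of the weight \<open>l\<close> is the prefactor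
  \<open>2 powr (l / (1 - l))\<close>: it blows up as \<open>l\<close> tends to 1 but does not
  depend on \<open>u\<close>, and the logarithm turns it into an additive constant, negligible
  because \<open>M_set\<close> tends to infinity. The process lives on an abstract probability space
  and is Gaussian only through its linear combinations; coordinates on a product of standard normal
  laws come from Gram-Schmidt and are identified by characteristic functions.\<close>

lemma emeasure_le_of_bounds:
  fixes A :: "real set"
  assumes "\<And>x. x \<in> A \<Longrightarrow> p \<le> x \<and> x \<le> q" "p \<le> q"
  shows "emeasure lborel A \<le> ennreal (q - p)"
proof -
  have "A \<subseteq> {p..q}" using assms by auto
  then have "emeasure lborel A \<le> emeasure lborel {p..q}" by (intro emeasure_mono) auto
  also have "\<dots> = ennreal (q - p)" using assms(2) by simp
  finally show ?thesis .
qed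

text \<open>Superlevel sets of the Gaussian density are intervals, so only this trivial case of the
  Brunn-Minkowski inequality is needed.\<close>

lemma brunn_minkowski_interval:
  fixes A B :: "real set" and l r :: real
  assumes A: "A \<noteq> {}" and B: "B \<noteq> {}" and l: "0 < l" "l < 1"
    and sum: "\<And>x y. x \<in> A \<Longrightarrow> y \<in> B \<Longrightarrow> \<bar>l * x + (1 - l) * y\<bar> \<le> r"
  shows "ennreal l * emeasure lborel A + ennreal (1 - l) * emeasure lborel B \<le> ennreal (2 * r)"
proof -
  obtain a b where ab: "a \<in> A" "b \<in> B" using A B by auto
  have A_bd: "x \<le> (r - (1 - l) * y) / l" "(- r - (1 - l) * y) / l \<le> x" if "x \<in> A" "y \<in> B" for x y
    using sum[OF that] l by (auto simp: field_simps abs_le_iff)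
  have bA: "bdd_above A" "bdd_below A"
    using A_bd ab(2) by (auto intro!: bdd_aboveI bdd_belowI)
  have B_bd: "y \<le> (r - l * x) / (1 - l)" "(- r - l * x) / (1 - l) \<le> y" if "x \<in> A" "y \<in> B" for x y
    using sum[OF that] l by (auto simp: field_simps abs_le_iff)
  have bB: "bdd_above B" "bdd_below B"
    using B_bd ab(1) by (auto intro!: bdd_aboveI bdd_belowI)
  \<comment> \<open>The suprema are taken one variable at a time, first over \<open>A\<close> with
    \<open>y\<close> fixed, then over \<open>B\<close>, and likewise the infima; the sumset itself
    never appears.\<close>
  have "y \<le> (r - l * Sup A) / (1 - l)" if y: "y \<in> B" for y
  proof -
    have "Sup A \<le> (r - (1 - l) * y) / l" using A_bd(1)[OF _ y] by (intro cSup_least A)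
    then show ?thesis using l by (simp add: field_simps)
  qed
  then have "Sup B \<le> (r - l * Sup A) / (1 - l)" by (intro cSup_least B)
  then have s: "l * Sup A + (1 - l) * Sup B \<le> r" using l by (simp add: field_simps)
  have "(- r - l * Inf A) / (1 - l) \<le> y" if y: "y \<in> B" for y
  proof -
    have "(- r - (1 - l) * y) / l \<le> Inf A" using A_bd(2)[OF _ y] by (intro cInf_greatest A)
    then show ?thesis using l by (simp add: field_simps)
  qed
  then have "(- r - l * Inf A) / (1 - l) \<le> Inf B" by (intro cInf_greatest B)
  then have i: "- r \<le> l * Inf A + (1 - l) * Inf B" using l by (simp add: field_simps)
  have le: "Inf A \<le> Sup A" "Inf B \<le> Sup B" using A B bA bB by (auto intro!: cInf_le_cSup)
  have "ennreal l * emeasure lborel A + ennreal (1 - l) * emeasure lborel B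
    \<le> ennreal l * ennreal (Sup A - Inf A) + ennreal (1 - l) * ennreal (Sup B - Inf B)"
    by (intro add_mono mult_left_mono emeasure_le_of_bounds le)
      (auto intro!: cSup_upper cInf_lower bA bB)
  also have "\<dots> = ennreal (l * (Sup A - Inf A) + (1 - l) * (Sup B - Inf B))"
    using l le by (simp add: ennreal_mult ennreal_plus)
  also have "\<dots> \<le> ennreal (2 * r)"
    using s i by (intro ennreal_leI) (simp add: algebra_simps)
  finally show ?thesis .
qed

text \<open>Fubini on the region \<open>0 < s < min 1 (max 0 (u x))\<close>. Levels stop at 1
  because level sets are compared only there, after two functions have been divided by their
  suprema; for these two the truncation changes nothing.\<close>

lemma layer_cake_unit:
  fixes u :: "real \<Rightarrow> real"
  assumes [measurable]: "u \<in> borel_measurable borel"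
  shows "(\<integral>\<^sup>+s. emeasure lborel {x. s < u x} * indicator {0<..<1} s \<partial>lborel)
    = (\<integral>\<^sup>+x. ennreal (min 1 (max 0 (u x))) \<partial>lborel)"
proof -
  have "(\<integral>\<^sup>+s. emeasure lborel {x. s < u x} * indicator {0<..<1} s \<partial>lborel)
    = (\<integral>\<^sup>+s. (\<integral>\<^sup>+x. indicator {0<..<min 1 (max 0 (u x))} s \<partial>lborel) \<partial>lborel)"
  proof (intro nn_integral_cong)
    fix s :: real
    have "(\<integral>\<^sup>+x. indicator {0<..<min 1 (max 0 (u x))} s \<partial>lborel)
      = (\<integral>\<^sup>+x. indicator {x. s < u x} x * indicator {0<..<1} s \<partial>lborel)"
      by (intro nn_integral_cong) (auto simp: indicator_def)
    also have "\<dots> = emeasure lborel {x. s < u x} * indicator {0<..<1} s"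
      by (subst nn_integral_multc) auto
    finally show "emeasure lborel {x. s < u x} * indicator {0<..<1} s
      = (\<integral>\<^sup>+x. indicator {0<..<min 1 (max 0 (u x))} s \<partial>lborel)" ..
  qed
  also have "\<dots> = (\<integral>\<^sup>+x. (\<integral>\<^sup>+s. indicator {0<..<min 1 (max 0 (u x))} s \<partial>lborel) \<partial>lborel)"
  proof (rule lborel_pair.Fubini')
    have "(\<lambda>(x, s). indicator {0<..<min 1 (max 0 (u x))} s :: ennreal)
      = indicator {p. 0 < snd p \<and> snd p < min 1 (max 0 (u (fst p)))}"
      by (auto simp: indicator_def fun_eq_iff)
    then show "(\<lambda>(x, s). indicator {0<..<min 1 (max 0 (u x))} s :: ennreal)
      \<in> borel_measurable (lborel \<Otimes>\<^sub>M lborel)"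
      by simp
  qed
  also have "\<dots> = (\<integral>\<^sup>+x. ennreal (min 1 (max 0 (u x))) \<partial>lborel)"
    by (intro nn_integral_cong) simp
  finally show ?thesis .
qed

text \<open>The excess is the variance of a two-point law: \<open>l * x^2 + (1 - l) * y^2 - (l * x +
  (1 - l) * y)^2 = l * (1 - l) * (x - y)^2\<close>. It is the source of the exponential in all
  Prekopa-Leindler hypotheses below.\<close>

lemma std_normal_density_combination:
  fixes x y l :: real
  shows "std_normal_density (l * x + (1 - l) * y)
    = std_normal_density x powr l * std_normal_density y powr (1 - l)
      * exp (l * (1 - l) * (x - y)\<^sup>2 / 2)"
proof -
  define c where "c = 1 / sqrt (2 * pi)"
  have c: "c > 0" by (simp add: c_def)
  have n: "std_normal_density z = c * exp (- z\<^sup>2 / 2)" for z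
    by (simp add: normal_density_def c_def)
  have "std_normal_density x powr l * std_normal_density y powr (1 - l)
      = c powr l * c powr (1 - l) * exp (- x\<^sup>2 / 2 * l) * exp (- y\<^sup>2 / 2 * (1 - l))"
    using c by (simp add: n powr_mult exp_powr_real)
  also have "c powr l * c powr (1 - l) = c" using c by (simp flip: powr_add)
  finally show ?thesis unfolding n[of "l * x + (1 - l) * y"]
    by (simp add: mult.assoc flip: exp_add) (simp add: field_simps power2_eq_square)
qed

lemma std_normal_density_superlevel:
  assumes "0 < \<tau>" "\<tau> < std_normal_density z0"
  obtains r where "r > 0" "{z. \<tau> < std_normal_density z} = {- r<..<r}"
proof -
  define c where "c = 1 / sqrt (2 * pi)"
  have c: "c > 0" by (simp add: c_def)
  have n: "std_normal_density z = c * exp (- z\<^sup>2 / 2)" for z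
    by (simp add: normal_density_def c_def)
  define r where "r = sqrt (- 2 * ln (\<tau> / c))"
  have iff: "\<tau> < std_normal_density z \<longleftrightarrow> z\<^sup>2 < - 2 * ln (\<tau> / c)" for z
  proof -
    have "\<tau> < std_normal_density z \<longleftrightarrow> \<tau> / c < exp (- z\<^sup>2 / 2)"
      using c by (simp add: n field_simps)
    also have "\<dots> \<longleftrightarrow> ln (\<tau> / c) < - z\<^sup>2 / 2"
      using assms c by (metis divide_pos_pos exp_gt_zero ln_exp ln_less_cancel_iff)
    finally show ?thesis by auto
  qed
  have pos: "- 2 * ln (\<tau> / c) > 0" using iff[of z0] assms(2) zero_le_power2[of z0] by linarith
  then have r: "r > 0" "r\<^sup>2 = - 2 * ln (\<tau> / c)" by (simp_all add: r_def)
  have "z\<^sup>2 < r\<^sup>2 \<longleftrightarrow> z \<in> {- r<..<r}" for z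
  proof -
    have "z\<^sup>2 < r\<^sup>2 \<longleftrightarrow> \<bar>z\<bar> < r"
      using r(1) abs_le_square_iff[of r z] by (simp flip: not_le)
    then show ?thesis by auto
  qed
  then have "{z. \<tau> < std_normal_density z} = {- r<..<r}" unfolding iff r(2)[symmetric] by blast
  with r(1) show ?thesis by (rule that)
qed

lemma nn_integral_unit_le:
  fixes u :: "real \<Rightarrow> real"
  assumes "u \<in> borel_measurable borel" "\<And>x. 0 \<le> u x" "\<And>x. u x \<le> 1"
  shows "(\<integral>\<^sup>+s. emeasure lborel {x. s < u x} * indicator {0<..<1} s \<partial>lborel)
    = (\<integral>\<^sup>+x. ennreal (u x) \<partial>lborel)"
proof -
  have "min 1 (max 0 (u x)) = u x" for x using assms(2,3)[of x] by linarith
  then show ?thesis unfolding layer_cake_unit[OF assms(1)] by simp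
qed

text \<open>The level set is a section of a measurable planar set. Measurability in \<open>s\<close>
  lets the two level integrals be added in
  \<open>std_normal_prekopa_leindler_1D_aux\<close>.\<close>

lemma measurable_superlevel_emeasure [measurable]:
  fixes u :: "real \<Rightarrow> real"
  assumes [measurable]: "u \<in> borel_measurable borel"
  shows "(\<lambda>s. emeasure lborel {x. s < u x}) \<in> borel_measurable borel"
proof -
  have "{p \<in> space (lborel \<Otimes>\<^sub>M lborel). fst p < u (snd p)} \<in> sets (lborel \<Otimes>\<^sub>M lborel)"
    by measurable
  then have "{p. fst p < u (snd p)} \<in> sets (lborel \<Otimes>\<^sub>M lborel)"
    by (simp add: space_pair_measure)
  then have "(\<lambda>s. emeasure lborel (Pair s -` {p. fst p < u (snd p)})) \<in> borel_measurable lborel"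
    by (rule lborel.measurable_emeasure_Pair)
  then show ?thesis by (simp add: vimage_def)
qed

text \<open>The third function of Prekopa-Leindler is the constant 1, so the bound is the total mass
  of the Gaussian law. Dividing \<open>f\<close> and \<open>g\<close> times the density by their
  suprema makes the level sets at every height in \<open>{0<..<1}\<close> nonempty, as
  Brunn-Minkowski requires; \<open>x0\<close> and \<open>y0\<close> make these suprema
  positive.\<close>

lemma std_normal_prekopa_leindler_1D_aux:
  fixes f g :: "real \<Rightarrow> real"
  assumes [measurable]: "f \<in> borel_measurable borel" "g \<in> borel_measurable borel"
    and f: "\<And>x. 0 \<le> f x" "\<And>x. f x \<le> K" and g: "\<And>x. 0 \<le> g x" "\<And>x. g x \<le> K"
    and l: "0 < l" "l < 1"
    and le: "\<And>x y. f x powr l * g y powr (1 - l) \<le> exp (l * (1 - l) * (x - y)\<^sup>2 / 2)"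
    and nz: "f x0 \<noteq> 0" "g y0 \<noteq> 0"
  shows "(\<integral>x. f x \<partial>std_normal_distribution) powr l
    * (\<integral>x. g x \<partial>std_normal_distribution) powr (1 - l) \<le> 1"
proof -
  let ?p = std_normal_density
  interpret real_distribution std_normal_distribution by (rule real_dist_normal_dist)
  define u where "u x = f x * ?p x" for x
  define v where "v x = g x * ?p x" for x
  have [measurable]: "u \<in> borel_measurable borel" "v \<in> borel_measurable borel"
    unfolding u_def v_def by measurable
  have p_le: "?p x \<le> 1" for x
  proof -
    have "1 \<le> sqrt (2 * pi)" using pi_gt3 by simp
    then have "1 / sqrt (2 * pi) * exp (- x\<^sup>2 / 2) \<le> 1 * 1"
      by (intro mult_mono) (auto simp: divide_le_eq)
    then show ?thesis by (simp add: std_normal_density_def)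
  qed
  have p_pos: "?p x > 0" for x by (simp add: normal_density_pos)
  have K: "K \<ge> 0" using f[of 0] by simp
  have uv: "0 \<le> u x" "0 \<le> v x" "u x \<le> K" "v x \<le> K" for x
    unfolding u_def v_def using mult_mono[OF f(2) p_le, of x x] mult_mono[OF g(2) p_le, of x x] f g K
    by auto
  have bdd: "bdd_above (range u)" "bdd_above (range v)" using uv by (auto intro!: bdd_aboveI)
  define a where "a = (SUP x. u x)"
  define b where "b = (SUP x. v x)"
  have ua: "u x \<le> a" and vb: "v x \<le> b" for x
    unfolding a_def b_def using bdd by (auto intro!: cSUP_upper)
  have "0 < u x0" "0 < v y0" using nz f(1)[of x0] g(1)[of y0] p_pos
    by (auto simp: u_def v_def less_le)
  then have ab: "0 < a" "0 < b" using ua[of x0] vb[of y0] by linarith+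
  \<comment> \<open>Level \<open>s\<close> of \<open>u / a\<close> and of \<open>v / b\<close>
    combine to level \<open>s * c\<close> of the density, because
    \<open>s powr l * s powr (1 - l) = s\<close>.\<close>
  define c where "c = a powr l * b powr (1 - l)"
  have c: "c > 0" using ab by (simp add: c_def)
  have key: "u x powr l * v y powr (1 - l) \<le> ?p (l * x + (1 - l) * y)" for x y
  proof -
    have "u x powr l * v y powr (1 - l)
      = (f x powr l * g y powr (1 - l)) * (?p x powr l * ?p y powr (1 - l))"
      using f(1)[of x] g(1)[of y] by (simp add: u_def v_def powr_mult)
    also have "\<dots> \<le> exp (l * (1 - l) * (x - y)\<^sup>2 / 2) * (?p x powr l * ?p y powr (1 - l))"
      using le by (intro mult_right_mono) auto
    also have "\<dots> = ?p (l * x + (1 - l) * y)" unfolding std_normal_density_combination by (simp only: mult_ac)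
    finally show ?thesis .
  qed
  have level: "ennreal l * emeasure lborel {x. s < u x / a}
      + ennreal (1 - l) * emeasure lborel {x. s < v x / b}
      \<le> emeasure lborel {x. s < ?p x / c}" if s: "s \<in> {0<..<1}" for s
  proof -
    define A where "A = {x. s < u x / a}"
    define B where "B = {x. s < v x / b}"
    have "s * a < a" "s * b < b" using s ab by auto
    then obtain x1 y1 where "s * a < u x1" "s * b < v y1"
      using less_cSUP_iff[of UNIV u] less_cSUP_iff[of UNIV v] bdd unfolding a_def b_def by auto
    then have 1: "x1 \<in> A" "y1 \<in> B" using ab by (auto simp: A_def B_def field_simps)
    have AB: "s * c < ?p (l * x + (1 - l) * y)" if "x \<in> A" "y \<in> B" for x y
    proof -
      have "s * a < u x" "s * b < v y" using that ab by (auto simp: A_def B_def field_simps)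
      moreover have "0 \<le> s * a" "0 \<le> s * b" using s ab by auto
      ultimately have "(s * a) powr l * (s * b) powr (1 - l) < u x powr l * v y powr (1 - l)"
        using l by (intro mult_strict_mono powr_less_mono2) auto
      moreover have "(s * a) powr l * (s * b) powr (1 - l) = s powr l * s powr (1 - l) * c"
        using s ab by (simp add: powr_mult c_def)
      moreover have "s powr l * s powr (1 - l) = s" using s by (simp flip: powr_add)
      ultimately show ?thesis using key[of x y] by simp
    qed
    obtain r where r: "r > 0" "{z. s * c < ?p z} = {- r<..<r}"
      by (rule std_normal_density_superlevel[OF _ AB[OF 1]]) (use s c in auto)
    have "ennreal l * emeasure lborel A + ennreal (1 - l) * emeasure lborel B \<le> ennreal (2 * r)"
    proof (rule brunn_minkowski_interval[OF _ _ l])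
      fix x y assume "x \<in> A" "y \<in> B"
      then have "l * x + (1 - l) * y \<in> {- r<..<r}" using AB r(2) by auto
      then show "\<bar>l * x + (1 - l) * y\<bar> \<le> r" by (auto simp: abs_le_iff)
    qed (use 1 in auto)
    also have "\<dots> = emeasure lborel {- r<..<r}" using r(1) by simp
    also have "{- r<..<r} = {x. s < ?p x / c}" unfolding r(2)[symmetric] using c by (auto simp: field_simps)
    finally show ?thesis unfolding A_def B_def .
  qed
  have int_p: "(\<integral>\<^sup>+x. ennreal (?p x / c) \<partial>lborel) = ennreal (1 / c)"
  proof -
    have "(\<integral>\<^sup>+x. ennreal (?p x / c) \<partial>lborel) = (\<integral>\<^sup>+x. ennreal (1 / c) * ennreal (?p x) \<partial>lborel)"
      using c by (intro nn_integral_cong) (simp flip: ennreal_mult)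
    also have "\<dots> = ennreal (1 / c) * emeasure std_normal_distribution UNIV"
      by (subst nn_integral_cmult) (auto simp: emeasure_density)
    finally show ?thesis using emeasure_space_1 by simp
  qed
  have int_fg: "(\<integral>\<^sup>+x. ennreal (h x * ?p x / k) \<partial>lborel) = ennreal ((\<integral>x. h x \<partial>std_normal_distribution) / k)"
    if [measurable]: "h \<in> borel_measurable borel" and h: "\<And>x. 0 \<le> h x" "\<And>x. h x \<le> K" and k: "0 < k" for h k
  proof -
    have "(\<integral>\<^sup>+x. ennreal (h x * ?p x / k) \<partial>lborel) = (\<integral>\<^sup>+x. ennreal (?p x) * ennreal (h x / k) \<partial>lborel)"
      using h k by (intro nn_integral_cong) (simp add: mult.commute flip: ennreal_mult)
    also have "\<dots> = (\<integral>\<^sup>+x. ennreal (h x / k) \<partial>std_normal_distribution)"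
      by (subst nn_integral_density) auto
    also have "\<dots> = ennreal (\<integral>x. h x / k \<partial>std_normal_distribution)"
    proof -
      have "h x / k \<le> K / k" for x using h k by (intro divide_right_mono) auto
      then have "integrable std_normal_distribution (\<lambda>x. h x / k)"
        using h k by (intro integrable_const_bound[where B="K / k"]) auto
      then show ?thesis using h k by (intro nn_integral_eq_integral) auto
    qed
    finally show ?thesis by simp
  qed
  define F where "F = (\<integral>x. f x \<partial>std_normal_distribution)"
  define G where "G = (\<integral>x. g x \<partial>std_normal_distribution)"
  have FG: "0 \<le> F" "0 \<le> G" unfolding F_def G_def using f g by (auto intro!: integral_nonneg)
  have "ennreal l * ennreal (F / a) + ennreal (1 - l) * ennreal (G / b)
    = ennreal l * (\<integral>\<^sup>+s. emeasure lborel {x. s < u x / a} * indicator {0<..<1} s \<partial>lborel)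
      + ennreal (1 - l) * (\<integral>\<^sup>+s. emeasure lborel {x. s < v x / b} * indicator {0<..<1} s \<partial>lborel)"
    using int_fg[of f a] int_fg[of g b] f g ab uv ua vb
    by (subst (1 2) nn_integral_unit_le) (auto simp: u_def v_def F_def G_def divide_le_eq)
  also have "\<dots> = (\<integral>\<^sup>+s. (ennreal l * emeasure lborel {x. s < u x / a}
      + ennreal (1 - l) * emeasure lborel {x. s < v x / b}) * indicator {0<..<1} s \<partial>lborel)"
    by (simp add: distrib_right mult.assoc nn_integral_add nn_integral_cmult)
  also have "\<dots> \<le> (\<integral>\<^sup>+s. emeasure lborel {x. s < ?p x / c} * indicator {0<..<1} s \<partial>lborel)"
    using level by (intro nn_integral_mono) (auto simp: indicator_def)
  \<comment> \<open>\<open>?p x / c\<close> may exceed 1, so the layer-cake formula yields its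
    truncation, which is at most the function itself.\<close>
  also have "\<dots> \<le> (\<integral>\<^sup>+x. ennreal (?p x / c) \<partial>lborel)"
    using c by (subst layer_cake_unit) (auto intro!: nn_integral_mono ennreal_leI)
  finally have "ennreal l * ennreal (F / a) + ennreal (1 - l) * ennreal (G / b) \<le> ennreal (1 / c)"
    unfolding int_p .
  then have sum: "l * (F / a) + (1 - l) * (G / b) \<le> 1 / c"
    using l FG ab c by (simp flip: ennreal_mult ennreal_plus)
  show ?thesis
  proof (cases "F = 0 \<or> G = 0")
    case True then show ?thesis by (auto simp flip: F_def G_def)
  next
    case False
    \<comment> \<open>Weighted AM-GM turns the additive bound into the multiplicative one; the
      suprema then cancel against \<open>c\<close>.\<close>
    then have "(F / a) powr l * (G / b) powr (1 - l) \<le> l * (F / a) + (1 - l) * (G / b)"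
      using FG ab l by (intro Youngs_inequality_0) auto
    with sum have "(F / a) powr l * (G / b) powr (1 - l) \<le> 1 / c" by linarith
    moreover have "(F / a) powr l * (G / b) powr (1 - l) = F powr l * G powr (1 - l) / c"
      using FG ab by (simp add: powr_divide c_def)
    ultimately show ?thesis using c by (simp add: F_def G_def divide_le_cancel)
  qed
qed

lemma std_normal_prekopa_leindler_1D:
  fixes f g :: "real \<Rightarrow> real"
  assumes "f \<in> borel_measurable borel" "g \<in> borel_measurable borel"
    and "\<And>x. 0 \<le> f x" "\<And>x. f x \<le> K" "\<And>x. 0 \<le> g x" "\<And>x. g x \<le> K"
    and l: "0 < l" "l < 1"
    and "\<And>x y. f x powr l * g y powr (1 - l) \<le> exp (l * (1 - l) * (x - y)\<^sup>2 / 2)"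
  shows "(\<integral>x. f x \<partial>std_normal_distribution) powr l
    * (\<integral>x. g x \<partial>std_normal_distribution) powr (1 - l) \<le> 1"
proof (cases "(\<forall>x. f x = 0) \<or> (\<forall>y. g y = 0)")
  case True then show ?thesis by auto
next
  case False
  then obtain x y where "f x \<noteq> 0" "g y \<noteq> 0" by auto
  then show ?thesis using std_normal_prekopa_leindler_1D_aux[of f g K l x y] assms by blast
qed

text \<open>Tensorisation: integrating out one coordinate produces \<open>f'\<close> and
  \<open>g'\<close>, and the one-dimensional inequality in that coordinate yields the hypothesis for
  this pair in the remaining ones. The hypothesis is restricted to extensional functions because
  these make up the space of \<open>PiM\<close>.\<close>

lemma std_normal_PiM_prekopa_leindler:
  fixes f g :: "('i \<Rightarrow> real) \<Rightarrow> real"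
  assumes "finite I" and l: "0 < l" "l < 1"
    and "f \<in> borel_measurable (PiM I (\<lambda>_. std_normal_distribution))"
    and "g \<in> borel_measurable (PiM I (\<lambda>_. std_normal_distribution))"
    and "\<And>x. 0 \<le> f x" "\<And>x. f x \<le> K" "\<And>x. 0 \<le> g x" "\<And>x. g x \<le> K"
    and "\<And>x y. x \<in> extensional I \<Longrightarrow> y \<in> extensional I \<Longrightarrow>
      f x powr l * g y powr (1 - l) \<le> exp (l * (1 - l) * (\<Sum>i\<in>I. (x i - y i)\<^sup>2) / 2)"
  shows "(\<integral>x. f x \<partial>PiM I (\<lambda>_. std_normal_distribution)) powr l
    * (\<integral>x. g x \<partial>PiM I (\<lambda>_. std_normal_distribution)) powr (1 - l) \<le> 1"
  using assms(1,4-)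
proof (induction I arbitrary: f g)
  case empty
  \<comment> \<open>The empty product is a unit mass at the function that is
    \<open>undefined\<close> everywhere.\<close>
  have *: "(\<integral>x. h x \<partial>PiM {} (\<lambda>_. std_normal_distribution)) = h (\<lambda>_. undefined)" for h :: "('i \<Rightarrow> real) \<Rightarrow> real"
    by (simp add: PiM_empty lebesgue_integral_count_space_finite)
  show ?case unfolding * using empty.prems(7)[of "\<lambda>_. undefined" "\<lambda>_. undefined"] by simp
next
  case (insert i I f g)
  let ?N = "\<lambda>_. std_normal_distribution"
  interpret N: real_distribution std_normal_distribution by (rule real_dist_normal_dist)
  interpret product_sigma_finite ?N
    by standard
  interpret PI: prob_space "PiM (insert i I) ?N" by (rule prob_space_PiM) (rule N.prob_space_axioms)
  note [measurable] = insert.prems(1,2)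
  have upd: "(\<lambda>y. x(i := y)) \<in> measurable std_normal_distribution (PiM (insert i I) ?N)"
    if "x \<in> extensional I" for x
    by (intro measurable_fun_upd[where J=I]) (use that in \<open>auto simp: space_PiM PiE_def\<close>)
  have ext: "x(i := y) \<in> extensional (insert i I)" if "x \<in> extensional I" for x :: "'i \<Rightarrow> real" and y
    using that by (auto simp: extensional_def)
  have upd2: "(\<lambda>(x, y). x(i := y)) \<in> measurable (PiM I ?N \<Otimes>\<^sub>M std_normal_distribution) (PiM (insert i I) ?N)"
    by (rule measurable_add_dim)
  define f' where "f' x = (\<integral>y. f (x(i := y)) \<partial>std_normal_distribution)" for x
  define g' where "g' x = (\<integral>y. g (x(i := y)) \<partial>std_normal_distribution)" for x
  have meas: "f' \<in> borel_measurable (PiM I ?N)" "g' \<in> borel_measurable (PiM I ?N)"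
    unfolding f'_def g'_def
    using measurable_compose[OF upd2 insert.prems(1)] measurable_compose[OF upd2 insert.prems(2)]
    by (auto intro!: N.borel_measurable_lebesgue_integral simp: case_prod_unfold)
  have int: "(\<integral>x. f x \<partial>PiM (insert i I) ?N) = (\<integral>x. f' x \<partial>PiM I ?N)"
    "(\<integral>x. g x \<partial>PiM (insert i I) ?N) = (\<integral>x. g' x \<partial>PiM I ?N)"
    unfolding f'_def g'_def using insert.prems insert.hyps
    by (auto intro!: product_integral_insert PI.integrable_const_bound[where B=K])
  have K: "K \<ge> 0" using insert.prems(3,4)[of undefined] by linarith
  \<comment> \<open>The bounds on \<open>f'\<close> and \<open>g'\<close> are required at all
    arguments, also at nonextensional ones, where measurability of the section is not known. A
    nonintegrable section has integral 0, which \<open>K \<ge> 0\<close> covers.\<close>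
  have upper: "(\<integral>y. h y \<partial>std_normal_distribution) \<le> K" if "\<And>y. h y \<le> K" for h :: "real \<Rightarrow> real"
  proof (cases "integrable std_normal_distribution h")
    case True
    have "(\<integral>y. h y \<partial>std_normal_distribution) \<le> (\<integral>y. K \<partial>std_normal_distribution)"
      using True that by (intro integral_mono) auto
    then show ?thesis using N.prob_space by simp
  next
    case False then show ?thesis using K by (simp add: not_integrable_integral_eq)
  qed
  show ?case unfolding int
  proof (rule insert.IH[OF meas])
    fix x y :: "'i \<Rightarrow> real"
    show "0 \<le> f' x" "0 \<le> g' x" "f' x \<le> K" "g' x \<le> K"
      unfolding f'_def g'_def using insert.prems by (auto intro!: integral_nonneg upper)
    assume xy: "x \<in> extensional I" "y \<in> extensional I"
    define D where "D = (\<Sum>j\<in>I. (x j - y j)\<^sup>2)"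
    \<comment> \<open>\<open>k powr (1 - l) = exp (- l * (1 - l) * D / 2)\<close> removes the
      contribution of the other coordinates from the exponent. Scaling \<open>g\<close> by
      \<open>k \<le> 1\<close> preserves the bound \<open>K\<close>.\<close>
    define k where "k = exp (- l * D / 2)"
    have D: "D \<ge> 0" by (simp add: D_def sum_nonneg)
    have k: "0 < k" "k \<le> 1" using D l by (auto simp: k_def)
    have "(\<integral>s. f (x(i := s)) \<partial>std_normal_distribution) powr l
      * (\<integral>s. k * g (y(i := s)) \<partial>std_normal_distribution) powr (1 - l) \<le> 1"
    proof (rule std_normal_prekopa_leindler_1D[where K=K, OF _ _ _ _ _ _ l])
      show "(\<lambda>s. f (x(i := s))) \<in> borel_measurable borel" "(\<lambda>s. k * g (y(i := s))) \<in> borel_measurable borel"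
        using measurable_compose[OF upd[OF xy(1)] insert.prems(1)]
          borel_measurable_times[OF borel_measurable_const measurable_compose[OF upd[OF xy(2)] insert.prems(2)], of k]
        unfolding measurable_density_eq1 measurable_lborel2 .
      fix s r
      show "0 \<le> f (x(i := s))" "f (x(i := s)) \<le> K" "0 \<le> k * g (y(i := s))"
        using insert.prems k by auto
      show "k * g (y(i := s)) \<le> K"
        using insert.prems(5)[of "y(i:=s)"] insert.prems(6)[of "y(i:=s)"] k mult_left_le_one_le[of "g (y(i := s))" k]
        by linarith
      have "(\<Sum>j\<in>insert i I. ((x(i := s)) j - (y(i := r)) j)\<^sup>2) = (s - r)\<^sup>2 + D"
      proof -
        have "(\<Sum>j\<in>I. ((x(i := s)) j - (y(i := r)) j)\<^sup>2) = D"
          unfolding D_def using insert.hyps by (intro sum.cong) auto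
        then show ?thesis using insert.hyps by simp
      qed
      then have "f (x(i := s)) powr l * g (y(i := r)) powr (1 - l) \<le> exp (l * (1 - l) * ((s - r)\<^sup>2 + D) / 2)"
        using insert.prems(7)[OF ext[OF xy(1), of s] ext[OF xy(2), of r]] by (simp only:)
      then have "k powr (1 - l) * (f (x(i := s)) powr l * g (y(i := r)) powr (1 - l))
        \<le> exp (- l * D / 2 * (1 - l)) * exp (l * (1 - l) * ((s - r)\<^sup>2 + D) / 2)"
        unfolding k_def exp_powr_real by (intro mult_left_mono) auto
      also have "\<dots> = exp (l * (1 - l) * (s - r)\<^sup>2 / 2)"
        unfolding exp_add[symmetric] by (simp add: field_simps)
      finally show "f (x(i := s)) powr l * (k * g (y(i := r))) powr (1 - l) \<le> exp (l * (1 - l) * (s - r)\<^sup>2 / 2)"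
        using k insert.prems(5) by (simp add: powr_mult mult_ac)
    qed
    then have "f' x powr l * (k * g' y) powr (1 - l) \<le> 1" by (simp add: f'_def g'_def)
    moreover have "0 \<le> g' y" unfolding g'_def using insert.prems by (auto intro!: integral_nonneg)
    ultimately have "(f' x powr l * g' y powr (1 - l)) * k powr (1 - l) \<le> 1"
      using k by (simp add: powr_mult mult_ac)
    then have "f' x powr l * g' y powr (1 - l) \<le> 1 / k powr (1 - l)"
      using k by (simp add: field_simps)
    also have "1 / k powr (1 - l) = exp (l * (1 - l) * D / 2)"
      unfolding k_def exp_powr_real by (simp add: field_simps exp_minus flip: exp_diff)
    finally show "f' x powr l * g' y powr (1 - l) \<le> exp (l * (1 - l) * (\<Sum>i\<in>I. (x i - y i)\<^sup>2) / 2)"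
      by (simp add: D_def)
  qed
qed

text \<open>Cauchy-Schwarz puts the set where all forms are at most \<eta> at Euclidean distance at
  least (1 - \<eta>) / \<sigma> from the set where some form exceeds 1. Prekopa-Leindler for the
  indicators of two separated sets bounds a product of powers of their measures.\<close>

lemma std_normal_PiM_concentration:
  fixes a :: "'t \<Rightarrow> 'i \<Rightarrow> real"
  defines "P I \<equiv> PiM I (\<lambda>_. std_normal_distribution)"
  assumes fin: "finite I" "finite F" and l: "0 < l" "l < 1" and \<sigma>: "\<sigma> > 0" and \<eta>: "\<eta> < 1"
    and a: "\<And>t. t \<in> F \<Longrightarrow> (\<Sum>i\<in>I. (a t i)\<^sup>2) \<le> \<sigma>\<^sup>2"
    and half: "measure (P I) {x \<in> space (P I). \<forall>t\<in>F. (\<Sum>i\<in>I. a t i * x i) \<le> \<eta>} \<ge> 1 / 2"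
  shows "measure (P I) {x \<in> space (P I). \<exists>t\<in>F. (\<Sum>i\<in>I. a t i * x i) > 1}
    \<le> 2 powr (l / (1 - l)) * exp (- l * (1 - \<eta>)\<^sup>2 / (2 * \<sigma>\<^sup>2))"
proof -
  interpret prob_space "P I"
    unfolding P_def by (rule prob_space_PiM) (simp add: prob_space_normal_density)
  define A where "A = {x \<in> space (P I). \<forall>t\<in>F. (\<Sum>i\<in>I. a t i * x i) \<le> \<eta>}"
  define B where "B = {x \<in> space (P I). \<exists>t\<in>F. (\<Sum>i\<in>I. a t i * x i) > 1}"
  have lin [measurable]: "(\<lambda>x. \<Sum>i\<in>I. a t i * x i) \<in> borel_measurable (P I)" for t
    unfolding P_def
    by (intro borel_measurable_sum borel_measurable_times borel_measurable_const)
      (auto intro!: measurable_compose[OF measurable_component_singleton])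
  have [measurable]: "A \<in> events" "B \<in> events"
    unfolding A_def B_def using fin by (auto intro!: sets.sets_Collect_finite_All sets.sets_Collect_finite_Ex)
  define r where "r = (1 - \<eta>)\<^sup>2 / \<sigma>\<^sup>2"
  \<comment> \<open>\<open>c powr (1 - l) = exp (l * (1 - l) * r / 2)\<close> is the largest factor
    that the squared separation \<open>r\<close> permits in the Prekopa-Leindler hypothesis.\<close>
  define c where "c = exp (l * r / 2)"
  have r: "r \<ge> 0" by (simp add: r_def)
  have c: "c \<ge> 1" using r l by (simp add: c_def)
  have dist: "(\<Sum>i\<in>I. (x i - y i)\<^sup>2) \<ge> r" if x: "x \<in> A" and y: "y \<in> B" for x y
  proof -
    obtain t where t: "t \<in> F" "(\<Sum>i\<in>I. a t i * y i) > 1" using y by (auto simp: B_def)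
    have "(\<Sum>i\<in>I. a t i * x i) \<le> \<eta>" using x t by (auto simp: A_def)
    then have "1 - \<eta> \<le> (\<Sum>i\<in>I. a t i * (y i - x i))"
      using t(2) by (simp add: right_diff_distrib sum_subtractf)
    then have "(1 - \<eta>)\<^sup>2 \<le> (\<Sum>i\<in>I. a t i * (y i - x i))\<^sup>2" using \<eta> by (intro power_mono) auto
    also have "\<dots> \<le> (\<Sum>i\<in>I. (a t i)\<^sup>2) * (\<Sum>i\<in>I. (y i - x i)\<^sup>2)" by (rule Cauchy_Schwarz_ineq_sum)
    also have "\<dots> \<le> \<sigma>\<^sup>2 * (\<Sum>i\<in>I. (y i - x i)\<^sup>2)" using a[OF t(1)] by (intro mult_right_mono sum_nonneg) auto
    finally show ?thesis using \<sigma> by (simp add: r_def field_simps power2_commute)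
  qed
  have "(\<integral>x. indicator A x \<partial>P I) powr l * (\<integral>x. c * indicator B x \<partial>P I) powr (1 - l) \<le> 1"
    unfolding P_def
  proof (rule std_normal_PiM_prekopa_leindler[where K=c, OF fin(1) l])
    fix x y :: "'i \<Rightarrow> real"
    show "indicat_real A x powr l * (c * indicat_real B y) powr (1 - l)
      \<le> exp (l * (1 - l) * (\<Sum>i\<in>I. (x i - y i)\<^sup>2) / 2)"
    proof (cases "x \<in> A \<and> y \<in> B")
      case True
      then have "l * (1 - l) * r / 2 \<le> l * (1 - l) * (\<Sum>i\<in>I. (x i - y i)\<^sup>2) / 2"
        using dist l by (intro divide_right_mono mult_left_mono) auto
      then show ?thesis using True by (simp add: c_def exp_powr_real mult_ac)
    qed (auto simp: indicator_def)
  qed (use c in \<open>auto simp: indicator_def simp flip: P_def\<close>)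
  then have "prob A powr l * (c * prob B) powr (1 - l) \<le> 1" by simp
  moreover have "(1 / 2) powr l \<le> prob A powr l"
    using half l unfolding A_def by (intro powr_mono2) auto
  ultimately have "(1 / 2) powr l * (c * prob B) powr (1 - l) \<le> 1"
    by (meson mult_right_mono order_trans powr_ge_zero)
  then have "(c * prob B) powr (1 - l) \<le> 2 powr l" by (simp add: powr_divide field_simps)
  \<comment> \<open>Solving for \<open>prob B\<close> puts the loss into
    \<open>2 powr (l / (1 - l))\<close>, free of \<open>r\<close>, while the exponent
    \<open>l * r / 2\<close> approaches the sharp \<open>r / 2\<close>.\<close>
  then have "((c * prob B) powr (1 - l)) powr (1 / (1 - l)) \<le> (2 powr l) powr (1 / (1 - l))"
    using l by (intro powr_mono2) auto
  then have "c * prob B \<le> 2 powr (l / (1 - l))"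
    using l c by (simp add: powr_powr)
  then have "prob B \<le> 2 powr (l / (1 - l)) * exp (- (l * r / 2))"
    using c by (simp add: c_def exp_minus field_simps)
  then show ?thesis unfolding B_def by (simp add: r_def mult.commute)
qed

section \<open>Vectors with a standard normal characteristic function\<close>

text \<open>A change of measure with two uses: trigonometric weights, to replace complex measures by
  probability laws, and the indicator of an event, to condition on it.\<close>

lemma (in prob_space) weighted_density:
  fixes g :: "'a \<Rightarrow> real"
  assumes [measurable]: "g \<in> borel_measurable M" and g: "\<And>\<omega>. 0 \<le> g \<omega>" "\<And>\<omega>. g \<omega> \<le> K"
    and e: "expectation g > 0"
  defines "D \<equiv> density M (\<lambda>\<omega>. ennreal (g \<omega> / expectation g))"
  shows "prob_space D"
    and "\<And>h :: 'a \<Rightarrow> 'b :: {banach, second_countable_topology}. h \<in> borel_measurable M \<Longrightarrow>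
      integral\<^sup>L D h = (\<integral>\<omega>. g \<omega> *\<^sub>R h \<omega> \<partial>M) /\<^sub>R expectation g"
proof -
  have int: "integrable M g" using g by (intro integrable_const_bound[where B=K]) auto
  show "prob_space D"
  proof
    have "emeasure D (space D) = (\<integral>\<^sup>+\<omega>. ennreal (g \<omega> / expectation g) \<partial>M)"
      unfolding D_def by (simp add: emeasure_density cong: nn_integral_cong)
    also have "\<dots> = ennreal (\<integral>\<omega>. g \<omega> / expectation g \<partial>M)"
      using g e int by (intro nn_integral_eq_integral) auto
    finally show "emeasure D (space D) = 1" using e by simp
  qed
  fix h :: "'a \<Rightarrow> 'b" assume [measurable]: "h \<in> borel_measurable M"
  have "integral\<^sup>L D h = (\<integral>\<omega>. (g \<omega> / expectation g) *\<^sub>R h \<omega> \<partial>M)"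
    unfolding D_def using g e by (intro integral_density) auto
  also have "\<dots> = (\<integral>\<omega>. (1 / expectation g) *\<^sub>R (g \<omega> *\<^sub>R h \<omega>) \<partial>M)"
    by (intro Bochner_Integration.integral_cong) auto
  finally show "integral\<^sup>L D h = (\<integral>\<omega>. g \<omega> *\<^sub>R h \<omega> \<partial>M) /\<^sub>R expectation g"
    by (simp only: integral_scaleR_right inverse_eq_divide)
qed

text \<open>Under the reweighted measure \<open>Y\<close> has the standard normal characteristic
  function, so Levy uniqueness identifies its law there.\<close>

lemma (in prob_space) weighted_std_normal:
  fixes g Y :: "'a \<Rightarrow> real"
  assumes [measurable]: "g \<in> borel_measurable M" "Y \<in> borel_measurable M" "B \<in> sets borel"
    and g: "\<And>\<omega>. 0 \<le> g \<omega>" "\<And>\<omega>. g \<omega> \<le> K"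
    and e: "expectation g > 0"
    and char: "\<And>s. (\<integral>\<omega>. g \<omega> *\<^sub>R iexp (s * Y \<omega>) \<partial>M) = expectation g * exp (- s\<^sup>2 / 2)"
  shows "expectation (\<lambda>\<omega>. g \<omega> * indicator B (Y \<omega>)) = expectation g * measure std_normal_distribution B"
proof -
  define D where "D = density M (\<lambda>\<omega>. ennreal (g \<omega> / expectation g))"
  interpret D: prob_space D unfolding D_def using weighted_density(1)[OF assms(1) g e] .
  note int = weighted_density(2)[OF assms(1) g e, folded D_def]
  have [measurable]: "Y \<in> borel_measurable D" by (simp add: D_def)
  have "distr D borel Y = std_normal_distribution"
  proof (rule Levy_uniqueness)
    show "real_distribution (distr D borel Y)"
      unfolding real_distribution_def real_distribution_axioms_def using D.prob_space_distr[of Y borel] by simp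
    have "char (distr D borel Y) s = char std_normal_distribution s" for s
    proof -
      have "char (distr D borel Y) s = (\<integral>\<omega>. iexp (s * Y \<omega>) \<partial>D)"
        unfolding char_def by (subst integral_distr) simp_all
      also have "\<dots> = (\<integral>\<omega>. g \<omega> *\<^sub>R iexp (s * Y \<omega>) \<partial>M) /\<^sub>R expectation g" by (subst int) simp_all
      also have "\<dots> = exp (- s\<^sup>2 / 2)" unfolding char using e by (simp add: scaleR_conv_of_real)
      finally show ?thesis by (simp add: char_std_normal_distribution)
    qed
    then show "char (distr D borel Y) = char std_normal_distribution" ..
  qed (rule real_dist_normal_dist)
  then have "measure std_normal_distribution B = measure (distr D borel Y) B" by simp
  also have "\<dots> = (\<integral>y. indicator B y \<partial>distr D borel Y)" by simp
  also have "\<dots> = (\<integral>\<omega>. indicator B (Y \<omega>) \<partial>D)" by (subst integral_distr) auto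
  also have "\<dots> = (\<integral>\<omega>. g \<omega> *\<^sub>R indicator B (Y \<omega>) \<partial>M) /\<^sub>R expectation g" by (subst int) simp_all
  finally show ?thesis using e by (simp add: field_simps)
qed

text \<open>The laws of \<open>Y\<close> weighted by \<open>1 + cos U\<close> and \<open>1 + sin U\<close> are determined by one-dimensional
  characteristic functions; subtracting the unweighted law leaves the real and imaginary parts.\<close>

lemma (in prob_space) iexp_indicator_factor:
  fixes U Y :: "'a \<Rightarrow> real"
  assumes [measurable]: "U \<in> borel_measurable M" "Y \<in> borel_measurable M" "B \<in> sets borel"
    and char: "\<And>r s. (\<integral>\<omega>. iexp (r * U \<omega> + s * Y \<omega>) \<partial>M) = exp (- (r\<^sup>2 * v + s\<^sup>2) / 2)"
  shows "(\<integral>\<omega>. indicator B (Y \<omega>) *\<^sub>R iexp (U \<omega>) \<partial>M)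
    = exp (- v / 2) * measure std_normal_distribution B"
proof -
  define c where "c = exp (- v / 2)"
  have c: "c > 0" by (simp add: c_def)
  have I [simp]: "integrable M (\<lambda>\<omega>. iexp (f \<omega>))" if [measurable]: "f \<in> borel_measurable M" for f :: "'a \<Rightarrow> real"
    by (intro integrable_const_bound[where B=1]) auto
  \<comment> \<open>Euler's formulas express the weights through the cases \<open>r = 0\<close>,
    \<open>1\<close> and \<open>-1\<close>; in the sine the two factors \<open>c\<close>
    cancel.\<close>
  have i: "(\<integral>\<omega>. iexp (s * Y \<omega>) \<partial>M) = exp (- s\<^sup>2 / 2)"
    "(\<integral>\<omega>. iexp (U \<omega> + s * Y \<omega>) \<partial>M) = c * exp (- s\<^sup>2 / 2)"
    "(\<integral>\<omega>. iexp (- U \<omega> + s * Y \<omega>) \<partial>M) = c * exp (- s\<^sup>2 / 2)" for s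
    using char[of 0 s] char[of 1 s] char[of "-1" s]
    by (simp_all add: c_def add_divide_distrib flip: of_real_mult exp_add)
  have lin: "(\<integral>\<omega>. iexp (f \<omega>) + (iexp (g \<omega>) + a * iexp (h \<omega>)) / w \<partial>M)
    = (\<integral>\<omega>. iexp (f \<omega>) \<partial>M) + ((\<integral>\<omega>. iexp (g \<omega>) \<partial>M) + a * (\<integral>\<omega>. iexp (h \<omega>) \<partial>M)) / w"
    if [measurable]: "f \<in> borel_measurable M" "g \<in> borel_measurable M" "h \<in> borel_measurable M"
    for f g h :: "'a \<Rightarrow> real" and a w :: complex
    by (simp only: Bochner_Integration.integral_add integral_mult_right_zero integral_divide_zero
      I that Bochner_Integration.integrable_add integrable_mult_right integrable_divide)
  have c1: "(\<integral>\<omega>. (1 + cos (U \<omega>)) *\<^sub>R iexp (s * Y \<omega>) \<partial>M) = (1 + c) * exp (- s\<^sup>2 / 2)" for s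
  proof -
    have "(\<integral>\<omega>. (1 + cos (U \<omega>)) *\<^sub>R iexp (s * Y \<omega>) \<partial>M)
      = (\<integral>\<omega>. iexp (s * Y \<omega>) + (iexp (U \<omega> + s * Y \<omega>) + 1 * iexp (- U \<omega> + s * Y \<omega>)) / 2 \<partial>M)"
      by (intro Bochner_Integration.integral_cong refl)
        (simp add: scaleR_conv_of_real distrib_left distrib_right exp_add exp_diff
          exp_minus cos_exp_eq field_simps flip: cos_of_real)
    also have "\<dots> = exp (- s\<^sup>2 / 2) + (c * exp (- s\<^sup>2 / 2) + 1 * (c * exp (- s\<^sup>2 / 2))) / 2"
      by (subst lin) (simp_all only: i, measurable)
    finally show ?thesis by (simp add: distrib_right)
  qed
  have s1: "(\<integral>\<omega>. (1 + sin (U \<omega>)) *\<^sub>R iexp (s * Y \<omega>) \<partial>M) = exp (- s\<^sup>2 / 2)" for s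
  proof -
    have "(\<integral>\<omega>. (1 + sin (U \<omega>)) *\<^sub>R iexp (s * Y \<omega>) \<partial>M)
      = (\<integral>\<omega>. iexp (s * Y \<omega>) + (iexp (U \<omega> + s * Y \<omega>) + - 1 * iexp (- U \<omega> + s * Y \<omega>)) / (2 * \<i>) \<partial>M)"
      by (intro Bochner_Integration.integral_cong refl)
        (simp add: scaleR_conv_of_real distrib_left distrib_right exp_add exp_diff
          exp_minus sin_exp_eq field_simps flip: sin_of_real)
    also have "\<dots> = exp (- s\<^sup>2 / 2) + (c * exp (- s\<^sup>2 / 2) + - 1 * (c * exp (- s\<^sup>2 / 2))) / (2 * \<i>)"
      by (subst lin) (simp_all only: i, measurable)
    finally show ?thesis by simp
  qed
  have of_real_int: "complex_of_real (expectation f) = (\<integral>\<omega>. f \<omega> *\<^sub>R iexp (0 * Y \<omega>) \<partial>M)" for f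
    by (simp add: scaleR_conv_of_real)
  have "complex_of_real (expectation (\<lambda>\<omega>. 1 + cos (U \<omega>))) = complex_of_real (1 + c)"
    "complex_of_real (expectation (\<lambda>\<omega>. 1 + sin (U \<omega>))) = complex_of_real 1"
    unfolding of_real_int c1 s1 by simp_all
  then have e: "expectation (\<lambda>\<omega>. 1 + cos (U \<omega>)) = 1 + c" "expectation (\<lambda>\<omega>. 1 + sin (U \<omega>)) = 1"
    unfolding of_real_eq_iff .
  have ge: "0 \<le> 1 + cos x" "0 \<le> 1 + sin x" "1 + cos x \<le> 2" "1 + sin x \<le> 2" for x :: real
    using cos_ge_minus_one[of x] sin_ge_minus_one[of x] cos_le_one[of x] sin_le_one[of x] by linarith+
  let ?g = "measure std_normal_distribution B"
  have w: "expectation (\<lambda>\<omega>. (1 + cos (U \<omega>)) * indicator B (Y \<omega>)) = (1 + c) * ?g"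
    "expectation (\<lambda>\<omega>. (1 + sin (U \<omega>)) * indicator B (Y \<omega>)) = ?g"
    "expectation (\<lambda>\<omega>. 1 * indicator B (Y \<omega>)) = ?g"
    using weighted_std_normal[of "\<lambda>\<omega>. 1 + cos (U \<omega>)" Y B 2]
      weighted_std_normal[of "\<lambda>\<omega>. 1 + sin (U \<omega>)" Y B 2]
      weighted_std_normal[of "\<lambda>\<omega>. 1" Y B 1] c1 s1 i(1) e ge c
    by (simp_all add: prob_space)
  have Ib: "integrable M (\<lambda>\<omega>. f \<omega> * indicator B (Y \<omega>))"
    if [measurable]: "f \<in> borel_measurable M" and "\<And>\<omega>. \<bar>f \<omega>\<bar> \<le> 2" for f :: "'a \<Rightarrow> real"
    using that by (intro integrable_const_bound[where B=2]) (auto simp: indicator_def)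
  have J: "integrable M (\<lambda>\<omega>. (1 + cos (U \<omega>)) * indicator B (Y \<omega>))"
    "integrable M (\<lambda>\<omega>. (1 + sin (U \<omega>)) * indicator B (Y \<omega>))"
    "integrable M (\<lambda>\<omega>. 1 * indicat_real B (Y \<omega>))"
    using ge by (intro Ib[of "\<lambda>\<omega>. 1 + cos (U \<omega>)"] Ib[of "\<lambda>\<omega>. 1 + sin (U \<omega>)"] Ib[of "\<lambda>\<omega>. 1"]; simp)+
  have "expectation (\<lambda>\<omega>. cos (U \<omega>) * indicator B (Y \<omega>))
    = expectation (\<lambda>\<omega>. (1 + cos (U \<omega>)) * indicator B (Y \<omega>) - 1 * indicator B (Y \<omega>))"
    by (simp add: algebra_simps)
  also have "\<dots> = c * ?g"
    unfolding Bochner_Integration.integral_diff[OF J(1,3)] w by (simp add: algebra_simps)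
  finally have C: "expectation (\<lambda>\<omega>. cos (U \<omega>) * indicator B (Y \<omega>)) = c * ?g" .
  have "expectation (\<lambda>\<omega>. sin (U \<omega>) * indicator B (Y \<omega>))
    = expectation (\<lambda>\<omega>. (1 + sin (U \<omega>)) * indicator B (Y \<omega>) - 1 * indicator B (Y \<omega>))"
    by (simp add: algebra_simps)
  also have "\<dots> = 0"
    unfolding Bochner_Integration.integral_diff[OF J(2,3)] w by simp
  finally have S: "expectation (\<lambda>\<omega>. sin (U \<omega>) * indicator B (Y \<omega>)) = 0" .
  have "(\<integral>\<omega>. indicator B (Y \<omega>) *\<^sub>R iexp (U \<omega>) \<partial>M)
    = (\<integral>\<omega>. complex_of_real (cos (U \<omega>) * indicator B (Y \<omega>))
       + \<i> * complex_of_real (sin (U \<omega>) * indicator B (Y \<omega>)) \<partial>M)"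
    by (intro Bochner_Integration.integral_cong refl)
      (simp add: indicator_def cis_conv_exp[symmetric] complex_eq_iff)
  also have "\<dots> = complex_of_real (expectation (\<lambda>\<omega>. cos (U \<omega>) * indicator B (Y \<omega>)))
       + \<i> * complex_of_real (expectation (\<lambda>\<omega>. sin (U \<omega>) * indicator B (Y \<omega>)))"
    by (subst Bochner_Integration.integral_add)
      (auto intro!: integrable_of_real integrable_mult_right Ib order_trans[OF abs_cos_le_one] order_trans[OF abs_sin_le_one]
       simp del: of_real_mult)
  finally show ?thesis unfolding C S by (simp add: c_def)
qed

text \<open>Conditioning on the event that one coordinate lies in its set preserves the hypothesis for the
  remaining coordinates, which makes the induction work for all probability spaces at once.\<close>

lemma std_normal_vector_prob:
  fixes \<xi> :: "'i \<Rightarrow> 'a \<Rightarrow> real"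
  assumes "finite I" "prob_space M" "\<And>i. i \<in> I \<Longrightarrow> \<xi> i \<in> borel_measurable M"
    and "\<And>\<theta>. (\<integral>\<omega>. iexp (\<Sum>i\<in>I. \<theta> i * \<xi> i \<omega>) \<partial>M) = exp (- (\<Sum>i\<in>I. (\<theta> i)\<^sup>2) / 2)"
    and B: "\<And>i. i \<in> I \<Longrightarrow> B i \<in> sets borel"
  shows "measure M {\<omega> \<in> space M. \<forall>i\<in>I. \<xi> i \<omega> \<in> B i} = (\<Prod>i\<in>I. measure std_normal_distribution (B i))"
  using assms
proof (induction I arbitrary: M)
  case empty
  then show ?case by (simp add: prob_space.prob_space)
next
  case (insert k I M)
  interpret prob_space M by fact
  note [measurable] = insert.prems(2)[of k, simplified]
  have [measurable]: "\<xi> i \<in> borel_measurable M" if "i \<in> I" for i using insert.prems(2) that by simp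
  have [measurable]: "B k \<in> sets borel" "\<And>i. i \<in> I \<Longrightarrow> B i \<in> sets borel" using insert.prems(4) by auto
  have factor: "(\<integral>\<omega>. indicator (B k) (\<xi> k \<omega>) *\<^sub>R iexp (\<Sum>i\<in>I. \<theta> i * \<xi> i \<omega>) \<partial>M)
    = exp (- (\<Sum>i\<in>I. (\<theta> i)\<^sup>2) / 2) * measure std_normal_distribution (B k)" for \<theta>
  proof (rule iexp_indicator_factor)
    fix r s :: real
    \<comment> \<open>A combination of \<open>\<xi> k\<close> with a multiple of one fixed linear
      form in the others is again a linear form, so the hypothesis supplies the joint characteristic
      function that \<open>iexp_indicator_factor\<close> asks for.\<close>
    have eq: "(\<Sum>i\<in>insert k I. ((\<lambda>i. r * \<theta> i)(k := s)) i * \<xi> i \<omega>) = r * (\<Sum>i\<in>I. \<theta> i * \<xi> i \<omega>) + s * \<xi> k \<omega>" for \<omega>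
    proof -
      have "(\<Sum>i\<in>I. ((\<lambda>i. r * \<theta> i)(k := s)) i * \<xi> i \<omega>) = (\<Sum>i\<in>I. r * (\<theta> i * \<xi> i \<omega>))"
        using insert.hyps by (intro sum.cong) auto
      then show ?thesis using insert.hyps by (simp add: sum_distrib_left)
    qed
    have eq2: "(\<Sum>i\<in>insert k I. (((\<lambda>i. r * \<theta> i)(k := s)) i)\<^sup>2) = r\<^sup>2 * (\<Sum>i\<in>I. (\<theta> i)\<^sup>2) + s\<^sup>2"
    proof -
      have "(\<Sum>i\<in>I. (((\<lambda>i. r * \<theta> i)(k := s)) i)\<^sup>2) = (\<Sum>i\<in>I. r\<^sup>2 * (\<theta> i)\<^sup>2)"
        using insert.hyps by (intro sum.cong) (auto simp: power_mult_distrib)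
      then show ?thesis using insert.hyps by (simp add: sum_distrib_left)
    qed
    show "(\<integral>\<omega>. iexp (r * (\<Sum>i\<in>I. \<theta> i * \<xi> i \<omega>) + s * \<xi> k \<omega>) \<partial>M)
      = exp (- (r\<^sup>2 * (\<Sum>i\<in>I. (\<theta> i)\<^sup>2) + s\<^sup>2) / 2)"
      using insert.prems(3)[of "(\<lambda>i. r * \<theta> i)(k := s)"] unfolding eq eq2 .
  qed auto
  define p where "p = measure std_normal_distribution (B k)"
  define g where "g \<omega> = indicat_real (B k) (\<xi> k \<omega>)" for \<omega>
  have [measurable]: "g \<in> borel_measurable M" unfolding g_def by measurable
  have g: "0 \<le> g \<omega>" "g \<omega> \<le> 1" for \<omega> by (auto simp: g_def)
  have Eg: "expectation g = p"
  proof -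
    have "complex_of_real (expectation g) = complex_of_real p"
      using factor[of "\<lambda>_. 0"] by (simp add: g_def[abs_def] p_def scaleR_conv_of_real)
    then show ?thesis by (simp only: of_real_eq_iff)
  qed
  define A where "A = {\<omega> \<in> space M. \<forall>i\<in>I. \<xi> i \<omega> \<in> B i}"
  have [measurable]: "A \<in> events" unfolding A_def using insert.hyps
    by (intro sets.sets_Collect_finite_All) measurable
  have split: "measure M {\<omega> \<in> space M. \<forall>i\<in>insert k I. \<xi> i \<omega> \<in> B i} = expectation (\<lambda>\<omega>. g \<omega> *\<^sub>R indicat_real A \<omega>)"
  proof -
    have "{\<omega> \<in> space M. \<forall>i\<in>insert k I. \<xi> i \<omega> \<in> B i} = {\<omega> \<in> space M. \<xi> k \<omega> \<in> B k} \<inter> A"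
      by (auto simp: A_def)
    moreover have "{\<omega> \<in> space M. \<xi> k \<omega> \<in> B k} \<inter> A \<in> events" by measurable
    ultimately have "measure M {\<omega> \<in> space M. \<forall>i\<in>insert k I. \<xi> i \<omega> \<in> B i}
      = expectation (indicator ({\<omega> \<in> space M. \<xi> k \<omega> \<in> B k} \<inter> A))" by simp
    also have "\<dots> = expectation (\<lambda>\<omega>. g \<omega> *\<^sub>R indicat_real A \<omega>)"
      by (intro Bochner_Integration.integral_cong refl) (auto simp: g_def indicator_def)
    finally show ?thesis .
  qed
  show ?case
  proof (cases "p = 0")
    \<comment> \<open>An event of probability zero cannot be conditioned on; here both sides
      vanish.\<close>
    case True
    have "expectation (\<lambda>\<omega>. g \<omega> *\<^sub>R indicat_real A \<omega>) \<le> expectation g"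
      using g by (intro integral_mono integrable_const_bound[where B=1]) (auto simp: indicator_def)
    moreover have "expectation (\<lambda>\<omega>. g \<omega> *\<^sub>R indicat_real A \<omega>) \<ge> 0"
      using g by (intro Bochner_Integration.integral_nonneg) auto
    ultimately show ?thesis using True insert.hyps unfolding split Eg by (simp flip: p_def)
  next
    case False
    then have p: "p > 0" unfolding p_def by (simp add: less_le)
    define D where "D = density M (\<lambda>\<omega>. ennreal (g \<omega> / expectation g))"
    have e: "expectation g > 0" using p Eg by simp
    note wd = weighted_density[OF _ g e, folded D_def, simplified]
    have "measure D {\<omega> \<in> space D. \<forall>i\<in>I. \<xi> i \<omega> \<in> B i} = (\<Prod>i\<in>I. measure std_normal_distribution (B i))"
    proof (rule insert.IH)
      show "prob_space D" by (rule wd(1)) measurable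
      show "\<xi> i \<in> borel_measurable D" if "i \<in> I" for i using that by (simp add: D_def)
      show "B i \<in> sets borel" if "i \<in> I" for i using that by simp
      fix \<theta>
      have "(\<integral>\<omega>. iexp (\<Sum>i\<in>I. \<theta> i * \<xi> i \<omega>) \<partial>D) = (\<integral>\<omega>. g \<omega> *\<^sub>R iexp (\<Sum>i\<in>I. \<theta> i * \<xi> i \<omega>) \<partial>M) /\<^sub>R expectation g"
        by (rule wd(2)) measurable
      also have "\<dots> = exp (- (\<Sum>i\<in>I. (\<theta> i)\<^sup>2) / 2)"
        unfolding g_def factor using p by (simp add: Eg[unfolded g_def] p_def[symmetric] scaleR_conv_of_real)
      finally show "(\<integral>\<omega>. iexp (\<Sum>i\<in>I. \<theta> i * \<xi> i \<omega>) \<partial>D) = exp (- (\<Sum>i\<in>I. (\<theta> i)\<^sup>2) / 2)" .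
    qed
    also have "{\<omega> \<in> space D. \<forall>i\<in>I. \<xi> i \<omega> \<in> B i} = A" by (simp add: D_def A_def)
    finally have "measure D A = (\<Prod>i\<in>I. measure std_normal_distribution (B i))" .
    moreover have "measure D A = expectation (\<lambda>\<omega>. g \<omega> *\<^sub>R indicat_real A \<omega>) / p"
    proof -
      interpret D: prob_space D by (rule wd(1)) measurable
      have "A \<in> sets D" by (simp add: D_def)
      then have "measure D A = integral\<^sup>L D (indicator A)" by simp
      also have "\<dots> = (\<integral>\<omega>. g \<omega> *\<^sub>R indicat_real A \<omega> \<partial>M) /\<^sub>R expectation g" by (rule wd(2)) measurable
      finally show ?thesis by (simp add: Eg field_simps)
    qed
    ultimately show ?thesis using insert.hyps p unfolding split by (simp add: field_simps flip: p_def)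
  qed
qed

lemma std_normal_vector_distr:
  fixes \<xi> :: "'i \<Rightarrow> 'a \<Rightarrow> real"
  assumes I: "finite I" and M: "prob_space M" and [measurable]: "\<And>i. i \<in> I \<Longrightarrow> \<xi> i \<in> borel_measurable M"
    and char: "\<And>\<theta>. (\<integral>\<omega>. iexp (\<Sum>i\<in>I. \<theta> i * \<xi> i \<omega>) \<partial>M) = exp (- (\<Sum>i\<in>I. (\<theta> i)\<^sup>2) / 2)"
  shows "distr M (PiM I (\<lambda>_. std_normal_distribution)) (\<lambda>\<omega>. \<lambda>i\<in>I. \<xi> i \<omega>) = PiM I (\<lambda>_. std_normal_distribution)"
proof -
  interpret prob_space M by fact
  interpret N: real_distribution std_normal_distribution by (rule real_dist_normal_dist)
  interpret product_sigma_finite "\<lambda>_. std_normal_distribution" by standard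
  have [measurable]: "\<xi> i \<in> measurable M std_normal_distribution" if "i \<in> I" for i
    using assms(3)[OF that] by simp
  have fm: "(\<lambda>\<omega>. \<lambda>i\<in>I. \<xi> i \<omega>) \<in> measurable M (PiM I (\<lambda>_. std_normal_distribution))"
    by measurable
  show ?thesis
  proof (rule PiM_eqI[OF I])
    fix A :: "'i \<Rightarrow> real set" assume A: "\<And>i. i \<in> I \<Longrightarrow> A i \<in> sets std_normal_distribution"
    then have "Pi\<^sub>E I A \<in> sets (PiM I (\<lambda>_. std_normal_distribution))" using I by (intro sets_PiM_I_finite) auto
    then have "emeasure (distr M (PiM I (\<lambda>_. std_normal_distribution)) (\<lambda>\<omega>. \<lambda>i\<in>I. \<xi> i \<omega>)) (Pi\<^sub>E I A)
      = emeasure M ((\<lambda>\<omega>. \<lambda>i\<in>I. \<xi> i \<omega>) -` Pi\<^sub>E I A \<inter> space M)"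
      by (rule emeasure_distr[OF fm])
    also have "(\<lambda>\<omega>. \<lambda>i\<in>I. \<xi> i \<omega>) -` Pi\<^sub>E I A \<inter> space M = {\<omega> \<in> space M. \<forall>i\<in>I. \<xi> i \<omega> \<in> A i}"
      by (auto simp: PiE_def Pi_def)
    also have "emeasure M \<dots> = ennreal (\<Prod>i\<in>I. measure std_normal_distribution (A i))"
      unfolding emeasure_eq_measure using std_normal_vector_prob[OF I M assms(3) char, of A] A by simp
    also have "\<dots> = (\<Prod>i\<in>I. emeasure std_normal_distribution (A i))"
      by (simp add: N.emeasure_eq_measure prod_ennreal)
    finally show "emeasure (distr M (PiM I (\<lambda>_. std_normal_distribution)) (\<lambda>\<omega>. \<lambda>i\<in>I. \<xi> i \<omega>)) (Pi\<^sub>E I A)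
      = (\<Prod>i\<in>I. emeasure std_normal_distribution (A i))" .
  qed simp
qed

section \<open>Tightness, quadratic programs and limits\<close>

text \<open>Continuity from above: the exceedance events decrease in the level and their
  intersection is null. Countability of \<open>S\<close> makes them measurable.\<close>

lemma (in prob_space) tight_countable:
  fixes f :: "'t \<Rightarrow> 'a \<Rightarrow> real"
  assumes S: "countable S" and meas: "\<And>t. t \<in> S \<Longrightarrow> f t \<in> borel_measurable M"
    and bdd: "AE \<omega> in M. bdd_above ((\<lambda>t. f t \<omega>) ` S)" and \<delta>: "\<delta> > 0"
  shows "\<exists>n::nat. prob {\<omega> \<in> space M. \<exists>t\<in>S. f t \<omega> > real n} < \<delta>"
proof -
  define A where "A n = {\<omega> \<in> space M. \<exists>t\<in>S. f t \<omega> > real n}" for n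
  have A [measurable]: "A n \<in> events" for n
    unfolding A_def using meas by (intro sets.sets_Collect_countable_Ex' S) auto
  have "decseq A"
  proof (rule decseq_SucI)
    fix n
    have "real n < x" if "real (Suc n) < x" for x using that by simp
    then show "A (Suc n) \<le> A n" unfolding A_def by blast
  qed
  then have lim: "(\<lambda>n. prob (A n)) \<longlonglongrightarrow> prob (\<Inter>n. A n)"
    using A by (intro finite_Lim_measure_decseq) auto
  have "AE \<omega> in M. \<omega> \<notin> (\<Inter>n. A n)"
    using bdd
  proof eventually_elim
    case (elim \<omega>)
    then obtain c where c: "\<And>t. t \<in> S \<Longrightarrow> f t \<omega> \<le> c" by (auto simp: bdd_above_def)
    obtain n :: nat where "c \<le> real n" using real_arch_simple by blast
    with c have "\<omega> \<notin> A n" unfolding A_def by force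
    then show ?case by blast
  qed
  then have "prob (\<Inter>n. A n) = 0" by (subst prob_eq_0) auto
  with lim \<delta> have "eventually (\<lambda>n. prob (A n) < \<delta>) sequentially" by (auto intro: order_tendstoD)
  then show ?thesis unfolding A_def by (auto simp: eventually_sequentially)
qed

text \<open>The supremum over an uncountable \<open>T\<close> need not be measurable, so the uniform bound on the
  one-point tails is obtained from a sequence of worst points.\<close>

lemma (in prob_space) tight_uniform:
  fixes f :: "'t \<Rightarrow> 'a \<Rightarrow> real"
  assumes meas: "\<And>t. t \<in> T \<Longrightarrow> f t \<in> borel_measurable M"
    and bdd: "AE \<omega> in M. bdd_above ((\<lambda>t. f t \<omega>) ` T)" and \<delta>: "\<delta> > 0"
  shows "\<exists>n::nat. \<forall>t\<in>T. prob {\<omega> \<in> space M. f t \<omega> > real n} < \<delta>"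
proof (rule ccontr)
  assume "\<not> ?thesis"
  then have "\<forall>n::nat. \<exists>t\<in>T. prob {\<omega> \<in> space M. f t \<omega> > real n} \<ge> \<delta>" by (auto simp: not_less)
  then obtain t where t: "\<And>n. t n \<in> T" "\<And>n::nat. prob {\<omega> \<in> space M. f (t n) \<omega> > real n} \<ge> \<delta>" by metis
  have ms: "\<And>s. s \<in> range t \<Longrightarrow> f s \<in> borel_measurable M" using t(1) meas by auto
  have "AE \<omega> in M. bdd_above ((\<lambda>t. f t \<omega>) ` range t)"
    using bdd by eventually_elim (rule bdd_above_mono, use t(1) in auto)
  from tight_countable[OF _ ms this \<delta>] obtain n :: nat
    where n: "prob {\<omega> \<in> space M. \<exists>s\<in>range t. f s \<omega> > real n} < \<delta>" by auto
  have "{\<omega> \<in> space M. \<exists>s\<in>range t. f s \<omega> > real n} \<in> events"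
    using ms by (intro sets.sets_Collect_countable_Ex') auto
  then have "prob {\<omega> \<in> space M. f (t n) \<omega> > real n} \<le> prob {\<omega> \<in> space M. \<exists>s\<in>range t. f s \<omega> > real n}"
    by (intro finite_measure_mono) auto
  then show False using t(2)[of n] n by linarith
qed

section \<open>Quadratic programs and their dual vectors\<close>

lemma matrix_quadratic_expand:
  fixes P :: "real ^ 'n ^ 'n"
  assumes "transpose P = P"
  shows "(x + s *\<^sub>R h) \<bullet> (P *v (x + s *\<^sub>R h)) = x \<bullet> (P *v x) + 2 * s * (h \<bullet> (P *v x)) + s\<^sup>2 * (h \<bullet> (P *v h))"
proof -
  have "x \<bullet> (P *v h) = (transpose P *v x) \<bullet> h"
    by (simp add: dot_lmul_matrix)
  then have "x \<bullet> (P *v h) = h \<bullet> (P *v x)"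
    by (simp add: assms inner_commute)
  then show ?thesis
    by (simp add: matrix_vector_right_distrib matrix_vector_mult_scaleR inner_add_left inner_add_right
      inner_scaleR_left inner_scaleR_right power2_eq_square algebra_simps)
qed

lemma first_order_nonneg:
  fixes a c :: real
  assumes "\<And>s. 0 < s \<Longrightarrow> s \<le> 1 \<Longrightarrow> 0 \<le> 2 * s * a + s\<^sup>2 * c"
  shows "0 \<le> a"
proof (rule ccontr)
  assume "\<not> 0 \<le> a"
  then have a: "a < 0" by simp
  \<comment> \<open>Small enough that \<open>s * c \<le> - a\<close>, so the quadratic term cannot
    offset \<open>2 * a\<close>.\<close>
  define s where "s = min 1 (- a / (\<bar>c\<bar> + 1))"
  have s: "0 < s" "s \<le> 1" "s * (\<bar>c\<bar> + 1) \<le> - a"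
  proof -
    show "0 < s" "s \<le> 1" using a abs_ge_zero[of c] by (auto simp: s_def intro!: divide_neg_pos)
    have "s * (\<bar>c\<bar> + 1) \<le> (- a / (\<bar>c\<bar> + 1)) * (\<bar>c\<bar> + 1)"
      unfolding s_def by (intro mult_right_mono) auto
    moreover have "(- a / (\<bar>c\<bar> + 1)) * (\<bar>c\<bar> + 1) = - a" using abs_ge_zero[of c] by simp
    ultimately show "s * (\<bar>c\<bar> + 1) \<le> - a" by linarith
  qed
  have "s * c \<le> s * (\<bar>c\<bar> + 1)" using s by (intro mult_left_mono) auto
  then have "2 * a + s * c < 0" using s(3) a by linarith
  then have "s * (2 * a + s * c) < 0" using s(1) by (simp add: mult_pos_neg)
  then show False using assms[OF s(1,2)] by (simp add: power2_eq_square algebra_simps)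
qed

text \<open>Coercivity makes the sublevel set of \<open>b\<close> compact, so a minimiser exists.
  The last two conclusions are Kuhn-Tucker conditions: \<open>axis i 1\<close> and
  \<open>b - x\<close> are admissible directions, and the first-order condition along them gives the
  sign of \<open>P *v x\<close> and its complementary slackness.\<close>

lemma quadratic_program_minimizer:
  fixes P :: "real ^ 'n ^ 'n" and b c :: "real ^ 'n"
  assumes sym: "transpose P = P"
    and coercive: "\<And>x i. (x $ i)\<^sup>2 \<le> c $ i * (x \<bullet> (P *v x))"
    and c: "\<And>i. c $ i \<ge> 0"
  obtains x where "\<And>i. b $ i \<le> x $ i"
    "\<And>y. (\<And>i. b $ i \<le> y $ i) \<Longrightarrow> x \<bullet> (P *v x) \<le> y \<bullet> (P *v y)"
    "\<And>i. 0 \<le> (P *v x) $ i" "x \<bullet> (P *v x) \<le> (P *v x) \<bullet> b"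
proof -
  define q where "q x = x \<bullet> (P *v x)" for x
  have cont: "continuous_on A q" for A
    unfolding q_def by (intro continuous_intros matrix_vector_mult_linear_continuous_on)
  define K where "K = {x. (\<forall>i. b $ i \<le> x $ i) \<and> q x \<le> q b}"
  have "closed {x. b $ i \<le> x $ i}" for i
    by (intro closed_Collect_le continuous_intros)
  then have "closed (\<Inter>i. {x. b $ i \<le> x $ i})" by (intro closed_INT) auto
  moreover have "closed {x. q x \<le> q b}" by (intro closed_Collect_le cont continuous_intros)
  moreover have "K = (\<Inter>i. {x. b $ i \<le> x $ i}) \<inter> {x. q x \<le> q b}" by (auto simp: K_def)
  ultimately have "closed K" by (simp add: closed_Int)
  moreover have "bounded K"
  proof -
    have "norm x \<le> (\<Sum>i\<in>UNIV. sqrt (c $ i * q b))" if "x \<in> K" for x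
    proof -
      have "\<bar>x $ i\<bar> \<le> sqrt (c $ i * q b)" for i
      proof -
        have "(x $ i)\<^sup>2 \<le> c $ i * q b"
          using coercive[of x i] that mult_left_mono[OF _ c[of i], of "q x" "q b"] by (simp add: K_def q_def)
        then show ?thesis by (simp add: real_le_rsqrt)
      qed
      then have "(\<Sum>i\<in>UNIV. \<bar>x $ i\<bar>) \<le> (\<Sum>i\<in>UNIV. sqrt (c $ i * q b))" by (intro sum_mono)
      then show ?thesis using norm_le_l1_cart[of x] by linarith
    qed
    then show ?thesis by (auto simp: bounded_iff)
  qed
  ultimately have "compact K" by (simp add: compact_eq_bounded_closed)
  moreover have "b \<in> K" by (simp add: K_def)
  ultimately obtain x where x: "x \<in> K" "\<And>y. y \<in> K \<Longrightarrow> q x \<le> q y"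
    using continuous_attains_inf[of K q] cont by auto
  \<comment> \<open>A feasible point outside \<open>K\<close> has a larger value than
    \<open>b\<close>, hence than \<open>x\<close>.\<close>
  have min: "q x \<le> q y" if "\<And>i. b $ i \<le> y $ i" for y
  proof (cases "q y \<le> q b")
    case True then show ?thesis using x(2) that by (simp add: K_def)
  next
    case False then show ?thesis using x(1) by (simp add: K_def)
  qed
  \<comment> \<open>By convexity the whole segment from \<open>x\<close> to \<open>x + h\<close> is
    feasible, so minimality can be differentiated along it.\<close>
  have dir: "0 \<le> h \<bullet> (P *v x)" if "\<And>i. b $ i \<le> (x + h) $ i" for h
  proof (rule first_order_nonneg)
    fix s :: real assume s: "0 < s" "s \<le> 1"
    have "b $ i \<le> (x + s *\<^sub>R h) $ i" for i
    proof -
      have "(1 - s) * b $ i + s * b $ i \<le> (1 - s) * x $ i + s * (x + h) $ i"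
        using s x(1) that by (intro add_mono mult_left_mono) (auto simp: K_def)
      then show ?thesis by (simp add: algebra_simps)
    qed
    then have "q x \<le> q (x + s *\<^sub>R h)" by (rule min)
    then show "0 \<le> 2 * s * (h \<bullet> (P *v x)) + s\<^sup>2 * (h \<bullet> (P *v h))"
      unfolding q_def matrix_quadratic_expand[OF sym] by simp
  qed
  show thesis
  proof
    show 1: "b $ i \<le> x $ i" for i using x(1) by (auto simp: K_def)
    show "x \<bullet> (P *v x) \<le> y \<bullet> (P *v y)" if "\<And>i. b $ i \<le> y $ i" for y
      using min[OF that] by (simp add: q_def)
    show "0 \<le> (P *v x) $ i" for i
    proof -
      have "b $ j \<le> (x + axis i 1) $ j" for j using 1[of j] by (auto simp: axis_def)
      then show ?thesis using dir[of "axis i 1"] by (simp add: inner_commute[of "axis i 1"] inner_axis)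
    qed
    show "x \<bullet> (P *v x) \<le> (P *v x) \<bullet> b"
      using dir[of "b - x"] by (simp add: inner_diff_left inner_commute[of "P *v x" b])
  qed
qed

lemma matrix_inv_props:
  fixes S :: "real ^ 'n ^ 'n"
  assumes "invertible S"
  shows "S ** matrix_inv S = mat 1" "matrix_inv S ** S = mat 1"
  using someI_ex[OF assms[unfolded invertible_def]] by (auto simp: matrix_inv_def)

lemma symmetric_matrix_inv:
  fixes S :: "real ^ 'n ^ 'n"
  assumes "invertible S" "transpose S = S"
  shows "transpose (matrix_inv S) = matrix_inv S"
proof -
  have "S ** matrix_inv S = mat 1" "matrix_inv S ** S = mat 1"
    using assms(1) by (simp_all add: matrix_inv_props)
  then have "transpose (matrix_inv S) ** S = mat 1"
    by (metis assms(2) matrix_transpose_mul transpose_mat)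
  then show ?thesis
    by (metis \<open>S ** matrix_inv S = mat 1\<close> matrix_mul_assoc matrix_mul_lid matrix_mul_rid)
qed

text \<open>On an interval of length one the density is at least its value at the right endpoint.
  The shift by 1 costs only a lower-order term in the logarithm.\<close>

lemma std_normal_tail_ge:
  assumes "0 \<le> s"
  shows "measure std_normal_distribution {s<..} \<ge> std_normal_density (s + 1)"
proof -
  interpret N: real_distribution std_normal_distribution by (rule real_dist_normal_dist)
  have "ennreal (std_normal_density (s + 1)) = (\<integral>\<^sup>+x. ennreal (std_normal_density (s + 1)) * indicator {s<..s+1} x \<partial>lborel)"
    by (subst nn_integral_cmult_indicator) auto
  also have "\<dots> \<le> (\<integral>\<^sup>+x. ennreal (std_normal_density x) * indicator {s<..s+1} x \<partial>lborel)"
  proof (intro nn_integral_mono)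
    fix x
    show "ennreal (std_normal_density (s + 1)) * indicator {s<..s+1} x \<le> ennreal (std_normal_density x) * indicator {s<..s+1} x"
    proof (cases "x \<in> {s<..s+1}")
      case True
      then have "x\<^sup>2 \<le> (s + 1)\<^sup>2" using assms by (intro power_mono) auto
      then show ?thesis using True by (auto simp: std_normal_density_def intro!: ennreal_leI divide_right_mono)
    qed simp
  qed
  also have "\<dots> = emeasure std_normal_distribution {s<..s+1}" by (subst emeasure_density) auto
  also have "\<dots> \<le> emeasure std_normal_distribution {s<..}" by (intro emeasure_mono) auto
  finally show ?thesis by (simp add: N.emeasure_eq_measure)
qed

lemma inner_strict_mono:
  fixes w x y :: "real ^ 'n"
  assumes "\<And>i. 0 \<le> w $ i" "w \<noteq> 0" "\<And>i. y $ i < x $ i"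
  shows "w \<bullet> y < w \<bullet> x"
proof -
  obtain j where "w $ j \<noteq> 0" using assms(2) by (auto simp: vec_eq_iff)
  then have "w $ j * y $ j < w $ j * x $ j" using assms(1)[of j] assms(3) by simp
  then have "(\<Sum>i\<in>UNIV. w $ i * y $ i) < (\<Sum>i\<in>UNIV. w $ i * x $ i)"
    using assms by (intro sum_strict_mono_ex1) (auto intro: mult_left_mono less_imp_le)
  then show ?thesis by (simp add: inner_vec_def)
qed

lemma inner_mono:
  fixes w x y :: "real ^ 'n"
  assumes "\<And>i. 0 \<le> w $ i" "\<And>i. y $ i \<le> x $ i"
  shows "w \<bullet> y \<le> w \<bullet> x"
  using assms by (auto simp: inner_vec_def intro!: sum_mono mult_left_mono)

text \<open>\<open>L\<close> will be minus a log-probability; \<open>K\<close> absorbs the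
  prefactors of the probability estimates and may depend on \<kappa>.\<close>

lemma ratio_tendsto_1I:
  fixes L m :: "real \<Rightarrow> real"
  assumes m: "filterlim m at_top at_top"
    and lower: "\<And>\<kappa>. \<kappa> < 1 \<Longrightarrow> \<exists>K. eventually (\<lambda>u. \<kappa> * m u - K \<le> L u) at_top"
    and upper: "\<And>\<kappa>. \<kappa> > 1 \<Longrightarrow> \<exists>K. eventually (\<lambda>u. L u \<le> \<kappa> * m u + K) at_top"
  shows "((\<lambda>u. L u / m u) \<longlongrightarrow> 1) at_top"
proof (rule order_tendstoI)
  have div: "eventually (\<lambda>u. C < m u) at_top" for C using m by (simp add: filterlim_at_top_dense)
  fix a :: real assume a: "a < 1"
  \<comment> \<open>Halfway between \<open>a\<close> and 1, so that the gap
    \<open>(\<kappa> - a) * m u\<close> eventually exceeds \<open>K\<close>.\<close>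
  define \<kappa> where "\<kappa> = (a + 1) / 2"
  obtain K where K: "eventually (\<lambda>u. \<kappa> * m u - K \<le> L u) at_top" using lower[of \<kappa>] a by (auto simp: \<kappa>_def)
  show "eventually (\<lambda>u. a < L u / m u) at_top"
    using K div[of 0] div[of "K / (\<kappa> - a)"]
  proof eventually_elim
    case (elim u)
    have "K < (\<kappa> - a) * m u" using elim(3) a by (simp add: \<kappa>_def pos_divide_less_eq mult.commute)
    then have "a * m u < L u" using elim(1) by (simp add: algebra_simps)
    then show ?case using elim(2) by (simp add: pos_less_divide_eq)
  qed
next
  have div: "eventually (\<lambda>u. C < m u) at_top" for C using m by (simp add: filterlim_at_top_dense)
  fix a :: real assume a: "1 < a"
  define \<kappa> where "\<kappa> = (a + 1) / 2"
  obtain K where K: "eventually (\<lambda>u. L u \<le> \<kappa> * m u + K) at_top" using upper[of \<kappa>] a by (auto simp: \<kappa>_def)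
  show "eventually (\<lambda>u. L u / m u < a) at_top"
    using K div[of 0] div[of "K / (a - \<kappa>)"]
  proof eventually_elim
    case (elim u)
    have "K < (a - \<kappa>) * m u" using elim(3) a by (simp add: \<kappa>_def pos_divide_less_eq mult.commute)
    then have "L u < a * m u" using elim(1) by (simp add: algebra_simps)
    then show ?case using elim(2) by (simp add: pos_divide_less_eq)
  qed
qed

section \<open>Gaussian spaces\<close>

text \<open>A linear space of centered Gaussian variables. Closure under combinations encodes joint
  Gaussianity; degenerate members are allowed, so residuals of projections stay in
  \<open>H\<close>.\<close>

locale gaussian_space = prob_space M for M :: "'a measure" +
  fixes H :: "('a \<Rightarrow> real) set"
  assumes zero: "(\<lambda>_. 0) \<in> H"
    and combination: "Y \<in> H \<Longrightarrow> Z \<in> H \<Longrightarrow> (\<lambda>\<omega>. a * Y \<omega> + b * Z \<omega>) \<in> H"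
    and gaussian: "Y \<in> H \<Longrightarrow> gaussian_rv M Y"
    and centered: "Y \<in> H \<Longrightarrow> expectation Y = 0"
begin

lemma measurable_H: "Y \<in> H \<Longrightarrow> Y \<in> borel_measurable M"
  using gaussian by (auto simp: gaussian_rv_def)

lemma scale: "Y \<in> H \<Longrightarrow> (\<lambda>\<omega>. a * Y \<omega>) \<in> H"
  using combination[of Y Y a 0] by simp

lemma divide: "Y \<in> H \<Longrightarrow> (\<lambda>\<omega>. Y \<omega> / a) \<in> H"
  using scale[of Y "1 / a"] by simp

lemma diff: "Y \<in> H \<Longrightarrow> Z \<in> H \<Longrightarrow> (\<lambda>\<omega>. Y \<omega> - Z \<omega>) \<in> H"
  using combination[of Y Z 1 "-1"] by simp

lemma sum_H:
  assumes "finite I" "\<And>i. i \<in> I \<Longrightarrow> Y i \<in> H"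
  shows "(\<lambda>\<omega>. \<Sum>i\<in>I. a i * Y i \<omega>) \<in> H"
  using assms
proof (induction I)
  case empty then show ?case by (simp add: zero)
next
  case (insert i I)
  then have "(\<lambda>\<omega>. a i * Y i \<omega> + 1 * (\<Sum>i\<in>I. a i * Y i \<omega>)) \<in> H" by (intro combination) auto
  then show ?case using insert.hyps by simp
qed

lemma law_cases:
  assumes "Y \<in> H"
  obtains (normal) \<sigma> where "\<sigma> > 0" "distributed M lborel (\<lambda>\<omega>. Y \<omega> / \<sigma>) std_normal_density"
    | (null) "AE \<omega> in M. Y \<omega> = 0"
proof -
  note [measurable] = measurable_H[OF assms]
  consider \<mu> \<sigma> where "\<sigma> > 0" "distributed M lborel Y (normal_density \<mu> \<sigma>)" | c where "AE \<omega> in M. Y \<omega> = c"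
    using gaussian[OF assms] unfolding gaussian_rv_def by blast
  then show thesis
  proof cases
    case 1
    then have "\<mu> = 0" using normal_distributed_expectation[OF 1] centered[OF assms] by simp
    then show thesis using 1 normal_standard_normal_convert[OF 1(1), of Y \<mu>] by (intro normal) auto
  next
    case 2
    then have "expectation Y = expectation (\<lambda>_. c)" by (intro integral_cong_AE) auto
    then have "c = 0" using centered[OF assms] by (simp add: prob_space)
    then show thesis using 2 null by simp
  qed
qed

lemma integrable_square:
  assumes "Y \<in> H"
  shows "integrable M (\<lambda>\<omega>. (Y \<omega>)\<^sup>2)"
  using assms
proof (cases Y rule: law_cases)
  case (normal \<sigma>)
  have "integrable M (\<lambda>\<omega>. (Y \<omega> / \<sigma>)\<^sup>2)"
    using distributed_integrable[OF normal(2), of "\<lambda>x. x\<^sup>2"] integrable_std_normal_moment[of 2] by simp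
  then have "integrable M (\<lambda>\<omega>. \<sigma>\<^sup>2 * (Y \<omega> / \<sigma>)\<^sup>2)" by (rule integrable_mult_right)
  then show ?thesis using normal(1) by (simp add: power_divide)
next
  case null
  note [measurable] = measurable_H[OF assms]
  have "integrable M (\<lambda>\<omega>. (Y \<omega>)\<^sup>2) \<longleftrightarrow> integrable M (\<lambda>\<omega>. 0 :: real)"
    using null by (intro integrable_cong_AE) auto
  then show ?thesis by simp
qed

lemma integrable_prod:
  assumes "Y \<in> H" "Z \<in> H"
  shows "integrable M (\<lambda>\<omega>. Y \<omega> * Z \<omega>)"
proof -
  have "integrable M (\<lambda>\<omega>. ((1 * Y \<omega> + 1 * Z \<omega>)\<^sup>2 - (Y \<omega>)\<^sup>2 - (Z \<omega>)\<^sup>2) / 2)"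
    by (intro integrable_divide Bochner_Integration.integrable_diff integrable_square combination assms)
  then show ?thesis by (simp add: power2_eq_square algebra_simps)
qed

definition cov :: "('a \<Rightarrow> real) \<Rightarrow> ('a \<Rightarrow> real) \<Rightarrow> real"
  where "cov Y Z = expectation (\<lambda>\<omega>. Y \<omega> * Z \<omega>)"

lemma cov_sym: "cov Y Z = cov Z Y"
  by (simp add: cov_def mult.commute)

lemma cov_nonneg: "0 \<le> cov Y Y"
  unfolding cov_def by (intro Bochner_Integration.integral_nonneg) auto

lemma cov_combination:
  assumes "Y \<in> H" "Z \<in> H" "V \<in> H"
  shows "cov (\<lambda>\<omega>. a * Y \<omega> + b * Z \<omega>) V = a * cov Y V + b * cov Z V"
proof -
  have "cov (\<lambda>\<omega>. a * Y \<omega> + b * Z \<omega>) V = expectation (\<lambda>\<omega>. a * (Y \<omega> * V \<omega>) + b * (Z \<omega> * V \<omega>))"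
    unfolding cov_def by (simp add: algebra_simps)
  then show ?thesis using assms by (simp add: integrable_prod cov_def)
qed

lemma cov_scale: "Y \<in> H \<Longrightarrow> V \<in> H \<Longrightarrow> cov (\<lambda>\<omega>. a * Y \<omega>) V = a * cov Y V"
  using cov_combination[of Y Y V a 0] by simp

lemma cov_divide:
  assumes "Y \<in> H" "V \<in> H"
  shows "cov (\<lambda>\<omega>. Y \<omega> / a) V = cov Y V / a" "cov V (\<lambda>\<omega>. Y \<omega> / a) = cov V Y / a"
  using cov_scale[OF assms, of "1 / a"] by (simp_all add: cov_sym[of V])

lemma cov_diff: "Y \<in> H \<Longrightarrow> Z \<in> H \<Longrightarrow> V \<in> H \<Longrightarrow> cov (\<lambda>\<omega>. Y \<omega> - Z \<omega>) V = cov Y V - cov Z V"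
  using cov_combination[of Y Z V 1 "-1"] by simp

lemma cov_sum:
  assumes "finite I" "\<And>i. i \<in> I \<Longrightarrow> Y i \<in> H" "V \<in> H"
  shows "cov (\<lambda>\<omega>. \<Sum>i\<in>I. a i * Y i \<omega>) V = (\<Sum>i\<in>I. a i * cov (Y i) V)"
  using assms
proof (induction I)
  case empty then show ?case by (simp add: cov_def)
next
  case (insert i I)
  then have "cov (\<lambda>\<omega>. a i * Y i \<omega> + 1 * (\<Sum>i\<in>I. a i * Y i \<omega>)) V
    = a i * cov (Y i) V + 1 * cov (\<lambda>\<omega>. \<Sum>i\<in>I. a i * Y i \<omega>) V"
    by (intro cov_combination sum_H) auto
  then show ?case using insert by simp
qed

lemma cov_cong_AE:
  assumes "Y \<in> H" "Y' \<in> H" "V \<in> H" "AE \<omega> in M. Y \<omega> = Y' \<omega>"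
  shows "cov Y V = cov Y' V"
  unfolding cov_def using assms
  by (intro integral_cong_AE) (auto intro: measurable_H borel_measurable_times)

lemma cov_zero_imp_AE: "Y \<in> H \<Longrightarrow> cov Y Y = 0 \<Longrightarrow> AE \<omega> in M. Y \<omega> = 0"
  using integral_nonneg_eq_0_iff_AE[OF integrable_square[of Y]]
  by (simp add: cov_def power2_eq_square)

text \<open>The residual of \<open>Y\<close> after projection on \<open>Z\<close> has nonnegative
  variance. A degenerate \<open>Z\<close> vanishes almost surely, and with it the
  covariance.\<close>

lemma cov_square_le:
  assumes "Y \<in> H" "Z \<in> H"
  shows "(cov Y Z)\<^sup>2 \<le> cov Y Y * cov Z Z"
proof (cases "cov Z Z = 0")
  case True
  then have "AE \<omega> in M. Z \<omega> = 0" by (rule cov_zero_imp_AE[OF assms(2)])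
  then have "cov Z Y = cov (\<lambda>_. 0) Y" by (intro cov_cong_AE assms zero)
  then show ?thesis using True by (simp add: cov_def mult.commute)
next
  case False
  define r where "r = cov Y Z / cov Z Z"
  define R where "R = (\<lambda>\<omega>. 1 * Y \<omega> + (- r) * Z \<omega>)"
  have R: "R \<in> H" unfolding R_def by (intro combination assms)
  have "cov R V = cov Y V - r * cov Z V" if "V \<in> H" for V
    unfolding R_def using cov_combination[OF assms that, of 1 "- r"] by simp
  note * = this[OF R] this[OF assms(1)] this[OF assms(2)]
  have "cov R R = cov Y R - r * cov Z R" by (rule *)
  also have "cov Z R = 0" unfolding cov_sym[of Z R] * using False by (simp add: r_def)
  also have "cov Y R = cov Y Y - r * cov Z Y" unfolding cov_sym[of Y R] * ..
  finally have "0 \<le> cov Y Y - (cov Y Z)\<^sup>2 / cov Z Z"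
    using cov_nonneg[of R] by (simp add: r_def cov_sym[of Z Y] power2_eq_square)
  then show ?thesis using False cov_nonneg[of Z] by (simp add: field_simps)
qed

lemma standardize:
  assumes "Y \<in> H" "cov Y Y > 0"
  shows "distributed M lborel (\<lambda>\<omega>. Y \<omega> / sqrt (cov Y Y)) std_normal_density"
  using assms(1)
proof (cases Y rule: law_cases)
  case (normal \<sigma>)
  have "expectation (\<lambda>\<omega>. (Y \<omega> / \<sigma>)\<^sup>2) = 1"
    using standard_normal_distributed_variance[OF normal(2)]
    unfolding standard_normal_distributed_expectation[OF normal(2)] by simp
  moreover have "expectation (\<lambda>\<omega>. (Y \<omega> / \<sigma>)\<^sup>2) = cov Y Y / \<sigma>\<^sup>2"
    by (simp add: cov_def power_divide power2_eq_square)
  ultimately have "cov Y Y / \<sigma>\<^sup>2 = 1" by argo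
  then have "cov Y Y = \<sigma>\<^sup>2" using normal(1) by simp
  then have "sqrt (cov Y Y) = \<sigma>" using normal(1) by simp
  then show ?thesis using normal(2) by simp
next
  case null
  then have "cov Y Y = cov (\<lambda>_. 0) Y" by (intro cov_cong_AE assms zero)
  then show ?thesis using assms(2) by (simp add: cov_def)
qed

lemma char_H:
  assumes "Y \<in> H"
  shows "(\<integral>\<omega>. iexp (Y \<omega>) \<partial>M) = exp (- cov Y Y / 2)"
proof (cases "cov Y Y = 0")
  case True
  note [measurable] = measurable_H[OF assms]
  have "(\<integral>\<omega>. iexp (Y \<omega>) \<partial>M) = (\<integral>\<omega>. 1 \<partial>M)"
    using cov_zero_imp_AE[OF assms True] by (intro integral_cong_AE) auto
  then show ?thesis using True by (simp add: prob_space)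
next
  case False
  note [measurable] = measurable_H[OF assms]
  define \<sigma> where "\<sigma> = sqrt (cov Y Y)"
  have v: "cov Y Y > 0" using False cov_nonneg[of Y] by simp
  have \<sigma>: "\<sigma> > 0" "\<sigma>\<^sup>2 = cov Y Y" using v by (simp_all add: \<sigma>_def)
  have "std_normal_distribution = distr M lborel (\<lambda>\<omega>. Y \<omega> / \<sigma>)"
    using distributed_distr_eq_density[OF standardize[OF assms v]] by (simp add: \<sigma>_def)
  then have "char std_normal_distribution \<sigma> = (\<integral>x. iexp (\<sigma> * x) \<partial>distr M lborel (\<lambda>\<omega>. Y \<omega> / \<sigma>))"
    by (simp add: char_def)
  also have "\<dots> = (\<integral>\<omega>. iexp (\<sigma> * (Y \<omega> / \<sigma>)) \<partial>M)" by (rule integral_distr) auto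
  finally show ?thesis using \<sigma> by (simp add: char_std_normal_distribution)
qed

section \<open>Orthonormal systems, Gram-Schmidt and concentration\<close>

definition orthonormal :: "'i set \<Rightarrow> ('i \<Rightarrow> 'a \<Rightarrow> real) \<Rightarrow> bool"
  where "orthonormal I \<xi> \<longleftrightarrow> finite I \<and> (\<forall>i\<in>I. \<xi> i \<in> H) \<and> (\<forall>i\<in>I. \<forall>j\<in>I. cov (\<xi> i) (\<xi> j) = (if i = j then 1 else 0))"

lemma cov_orthonormal_left:
  assumes "orthonormal I \<xi>" "j \<in> I"
  shows "cov (\<lambda>\<omega>. \<Sum>i\<in>I. a i * \<xi> i \<omega>) (\<xi> j) = a j"
proof -
  have "cov (\<lambda>\<omega>. \<Sum>i\<in>I. a i * \<xi> i \<omega>) (\<xi> j) = (\<Sum>i\<in>I. a i * cov (\<xi> i) (\<xi> j))"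
    using assms by (intro cov_sum) (auto simp: orthonormal_def)
  also have "\<dots> = (\<Sum>i\<in>I. if i = j then a j else 0)"
    using assms by (intro sum.cong) (auto simp: orthonormal_def)
  also have "\<dots> = a j" using assms by (simp add: orthonormal_def)
  finally show ?thesis .
qed

lemma cov_orthonormal:
  assumes "orthonormal I \<xi>"
  shows "cov (\<lambda>\<omega>. \<Sum>i\<in>I. a i * \<xi> i \<omega>) (\<lambda>\<omega>. \<Sum>i\<in>I. a i * \<xi> i \<omega>) = (\<Sum>i\<in>I. (a i)\<^sup>2)"
proof -
  have I: "finite I" "\<And>i. i \<in> I \<Longrightarrow> \<xi> i \<in> H" using assms by (auto simp: orthonormal_def)
  have "cov (\<lambda>\<omega>. \<Sum>i\<in>I. a i * \<xi> i \<omega>) (\<lambda>\<omega>. \<Sum>i\<in>I. a i * \<xi> i \<omega>)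
    = (\<Sum>j\<in>I. a j * cov (\<xi> j) (\<lambda>\<omega>. \<Sum>i\<in>I. a i * \<xi> i \<omega>))"
    using I by (intro cov_sum sum_H)
  also have "\<dots> = (\<Sum>j\<in>I. a j * a j)"
    using cov_orthonormal_left[OF assms] by (intro sum.cong) (auto simp: cov_sym[of "\<xi> _"])
  finally show ?thesis by (simp add: power2_eq_square)
qed

text \<open>A linear form in the system is again in \<open>H\<close>, so its characteristic function
  depends only on its variance, a sum of squares. This is why uncorrelated members of a Gaussian
  space are independent.\<close>

lemma orthonormal_char:
  assumes "orthonormal I \<xi>"
  shows "(\<integral>\<omega>. iexp (\<Sum>i\<in>I. \<theta> i * \<xi> i \<omega>) \<partial>M) = exp (- (\<Sum>i\<in>I. (\<theta> i)\<^sup>2) / 2)"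
  using assms by (subst char_H) (auto intro!: sum_H simp: orthonormal_def cov_orthonormal[OF assms])

lemma orthonormal_distr:
  assumes "orthonormal I \<xi>"
  shows "distr M (PiM I (\<lambda>_. std_normal_distribution)) (\<lambda>\<omega>. \<lambda>i\<in>I. \<xi> i \<omega>) = PiM I (\<lambda>_. std_normal_distribution)"
  using assms by (intro std_normal_vector_distr prob_space_axioms orthonormal_char) (auto simp: orthonormal_def measurable_H)

lemma orthonormal_prob:
  assumes "orthonormal I \<xi>" "\<And>i. i \<in> I \<Longrightarrow> B i \<in> sets borel"
  shows "prob {\<omega> \<in> space M. \<forall>i\<in>I. \<xi> i \<omega> \<in> B i} = (\<Prod>i\<in>I. measure std_normal_distribution (B i))"
  using assms by (intro std_normal_vector_prob prob_space_axioms orthonormal_char) (auto simp: orthonormal_def measurable_H)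

text \<open>A variable whose residual has variance zero adds no new vector; its representation then
  holds only almost surely, hence the AE in the statement.\<close>

lemma gram_schmidt:
  assumes "finite F" "\<And>t. t \<in> F \<Longrightarrow> Y t \<in> H"
  shows "\<exists>k \<xi> a. orthonormal {..<k :: nat} \<xi> \<and> (\<forall>t\<in>F. AE \<omega> in M. Y t \<omega> = (\<Sum>i<k. a t i * \<xi> i \<omega>))"
  using assms
proof (induction F)
  case empty
  have "orthonormal {..<0 :: nat} (\<lambda>_ _. 0)" by (simp add: orthonormal_def)
  then show ?case by blast
next
  case (insert t0 F)
  have "\<exists>k \<xi> a. orthonormal {..<k :: nat} \<xi> \<and> (\<forall>t\<in>F. AE \<omega> in M. Y t \<omega> = (\<Sum>i<k. a t i * \<xi> i \<omega>))"
    using insert.prems by (intro insert.IH) auto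
  then obtain k \<xi> a where on: "orthonormal {..<k :: nat} \<xi>"
    and a: "\<And>t. t \<in> F \<Longrightarrow> AE \<omega> in M. Y t \<omega> = (\<Sum>i<k. a t i * \<xi> i \<omega>)"
    by blast
  have \<xi>: "\<And>i. i < k \<Longrightarrow> \<xi> i \<in> H" "\<And>i j. i < k \<Longrightarrow> j < k \<Longrightarrow> cov (\<xi> i) (\<xi> j) = (if i = j then 1 else 0)"
    using on by (auto simp: orthonormal_def)
  define c where "c i = cov (Y t0) (\<xi> i)" for i
  define R where "R = (\<lambda>\<omega>. Y t0 \<omega> - (\<Sum>i<k. c i * \<xi> i \<omega>))"
  have Y0: "Y t0 \<in> H" using insert.prems by simp
  have S: "(\<lambda>\<omega>. \<Sum>i<k. c i * \<xi> i \<omega>) \<in> H" using \<xi> by (intro sum_H) auto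
  have R: "R \<in> H" unfolding R_def by (intro diff Y0 S)
  have R\<xi>: "cov R (\<xi> j) = 0" if "j < k" for j
    unfolding R_def using cov_diff[OF Y0 S \<xi>(1)[OF that]] cov_orthonormal_left[OF on, of j] that
    by (simp add: c_def)
  show ?case
  proof (cases "cov R R = 0")
    case True
    have "AE \<omega> in M. Y t0 \<omega> = (\<Sum>i<k. c i * \<xi> i \<omega>)"
      using cov_zero_imp_AE[OF R True] by (simp add: R_def)
    then have "\<forall>t\<in>insert t0 F. AE \<omega> in M. Y t \<omega> = (\<Sum>i<k. (a(t0 := c)) t i * \<xi> i \<omega>)"
      using a insert.hyps by auto
    then show ?thesis using on by blast
  next
    case False
    then have v: "cov R R > 0" using cov_nonneg[of R] by simp
    define \<eta> where "\<eta> = (\<lambda>\<omega>. R \<omega> / sqrt (cov R R))"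
    have \<eta>: "\<eta> \<in> H" unfolding \<eta>_def by (rule divide[OF R])
    have cov_\<eta>: "cov \<eta> V = cov R V / sqrt (cov R R)" if "V \<in> H" for V
      unfolding \<eta>_def by (rule cov_divide[OF R that])
    have \<eta>\<eta>: "cov \<eta> \<eta> = 1"
      unfolding cov_\<eta>[OF \<eta>] cov_sym[of R \<eta>] cov_\<eta>[OF R] using v
      by (simp add: field_simps flip: power2_eq_square)
    have \<eta>\<xi>: "cov \<eta> (\<xi> j) = 0" "cov (\<xi> j) \<eta> = 0" if "j < k" for j
      using cov_\<eta>[OF \<xi>(1)[OF that]] R\<xi>[OF that] by (simp_all add: cov_sym[of _ \<eta>])
    define \<xi>' where "\<xi>' = \<xi>(k := \<eta>)"
    have "orthonormal {..<Suc k} \<xi>'"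
      unfolding orthonormal_def \<xi>'_def using \<eta> \<eta>\<eta> \<eta>\<xi> \<xi> by (auto simp: less_Suc_eq)
    \<comment> \<open>The new variable has weight \<open>sqrt (cov R R)\<close> on the normalised
      residual; the earlier ones have coefficient 0 there.\<close>
    moreover define a' where "a' = (\<lambda>t i. if t = t0 then (c(k := sqrt (cov R R))) i else if i < k then a t i else 0)"
    have "\<forall>t\<in>insert t0 F. AE \<omega> in M. Y t \<omega> = (\<Sum>i<Suc k. a' t i * \<xi>' i \<omega>)"
    proof
      fix t assume "t \<in> insert t0 F"
      then consider "t = t0" | "t \<in> F" "t \<noteq> t0" using insert.hyps by auto
      then show "AE \<omega> in M. Y t \<omega> = (\<Sum>i<Suc k. a' t i * \<xi>' i \<omega>)"
      proof cases
        case 1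
        have "(\<Sum>i<Suc k. a' t i * \<xi>' i \<omega>) = (\<Sum>i<k. c i * \<xi> i \<omega>) + R \<omega>" for \<omega>
          using 1 v by (simp add: a'_def \<xi>'_def \<eta>_def)
        then show ?thesis using 1 by (simp add: R_def)
      next
        case 2
        have "(\<Sum>i<Suc k. a' t i * \<xi>' i \<omega>) = (\<Sum>i<k. a t i * \<xi> i \<omega>)" for \<omega>
          using 2 by (simp add: a'_def \<xi>'_def)
        then show ?thesis using a[OF 2(1)] by simp
      qed
    qed
    ultimately show ?thesis by blast
  qed
qed

text \<open>The bound involves only variances and one probability. Both are unchanged by the passage
  to Gram-Schmidt coordinates, so the size \<open>k\<close> of the system leaves no trace.\<close>

lemma concentration:
  assumes F: "finite F" "\<And>t. t \<in> F \<Longrightarrow> Y t \<in> H" and l: "0 < l" "l < 1" and \<sigma>: "\<sigma> > 0" and \<eta>: "\<eta> < 1"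
    and var: "\<And>t. t \<in> F \<Longrightarrow> cov (Y t) (Y t) \<le> \<sigma>\<^sup>2"
    and half: "prob {\<omega> \<in> space M. \<forall>t\<in>F. Y t \<omega> \<le> \<eta>} \<ge> 1 / 2"
  shows "prob {\<omega> \<in> space M. \<exists>t\<in>F. Y t \<omega> > 1}
    \<le> 2 powr (l / (1 - l)) * exp (- l * (1 - \<eta>)\<^sup>2 / (2 * \<sigma>\<^sup>2))"
proof -
  obtain k \<xi> a where on: "orthonormal {..<k :: nat} \<xi>"
    and a: "\<And>t. t \<in> F \<Longrightarrow> AE \<omega> in M. Y t \<omega> = (\<Sum>i<k. a t i * \<xi> i \<omega>)"
    using gram_schmidt[of F Y] F by blast
  have \<xi>: "\<And>i. i < k \<Longrightarrow> \<xi> i \<in> H" using on by (auto simp: orthonormal_def)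
  note [measurable] = measurable_H[OF F(2)] measurable_H[OF \<xi>]
  let ?P = "PiM {..<k} (\<lambda>_. std_normal_distribution)"
  define L where "L t x = (\<Sum>i<k. a t i * x i)" for t and x :: "nat \<Rightarrow> real"
  have [measurable]: "L t \<in> borel_measurable ?P" for t
    unfolding L_def
    by (intro borel_measurable_sum borel_measurable_times borel_measurable_const)
      (auto intro!: measurable_compose[OF measurable_component_singleton])
  have fm: "(\<lambda>\<omega>. \<lambda>i\<in>{..<k}. \<xi> i \<omega>) \<in> measurable M ?P"
    by (intro measurable_restrict) (use measurable_H[OF \<xi>] in simp)
  have ae: "AE \<omega> in M. \<forall>t\<in>F. Y t \<omega> = L t (\<lambda>i\<in>{..<k}. \<xi> i \<omega>)"
    using a F(1) by (subst AE_finite_all) (simp_all add: L_def)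
  \<comment> \<open>\<open>Q\<close> is a condition on the family of values. Padding with 0 off
    \<open>F\<close> makes the two families agree almost surely as total functions, so one statement
    serves both events.\<close>
  have transfer: "prob {\<omega> \<in> space M. Q (\<lambda>t. if t \<in> F then Y t \<omega> else 0)}
      = measure ?P {x \<in> space ?P. Q (\<lambda>t. if t \<in> F then L t x else 0)}"
    if meas: "{x \<in> space ?P. Q (\<lambda>t. if t \<in> F then L t x else 0)} \<in> sets ?P"
      "{\<omega> \<in> space M. Q (\<lambda>t. if t \<in> F then Y t \<omega> else 0)} \<in> events" for Q
  proof -
    let ?f = "\<lambda>\<omega>. \<lambda>i\<in>{..<k}. \<xi> i \<omega>"
    let ?B = "{x \<in> space ?P. Q (\<lambda>t. if t \<in> F then L t x else 0)}"
    have "measure ?P ?B = prob (?f -` ?B \<inter> space M)"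
      using measure_distr[OF fm meas(1)] orthonormal_distr[OF on] by simp
    also have "\<dots> = prob {\<omega> \<in> space M. Q (\<lambda>t. if t \<in> F then Y t \<omega> else 0)}"
    proof (rule finite_measure_eq_AE)
      show "AE \<omega> in M. (\<omega> \<in> ?f -` ?B \<inter> space M) = (\<omega> \<in> {\<omega> \<in> space M. Q (\<lambda>t. if t \<in> F then Y t \<omega> else 0)})"
        using ae
      proof eventually_elim
        case (elim \<omega>)
        then have "(\<lambda>t. if t \<in> F then Y t \<omega> else 0) = (\<lambda>t. if t \<in> F then L t (?f \<omega>) else 0)" by auto
        then show ?case using measurable_space[OF fm, of \<omega>] by auto
      qed
      show "?f -` ?B \<inter> space M \<in> events" using measurable_sets[OF fm meas(1)] .
    qed (rule meas(2))
    finally show ?thesis ..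
  qed
  have 1: "prob {\<omega> \<in> space M. \<forall>t\<in>F. Y t \<omega> \<le> \<eta>} = measure ?P {x \<in> space ?P. \<forall>t\<in>F. L t x \<le> \<eta>}"
    using transfer[of "\<lambda>z. \<forall>t\<in>F. z t \<le> \<eta>"] F(1) by simp
  have 2: "prob {\<omega> \<in> space M. \<exists>t\<in>F. Y t \<omega> > 1} = measure ?P {x \<in> space ?P. \<exists>t\<in>F. L t x > 1}"
    using transfer[of "\<lambda>z. \<exists>t\<in>F. z t > 1"] F(1) by (simp cong: bex_cong)
  have "(\<Sum>i<k. (a t i)\<^sup>2) \<le> \<sigma>\<^sup>2" if t: "t \<in> F" for t
  proof -
    let ?S = "\<lambda>\<omega>. \<Sum>i<k. a t i * \<xi> i \<omega>"
    have S: "?S \<in> H" using \<xi> by (intro sum_H) auto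
    \<comment> \<open>The representation is only almost sure, so it is substituted one argument at a
      time.\<close>
    have "cov ?S ?S = cov (Y t) ?S" using a[OF t] by (intro cov_cong_AE[symmetric] S F t)
    also have "\<dots> = cov (Y t) (Y t)"
      unfolding cov_sym[of "Y t" ?S] using a[OF t] by (intro cov_cong_AE[symmetric] S F t)
    finally show ?thesis using var[OF t] cov_orthonormal[OF on] by simp
  qed
  then show ?thesis
    using std_normal_PiM_concentration[of "{..<k}" F l \<sigma> \<eta> a] F(1) l \<sigma> \<eta> half
    unfolding 1 2 L_def by simp
qed

section \<open>Independence, tails and joint exceedance\<close>

lemma independent:
  assumes "Y \<in> H" "Z \<in> H" "cov Y Y > 0" "cov Z Z > 0" "cov Y Z = 0"
  shows "prob {\<omega> \<in> space M. Y \<omega> > y \<and> Z \<omega> \<le> z} = prob {\<omega> \<in> space M. Y \<omega> > y} * prob {\<omega> \<in> space M. Z \<omega> \<le> z}"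
proof -
  \<comment> \<open>Indexed by \<open>bool\<close>, the standardised pair is an orthonormal system,
    to which \<open>orthonormal_prob\<close> applies; its singletons give the marginals.\<close>
  define V where "V b = (if b then Y else Z)" for b
  define \<xi> where "\<xi> b = (\<lambda>\<omega>. V b \<omega> / sqrt (cov (V b) (V b)))" for b
  have V: "V b \<in> H" "cov (V b) (V b) > 0" for b using assms by (auto simp: V_def)
  have \<xi>: "\<xi> b \<in> H" for b unfolding \<xi>_def by (intro divide V)
  have cov_\<xi>: "cov (\<xi> b) (\<xi> c) = cov (V b) (V c) / sqrt (cov (V c) (V c)) / sqrt (cov (V b) (V b))" for b c
    unfolding \<xi>_def by (simp add: cov_divide divide V)
  have "cov (\<xi> b) (\<xi> c) = (if b = c then 1 else 0)" for b c
  proof (cases "b = c")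
    case True
    have *: "v / sqrt v / sqrt v = 1" if "v > 0" for v :: real using that by (simp add: real_div_sqrt)
    show ?thesis unfolding cov_\<xi> True using *[OF V(2)[of c]] by simp
  next
    case False
    then have "cov (V b) (V c) = 0" using assms(5) cov_sym[of Z Y] by (auto simp: V_def)
    then show ?thesis unfolding cov_\<xi> using False by simp
  qed
  then have on: "orthonormal (UNIV :: bool set) \<xi>" by (simp add: orthonormal_def \<xi>)
  define B where "B b = (if b then {y / sqrt (cov Y Y)<..} else {.. z / sqrt (cov Z Z)})" for b
  have B: "B b \<in> sets borel" for b by (simp add: B_def)
  have iff: "\<xi> True \<omega> \<in> B True \<longleftrightarrow> Y \<omega> > y" "\<xi> False \<omega> \<in> B False \<longleftrightarrow> Z \<omega> \<le> z" for \<omega>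
    using assms by (auto simp: \<xi>_def V_def B_def divide_less_cancel divide_le_cancel)
  have on1: "orthonormal {b} \<xi>" for b using on by (simp add: orthonormal_def)
  have "prob {\<omega> \<in> space M. \<xi> b \<omega> \<in> B b} = measure std_normal_distribution (B b)" for b
    using orthonormal_prob[OF on1, of _ B] B by simp
  from this[of True] this[of False]
  have "prob {\<omega> \<in> space M. Y \<omega> > y} = measure std_normal_distribution (B True)"
    "prob {\<omega> \<in> space M. Z \<omega> \<le> z} = measure std_normal_distribution (B False)"
    by (simp_all add: iff)
  moreover have "prob {\<omega> \<in> space M. \<forall>b\<in>UNIV. \<xi> b \<omega> \<in> B b} = (\<Prod>b\<in>UNIV. measure std_normal_distribution (B b))"
    by (rule orthonormal_prob[OF on B])
  moreover have "(\<forall>b\<in>UNIV. \<xi> b \<omega> \<in> B b) \<longleftrightarrow> Y \<omega> > y \<and> Z \<omega> \<le> z" for \<omega>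
    unfolding iff[symmetric] by (metis (full_types) UNIV_I)
  ultimately show ?thesis by (simp add: UNIV_bool)
qed

lemma tail_prob:
  assumes "Y \<in> H" "cov Y Y > 0"
  shows "prob {\<omega> \<in> space M. Y \<omega> > s * sqrt (cov Y Y)} = measure std_normal_distribution {s<..}"
proof -
  note [measurable] = measurable_H[OF assms(1)]
  let ?Z = "\<lambda>\<omega>. Y \<omega> / sqrt (cov Y Y)"
  have "measure std_normal_distribution {s<..} = measure (distr M lborel ?Z) {s<..}"
    using distributed_distr_eq_density[OF standardize[OF assms]] by simp
  also have "\<dots> = prob (?Z -` {s<..} \<inter> space M)" by (intro measure_distr) auto
  also have "?Z -` {s<..} \<inter> space M = {\<omega> \<in> space M. Y \<omega> > s * sqrt (cov Y Y)}"
    using assms(2) by (auto simp: field_simps)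
  finally show ?thesis ..
qed

text \<open>A nondegenerate centered Gaussian variable exceeds its own standard deviation with
  probability at least \<open>std_normal_density 2\<close>, by the tail bound at
  \<open>s = 1\<close>. A smaller tail at \<open>c\<close> therefore puts \<open>c\<close> above the
  standard deviation.\<close>

lemma sqrt_cov_le_of_tail:
  assumes "Y \<in> H" and "prob {\<omega> \<in> space M. Y \<omega> > c} < std_normal_density 2"
  shows "sqrt (cov Y Y) \<le> c"
proof (rule ccontr)
  note [measurable] = measurable_H[OF assms(1)]
  assume "\<not> ?thesis"
  then have c: "c < sqrt (cov Y Y)" by simp
  show False
  proof (cases "cov Y Y > 0")
    case True
    have "std_normal_density 2 \<le> prob {\<omega> \<in> space M. Y \<omega> > 1 * sqrt (cov Y Y)}"
      unfolding tail_prob[OF assms(1) True] using std_normal_tail_ge[of 1] by simp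
    also have "\<dots> \<le> prob {\<omega> \<in> space M. Y \<omega> > c}" using c by (intro finite_measure_mono) auto
    finally show False using assms(2) by simp
  next
    case False
    \<comment> \<open>Here \<open>c < 0\<close> and \<open>Y = 0\<close> almost surely, so the tail
      event has full probability.\<close>
    then have 0: "cov Y Y = 0" using cov_nonneg[of Y] by simp
    then have "AE \<omega> in M. \<omega> \<in> {\<omega> \<in> space M. Y \<omega> > c}"
      using cov_zero_imp_AE[OF assms(1) 0] c AE_space by (auto elim!: eventually_elim2)
    then have "prob {\<omega> \<in> space M. Y \<omega> > c} = 1" by (subst prob_eq_1) auto
    moreover have "std_normal_density 2 \<le> prob {\<omega> \<in> space M. Y \<omega> > c}"
    proof -
      interpret N: real_distribution std_normal_distribution by (rule real_dist_normal_dist)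
      have "std_normal_density 2 \<le> N.prob {1<..}" using std_normal_tail_ge[of 1] by simp
      also have "\<dots> \<le> 1" by (rule N.prob_le_1)
      finally show ?thesis using \<open>prob {\<omega> \<in> space M. Y \<omega> > c} = 1\<close> by simp
    qed
    ultimately show False using assms(2) by simp
  qed
qed

lemma prob_le_neg:
  assumes "R \<in> H" "r > 0"
  shows "prob {\<omega> \<in> space M. R \<omega> \<le> - r} \<le> cov R R / r\<^sup>2"
proof -
  note [measurable] = measurable_H[OF assms(1)]
  have "prob {\<omega> \<in> space M. R \<omega> \<le> - r} \<le> prob {\<omega> \<in> space M. r \<le> \<bar>R \<omega> - expectation R\<bar>}"
    using centered[OF assms(1)] assms(2) by (intro finite_measure_mono) auto
  also have "\<dots> \<le> variance R / r\<^sup>2"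
    using assms integrable_square by (intro Chebyshev_inequality) auto
  finally show ?thesis using centered[OF assms(1)] by (simp add: cov_def power2_eq_square)
qed

text \<open>Along \<open>W\<close> the vector is \<open>X i = x i * W / cov W W + R i\<close> with \<open>R i\<close> independent of \<open>W\<close>; pushing
  \<open>W\<close> slightly beyond \<open>cov W W\<close> leaves room for the residuals.\<close>

lemma joint_exceedance_ge:
  fixes X :: "'i::finite \<Rightarrow> 'a \<Rightarrow> real"
  assumes X: "\<And>i. X i \<in> H" and W: "W \<in> H" "cov W W > 0" and \<epsilon>: "\<epsilon> > 0"
    and x: "\<And>i. cov (X i) W > 0"
    and small: "\<And>i. cov (X i) (X i) \<le> (\<epsilon> * cov (X i) W)\<^sup>2 / (2 * real CARD('i))"
  shows "prob {\<omega> \<in> space M. \<forall>i. X i \<omega> > cov (X i) W}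
    \<ge> std_normal_density ((1 + \<epsilon>) * sqrt (cov W W) + 1) / 2"
proof -
  define Q where "Q = cov W W"
  define x where "x i = cov (X i) W" for i
  define R where "R i = (\<lambda>\<omega>. 1 * X i \<omega> + (- (x i / Q)) * W \<omega>)" for i
  note [measurable] = measurable_H[OF X] measurable_H[OF W(1)]
  have Q: "Q > 0" using W by (simp add: Q_def)
  have R: "R i \<in> H" for i unfolding R_def by (intro combination X W)
  note [measurable] = measurable_H[OF R]
  have cov_R: "cov (R i) V = cov (X i) V - x i / Q * cov W V" if "V \<in> H" for i V
    unfolding R_def using cov_combination[OF X W(1) that, of 1 i "- (x i / Q)"] by simp
  have RW: "cov (R i) W = 0" for i using cov_R[OF W(1)] Q by (simp add: x_def Q_def)
  have RR: "cov (R i) (R i) \<le> cov (X i) (X i)" for i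
  proof -
    have "cov (R i) (R i) = cov (X i) (R i) - x i / Q * cov W (R i)" by (rule cov_R[OF R])
    also have "\<dots> = cov (R i) (X i)" using RW by (simp add: cov_sym[of W] cov_sym[of "X i"])
    also have "\<dots> = cov (X i) (X i) - x i / Q * x i" unfolding cov_R[OF X] by (simp add: x_def cov_sym[of W])
    also have "\<dots> \<le> cov (X i) (X i)" using Q by (simp add: x_def)
    finally show ?thesis .
  qed
  define E where "E = {\<omega> \<in> space M. W \<omega> > (1 + \<epsilon>) * Q}"
  define B where "B i = {\<omega> \<in> space M. W \<omega> > (1 + \<epsilon>) * Q \<and> R i \<omega> \<le> - (\<epsilon> * x i)}" for i
  have [measurable]: "E \<in> events" "B i \<in> events" for i unfolding E_def B_def by measurable
  \<comment> \<open>Given \<open>E\<close>, each residual fails with probability at most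
    \<open>1 / (2 * real CARD('i))\<close>; the union bound then keeps half of
    \<open>prob E\<close>.\<close>
  have B: "prob (B i) \<le> prob E / (2 * real CARD('i))" for i
  proof -
    have ex: "\<epsilon> * x i > 0" using \<epsilon> assms(5) by (simp add: x_def)
    have le: "prob {\<omega> \<in> space M. R i \<omega> \<le> - (\<epsilon> * x i)} \<le> 1 / (2 * real CARD('i))"
    proof -
      have "prob {\<omega> \<in> space M. R i \<omega> \<le> - (\<epsilon> * x i)} \<le> cov (R i) (R i) / (\<epsilon> * x i)\<^sup>2" by (rule prob_le_neg[OF R ex])
      also have "\<dots> \<le> ((\<epsilon> * x i)\<^sup>2 / (2 * real CARD('i))) / (\<epsilon> * x i)\<^sup>2"
        using RR[of i] small[of i] unfolding x_def by (intro divide_right_mono) auto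
      also have "\<dots> = 1 / (2 * real CARD('i))" using less_imp_neq[OF ex] by simp
      finally show ?thesis .
    qed
    show ?thesis
    proof (cases "cov (R i) (R i) > 0")
      case True
      have "prob (B i) = prob E * prob {\<omega> \<in> space M. R i \<omega> \<le> - (\<epsilon> * x i)}"
        unfolding B_def E_def using RW[of i] by (intro independent W R True) (simp add: cov_sym[of W])
      also have "\<dots> \<le> prob E * (1 / (2 * real CARD('i)))" by (intro mult_left_mono le) auto
      finally show ?thesis by simp
    next
      \<comment> \<open>\<open>independent\<close> asks for positive variances; a degenerate
        residual fails with probability zero by Chebyshev.\<close>
      case False
      then have "cov (R i) (R i) = 0" using cov_nonneg[of "R i"] by simp
      then have "prob {\<omega> \<in> space M. R i \<omega> \<le> - (\<epsilon> * x i)} \<le> 0" using prob_le_neg[OF R ex, of i] by simp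
      moreover have "prob (B i) \<le> prob {\<omega> \<in> space M. R i \<omega> \<le> - (\<epsilon> * x i)}"
        unfolding B_def by (intro finite_measure_mono) auto
      ultimately show ?thesis by (smt (verit) divide_nonneg_nonneg measure_nonneg of_nat_0_le_iff)
    qed
  qed
  define G where "G = {\<omega> \<in> space M. \<forall>i. X i \<omega> > x i}"
  have G [measurable]: "G \<in> events" unfolding G_def by measurable
  have "E \<subseteq> G \<union> (\<Union>i. B i)"
  proof
    fix \<omega> assume \<omega>: "\<omega> \<in> E"
    show "\<omega> \<in> G \<union> (\<Union>i. B i)"
    proof (cases "\<exists>i. R i \<omega> \<le> - (\<epsilon> * x i)")
      case True then show ?thesis using \<omega> by (auto simp: E_def B_def)
    next
      case False
      have "X i \<omega> > x i" for i
      proof -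
        \<comment> \<open>On \<open>E\<close> the part along \<open>W\<close> exceeds
          \<open>(1 + \<epsilon>) * x i\<close>, and the residual takes back less than
          \<open>\<epsilon> * x i\<close>.\<close>
        have "x i / Q * W \<omega> > x i / Q * ((1 + \<epsilon>) * Q)"
          using \<omega> Q assms(5)[of i] by (intro mult_strict_left_mono) (auto simp: E_def x_def)
        moreover have "x i / Q * ((1 + \<epsilon>) * Q) = x i + \<epsilon> * x i" using Q by (simp add: field_simps)
        moreover have "R i \<omega> > - (\<epsilon> * x i)" using False by (auto simp: not_le)
        ultimately show ?thesis by (simp add: R_def)
      qed
      then show ?thesis using \<omega> by (auto simp: G_def E_def)
    qed
  qed
  then have "prob E \<le> prob (G \<union> (\<Union>i. B i))" by (intro finite_measure_mono) auto
  also have "\<dots> \<le> prob G + prob (\<Union>i. B i)" by (intro measure_Un_le) auto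
  also have "prob (\<Union>i. B i) \<le> (\<Sum>i\<in>UNIV. prob (B i))" by (intro measure_UNION_le) auto
  also have "\<dots> \<le> (\<Sum>i\<in>(UNIV :: 'i set). prob E / (2 * real CARD('i)))" by (intro sum_mono B)
  also have "\<dots> = prob E / 2" by simp
  finally have "prob E / 2 \<le> prob G" by simp
  moreover have "prob E \<ge> std_normal_density ((1 + \<epsilon>) * sqrt Q + 1)"
  proof -
    have eq: "(1 + \<epsilon>) * Q = ((1 + \<epsilon>) * sqrt Q) * sqrt Q" using Q by simp
    have "prob E = measure std_normal_distribution {(1 + \<epsilon>) * sqrt Q<..}"
      unfolding E_def eq by (rule tail_prob[OF W, folded Q_def])
    then show ?thesis using std_normal_tail_ge[of "(1 + \<epsilon>) * sqrt Q"] \<epsilon> Q by simp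
  qed
  ultimately show ?thesis unfolding G_def x_def Q_def by linarith
qed

end

section \<open>Drifted Gaussian processes\<close>

text \<open>Continuity from below along finite subsets; it carries bounds with uniform constants
  over to the whole separant.\<close>

lemma (in prob_space) prob_countable_Ex_le:
  assumes S: "countable S" and meas: "\<And>s. s \<in> S \<Longrightarrow> {\<omega> \<in> space M. E s \<omega>} \<in> events"
    and le: "\<And>F. finite F \<Longrightarrow> F \<subseteq> S \<Longrightarrow> prob {\<omega> \<in> space M. \<exists>s\<in>F. E s \<omega>} \<le> c"
  shows "prob {\<omega> \<in> space M. \<exists>s\<in>S. E s \<omega>} \<le> c"
proof (cases "S = {}")
  case True then show ?thesis using le[of "{}"] by simp
next
  case False
  define F where "F n = from_nat_into S ` {..n}" for n
  have F: "finite (F n)" "F n \<subseteq> S" for n using from_nat_into[OF False] by (auto simp: F_def)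
  define A where "A n = {\<omega> \<in> space M. \<exists>s\<in>F n. E s \<omega>}" for n
  have A: "A n \<in> events" for n
    unfolding A_def using F meas by (intro sets.sets_Collect_finite_Ex) auto
  have "incseq A"
  proof (rule incseq_SucI)
    fix n
    have "F n \<subseteq> F (Suc n)" unfolding F_def by (intro image_mono) auto
    then show "A n \<le> A (Suc n)" unfolding A_def by auto
  qed
  then have "(\<lambda>n. prob (A n)) \<longlonglongrightarrow> prob (\<Union>n. A n)"
    using A by (intro finite_Lim_measure_incseq) auto
  then have "prob (\<Union>n. A n) \<le> c"
    by (rule LIMSEQ_le_const2) (use le F in \<open>auto simp: A_def\<close>)
  moreover have "(\<Union>n. F n) = S"
  proof -
    have "(\<Union>n. F n) = range (from_nat_into S)" by (auto simp: F_def)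
    then show ?thesis using range_from_nat_into[OF False S] by simp
  qed
  then have "(\<Union>n. A n) = {\<omega> \<in> space M. \<exists>s\<in>S. E s \<omega>}" unfolding A_def by auto
  ultimately show ?thesis by simp
qed

locale drifted_gaussian_process = prob_space M for M :: "'a measure" +
  fixes T :: "(real ^ 'm) set"
    and X :: "real ^ 'm \<Rightarrow> 'a \<Rightarrow> real ^ 'n"
    and d :: "real ^ 'm \<Rightarrow> real ^ 'n"
    and q :: "real ^ 'n"
  assumes T: "T \<noteq> {}"
    and gaussian_process: "gaussian_process M T X"
    and centered_process: "centered_process M T X"
    and separable: "separable_process M T (\<lambda>t \<omega>. X t \<omega> - d t)"
    and invertible_cov: "t \<in> T \<Longrightarrow> invertible (cov_matrix M (X t))"
    and bounded: "\<epsilon> \<in> {0<..1} \<Longrightarrow> AE \<omega> in M. bdd_above ((\<lambda>t. X t \<omega> $ i - \<epsilon> * d t $ i) ` T)"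
    and q: "q $ i > 0"
begin

text \<open>The linear span of all coordinates at points of \<open>T\<close>, written as in
  \<open>gaussian_process\<close> so that Gaussianity of its members is immediate.\<close>

definition H where "H = {\<lambda>\<omega>. \<Sum>t\<in>F. a t \<bullet> X t \<omega> |F a. finite F \<and> F \<subseteq> T}"

lemma linear_in_H: "t \<in> T \<Longrightarrow> (\<lambda>\<omega>. w \<bullet> X t \<omega>) \<in> H"
  unfolding H_def by (intro CollectI exI[of _ "{t}"] exI[of _ "\<lambda>_. w"]) auto

lemma coordinate_eq: "X t \<omega> $ i = axis i 1 \<bullet> X t \<omega>"
  by (simp add: inner_commute[of "axis i 1"] inner_axis)

lemma coordinate_in_H: "t \<in> T \<Longrightarrow> (\<lambda>\<omega>. X t \<omega> $ i) \<in> H"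
  unfolding coordinate_eq by (rule linear_in_H)

lemma gaussian_coordinate:
  assumes "t \<in> T"
  shows "gaussian_rv M (\<lambda>\<omega>. X t \<omega> $ i)"
proof -
  have *: "\<And>F a. finite F \<Longrightarrow> F \<subseteq> T \<Longrightarrow> gaussian_rv M (\<lambda>\<omega>. \<Sum>t\<in>F. a t \<bullet> X t \<omega>)"
    using gaussian_process by (simp add: gaussian_process_def)
  have "gaussian_rv M (\<lambda>\<omega>. \<Sum>s\<in>{t}. axis i 1 \<bullet> X s \<omega>)"
    by (rule *) (use assms in auto)
  then show ?thesis unfolding coordinate_eq by simp
qed

text \<open>Shown directly from the law because it enters the instantiation of
  \<open>gaussian_space\<close>: means of members of \<open>H\<close> are computed by linearity,
  which requires integrability.\<close>

lemma integrable_coordinate: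
  assumes "t \<in> T"
  shows "integrable M (\<lambda>\<omega>. X t \<omega> $ i)"
proof -
  let ?Y = "\<lambda>\<omega>. X t \<omega> $ i"
  have [measurable]: "?Y \<in> borel_measurable M"
    using gaussian_coordinate[OF assms] by (simp add: gaussian_rv_def)
  consider \<mu> \<sigma> where "\<sigma> > 0" "distributed M lborel ?Y (normal_density \<mu> \<sigma>)" | c where "AE \<omega> in M. ?Y \<omega> = c"
    using gaussian_coordinate[OF assms, of i] unfolding gaussian_rv_def by blast
  then show ?thesis
  proof cases
    case 1
    show ?thesis
      using distributed_integrable[OF 1(2), of "\<lambda>x. x"] integrable_normal_moment_nz_1[OF 1(1)] by simp
  next
    case 2
    then have "integrable M ?Y \<longleftrightarrow> integrable M (\<lambda>_. c)" by (intro integrable_cong_AE) auto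
    then show ?thesis by simp
  qed
qed

lemma H_cases:
  assumes "Y \<in> H"
  obtains F f where "finite F" "F \<subseteq> T" "Y = (\<lambda>\<omega>. \<Sum>t\<in>F. f t \<bullet> X t \<omega>)"
  using assms unfolding H_def by blast

lemma combination_in_H:
  assumes "Y \<in> H" "Z \<in> H"
  shows "(\<lambda>\<omega>. a * Y \<omega> + b * Z \<omega>) \<in> H"
proof -
  obtain F f G g where F: "finite F" "F \<subseteq> T" "Y = (\<lambda>\<omega>. \<Sum>t\<in>F. f t \<bullet> X t \<omega>)"
    and G: "finite G" "G \<subseteq> T" "Z = (\<lambda>\<omega>. \<Sum>t\<in>G. g t \<bullet> X t \<omega>)"
    using assms unfolding H_def by blast
  define h where "h t = (if t \<in> F then a *\<^sub>R f t else 0) + (if t \<in> G then b *\<^sub>R g t else 0)" for t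
  have "a * Y \<omega> + b * Z \<omega> = (\<Sum>t\<in>F \<union> G. h t \<bullet> X t \<omega>)" for \<omega>
  proof -
    have "(\<Sum>t\<in>F \<union> G. h t \<bullet> X t \<omega>)
      = (\<Sum>t\<in>F \<union> G. (if t \<in> F then a *\<^sub>R f t else 0) \<bullet> X t \<omega>) + (\<Sum>t\<in>F \<union> G. (if t \<in> G then b *\<^sub>R g t else 0) \<bullet> X t \<omega>)"
      by (simp add: h_def inner_add_left sum.distrib)
    also have "(\<Sum>t\<in>F \<union> G. (if t \<in> F then a *\<^sub>R f t else 0) \<bullet> X t \<omega>) = (\<Sum>t\<in>F. a * (f t \<bullet> X t \<omega>))"
      using F(1) G(1) by (intro sum.mono_neutral_cong_right) auto
    also have "(\<Sum>t\<in>F \<union> G. (if t \<in> G then b *\<^sub>R g t else 0) \<bullet> X t \<omega>) = (\<Sum>t\<in>G. b * (g t \<bullet> X t \<omega>))"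
      using F(1) G(1) by (intro sum.mono_neutral_cong_right) auto
    finally show ?thesis by (simp add: F(3) G(3) sum_distrib_left)
  qed
  then show ?thesis unfolding H_def using F(1,2) G(1,2)
    by (intro CollectI exI[of _ "F \<union> G"] exI[of _ h]) auto
qed

sublocale gaussian_space M H
proof
  show "(\<lambda>_. 0) \<in> H" unfolding H_def by (intro CollectI exI[of _ "{}"]) auto
  show "(\<lambda>\<omega>. a * Y \<omega> + b * Z \<omega>) \<in> H" if "Y \<in> H" "Z \<in> H" for Y Z a b
    using that by (rule combination_in_H)
  show "gaussian_rv M Y" if "Y \<in> H" for Y
    using that gaussian_process unfolding H_def gaussian_process_def by blast
  show "expectation Y = 0" if Y: "Y \<in> H" for Y
  proof -
    obtain F f where F: "finite F" "F \<subseteq> T" "Y = (\<lambda>\<omega>. \<Sum>t\<in>F. f t \<bullet> X t \<omega>)"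
      using Y by (rule H_cases)
    have inner: "f t \<bullet> X t \<omega> = (\<Sum>i\<in>UNIV. f t $ i * X t \<omega> $ i)" for t \<omega>
      by (simp add: inner_vec_def)
    have int: "integrable M (\<lambda>\<omega>. f t \<bullet> X t \<omega>)" if "t \<in> F" for t
      unfolding inner using that F(2) by (auto intro!: Bochner_Integration.integrable_sum integrable_coordinate)
    have "expectation (\<lambda>\<omega>. f t \<bullet> X t \<omega>) = 0" if "t \<in> F" for t
    proof -
      have "t \<in> T" using that F(2) by auto
      then have "expectation (\<lambda>\<omega>. f t \<bullet> X t \<omega>) = (\<Sum>i\<in>UNIV. f t $ i * expectation (\<lambda>\<omega>. X t \<omega> $ i))"
        unfolding inner by (subst Bochner_Integration.integral_sum) (auto intro!: integrable_coordinate)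
      also have "\<dots> = 0"
        using centered_process \<open>t \<in> T\<close> unfolding centered_process_def by simp
      finally show ?thesis .
    qed
    then show ?thesis unfolding F(3) using int by (subst Bochner_Integration.integral_sum) auto
  qed
qed

section \<open>Covariance matrices, dual variables and \<open>M_point\<close>\<close>

definition \<Sigma> where "\<Sigma> t = cov_matrix M (X t)"

definition P where "P t = inv_cov M X t"

definition Q where "Q t x = x \<bullet> (P t *v x)"

definition b where "b u t = u *\<^sub>R q + d t"

lemma b_nth: "b u t $ i = u * q $ i + d t $ i"
  by (simp add: b_def)

lemma \<Sigma>_nth: "t \<in> T \<Longrightarrow> \<Sigma> t $ i $ j = cov (\<lambda>\<omega>. X t \<omega> $ i) (\<lambda>\<omega>. X t \<omega> $ j)"
  using centered_process by (simp add: \<Sigma>_def cov_matrix_def centered_process_def cov_def)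

lemma \<Sigma>_P: "t \<in> T \<Longrightarrow> \<Sigma> t *v (P t *v x) = x"
  unfolding \<Sigma>_def P_def inv_cov_def using invertible_cov
  by (simp add: matrix_vector_mul_assoc matrix_inv_props)

lemma transpose_P:
  assumes "t \<in> T" shows "transpose (P t) = P t"
proof -
  have "transpose (\<Sigma> t) = \<Sigma> t"
    by (simp add: transpose_def vec_eq_iff \<Sigma>_nth[OF assms] cov_sym)
  then show ?thesis using invertible_cov[OF assms] symmetric_matrix_inv
    unfolding \<Sigma>_def P_def inv_cov_def by blast
qed

lemma cov_linear_coordinate:
  assumes "t \<in> T"
  shows "cov (\<lambda>\<omega>. X t \<omega> $ i) (\<lambda>\<omega>. w \<bullet> X t \<omega>) = (\<Sigma> t *v w) $ i"
proof -
  have "cov (\<lambda>\<omega>. \<Sum>j\<in>UNIV. w $ j * X t \<omega> $ j) (\<lambda>\<omega>. X t \<omega> $ i)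
    = (\<Sum>j\<in>UNIV. w $ j * cov (\<lambda>\<omega>. X t \<omega> $ j) (\<lambda>\<omega>. X t \<omega> $ i))"
    by (intro cov_sum coordinate_in_H assms) auto
  then show ?thesis
    by (simp add: inner_vec_def matrix_vector_mult_def \<Sigma>_nth[OF assms] cov_sym[of "\<lambda>\<omega>. X t \<omega> $ i"] mult.commute)
qed

lemma cov_linear:
  assumes "t \<in> T"
  shows "cov (\<lambda>\<omega>. w \<bullet> X t \<omega>) (\<lambda>\<omega>. w \<bullet> X t \<omega>) = w \<bullet> (\<Sigma> t *v w)"
proof -
  define W where "W = (\<lambda>\<omega>. w \<bullet> X t \<omega>)"
  have W: "W \<in> H" unfolding W_def by (rule linear_in_H[OF assms])
  have W_sum: "W = (\<lambda>\<omega>. \<Sum>j\<in>UNIV. w $ j * X t \<omega> $ j)" by (simp add: W_def inner_vec_def)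
  have "cov W V = (\<Sum>j\<in>UNIV. w $ j * cov (\<lambda>\<omega>. X t \<omega> $ j) V)" if "V \<in> H" for V
    unfolding W_sum using that by (intro cov_sum coordinate_in_H assms) auto
  moreover have "cov (\<lambda>\<omega>. X t \<omega> $ j) W = (\<Sigma> t *v w) $ j" for j
    unfolding W_def by (rule cov_linear_coordinate[OF assms])
  ultimately have "cov W W = (\<Sum>j\<in>UNIV. w $ j * (\<Sigma> t *v w) $ j)"
    using W by simp
  then show ?thesis by (simp add: W_def inner_vec_def)
qed

text \<open>\<open>(P t *v x) \<bullet> X t \<omega>\<close> is the variable that represents
  \<open>x\<close> through covariances, as in a Cameron-Martin space with squared norm
  \<open>Q t x\<close>. Both claims reduce to \<open>\<Sigma>_P\<close>.\<close>

lemma cov_dual: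
  assumes "t \<in> T"
  shows "cov (\<lambda>\<omega>. X t \<omega> $ i) (\<lambda>\<omega>. (P t *v x) \<bullet> X t \<omega>) = x $ i"
    and "cov (\<lambda>\<omega>. (P t *v x) \<bullet> X t \<omega>) (\<lambda>\<omega>. (P t *v x) \<bullet> X t \<omega>) = Q t x"
  unfolding cov_linear_coordinate[OF assms] cov_linear[OF assms] \<Sigma>_P[OF assms] Q_def
  by (simp_all add: inner_commute)

lemma Q_nonneg: "t \<in> T \<Longrightarrow> 0 \<le> Q t x"
  using cov_dual(2) cov_nonneg by metis

text \<open>Cauchy-Schwarz for a coordinate and the dual variable. It supplies both the coercivity
  of \<open>Q t\<close> and the growth of \<open>M_set\<close>.\<close>

lemma coordinate_sq_le: "t \<in> T \<Longrightarrow> (x $ i)\<^sup>2 \<le> \<Sigma> t $ i $ i * Q t x"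
  using cov_square_le[OF coordinate_in_H linear_in_H, of t t i "P t *v x"]
  by (simp add: cov_dual \<Sigma>_nth)

lemma M_point_minimizer:
  assumes t: "t \<in> T"
  obtains x where "\<And>i. b u t $ i \<le> x $ i" "Q t x = M_point M X d q u t"
    "\<And>i. 0 \<le> (P t *v x) $ i" "Q t x \<le> (P t *v x) \<bullet> b u t"
proof -
  have coercive: "(x $ i)\<^sup>2 \<le> (\<chi> i. \<Sigma> t $ i $ i) $ i * (x \<bullet> (P t *v x))" for x i
    using coordinate_sq_le[OF t] by (simp add: Q_def)
  have nonneg: "(\<chi> i. \<Sigma> t $ i $ i) $ i \<ge> 0" for i
    using cov_nonneg by (simp add: \<Sigma>_nth[OF t])
  show thesis
  proof (rule quadratic_program_minimizer[OF transpose_P[OF t] coercive nonneg, where b = "b u t"])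
    fix x
    assume "\<And>i. b u t $ i \<le> x $ i"
      and "\<And>y. (\<And>i. b u t $ i \<le> y $ i) \<Longrightarrow> x \<bullet> (P t *v x) \<le> y \<bullet> (P t *v y)"
      and "\<And>i. 0 \<le> (P t *v x) $ i" and "x \<bullet> (P t *v x) \<le> (P t *v x) \<bullet> b u t"
    note x = this[folded Q_def]
  have "M_point M X d q u t = (INF v\<in>{v. \<forall>i. v $ i \<ge> u * q $ i}. Q t (v + d t))"
    by (simp add: M_point_def Q_def P_def)
  also have "\<dots> = Q t x"
  proof (rule cInf_eq_minimum)
    \<comment> \<open>The infimum runs over \<open>v\<close>, the quadratic program over
      \<open>x = v + d t\<close>.\<close>
    show "Q t x \<in> (\<lambda>v. Q t (v + d t)) ` {v. \<forall>i. v $ i \<ge> u * q $ i}"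
      using x(1) by (intro image_eqI[of _ _ "x - d t"]) (auto simp: b_nth algebra_simps)
    show "Q t x \<le> y" if "y \<in> (\<lambda>v. Q t (v + d t)) ` {v. \<forall>i. v $ i \<ge> u * q $ i}" for y
      using that by (auto intro!: x(2) simp: b_nth)
  qed
    finally show thesis using that[OF x(1) _ x(3,4)] by simp
  qed
qed

lemma M_point_nonneg: "t \<in> T \<Longrightarrow> 0 \<le> M_point M X d q u t"
  by (metis M_point_minimizer Q_nonneg)

lemma bdd_below_M_point: "bdd_below (M_point M X d q u ` T)"
  using M_point_nonneg by (auto intro!: bdd_belowI)

lemma M_set_le: "t \<in> T \<Longrightarrow> 2 * M_set M X d q u T \<le> M_point M X d q u t"
  unfolding M_set_def using bdd_below_M_point by (simp add: cINF_lower)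

section \<open>Uniform consequences of (A2)\<close>

lemma coordinate_deviation_small:
  assumes \<epsilon>: "0 < \<epsilon>" "\<epsilon> \<le> 1"
  shows "eventually (\<lambda>u. \<forall>i. \<forall>t\<in>T. 0 < b u t $ i \<and> sqrt (\<Sigma> t $ i $ i) \<le> \<epsilon> * b u t $ i) at_top"
proof (rule eventually_all_finite)
  fix i
  \<comment> \<open>Tightness of \<open>X t \<omega> $ i - e * d t $ i\<close> bounds the standard
    deviation by \<open>n + e * d t $ i\<close> with one \<open>n\<close> for all \<open>t\<close>;
    a large \<open>u\<close> then absorbs \<open>n\<close> into
    \<open>e * (u * q $ i)\<close>.\<close>
  define e where "e = \<epsilon> / 2"
  have e: "0 < e" "e \<in> {0<..1}" using \<epsilon> by (auto simp: e_def)
  have m: "(\<lambda>\<omega>. X t \<omega> $ i - e * d t $ i) \<in> borel_measurable M" if "t \<in> T" for t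
    using measurable_H[OF coordinate_in_H[OF that]] by simp
  obtain n :: nat where n: "\<And>t. t \<in> T \<Longrightarrow>
      prob {\<omega> \<in> space M. X t \<omega> $ i - e * d t $ i > real n} < std_normal_density 2"
    using tight_uniform[OF m bounded[OF e(2)], where \<delta> = "std_normal_density 2"] by (auto simp: normal_density_pos)
  have \<sigma>: "sqrt (\<Sigma> t $ i $ i) \<le> real n + e * d t $ i" if t: "t \<in> T" for t
  proof -
    have "{\<omega> \<in> space M. X t \<omega> $ i - e * d t $ i > real n} = {\<omega> \<in> space M. X t \<omega> $ i > real n + e * d t $ i}"
      by auto
    then show ?thesis unfolding \<Sigma>_nth[OF t]
      using n[OF t] by (intro sqrt_cov_le_of_tail coordinate_in_H t) simp
  qed
  show "eventually (\<lambda>u. \<forall>t\<in>T. 0 < b u t $ i \<and> sqrt (\<Sigma> t $ i $ i) \<le> \<epsilon> * b u t $ i) at_top"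
    using eventually_ge_at_top[of "(2 * real n + 1) / (e * q $ i)"]
  proof eventually_elim
    case (elim u)
    then have u: "2 * real n + 1 \<le> e * (u * q $ i)" using e q[of i] by (simp add: field_simps)
    show ?case
    proof
      fix t assume t: "t \<in> T"
      have "0 \<le> sqrt (\<Sigma> t $ i $ i)" using cov_nonneg by (simp add: \<Sigma>_nth[OF t])
      \<comment> \<open>Nonnegativity of the standard deviation bounds the otherwise arbitrary drift
        from below; with the threshold \<open>2 * n + 1\<close> this gives
        \<open>e * b u t $ i \<ge> n + 1\<close>.\<close>
      then have d: "- real n \<le> e * d t $ i" using \<sigma>[OF t] by linarith
      have eb: "e * b u t $ i = e * (u * q $ i) + e * d t $ i" by (simp add: b_nth algebra_simps)
      then have "0 < e * b u t $ i" using u d by linarith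
      then have "0 < b u t $ i" using e(1) by (simp add: zero_less_mult_iff)
      moreover have "real n + e * d t $ i \<le> 2 * (e * b u t $ i)" unfolding eb using u d of_nat_0_le_iff[of n, where 'a = real] by argo
      then have "sqrt (\<Sigma> t $ i $ i) \<le> \<epsilon> * b u t $ i" using \<sigma>[OF t] by (simp add: e_def)
      ultimately show "0 < b u t $ i \<and> sqrt (\<Sigma> t $ i $ i) \<le> \<epsilon> * b u t $ i" by simp
    qed
  qed
qed

text \<open>The suprema of \<open>X s \<omega> $ i - \<epsilon> * d s $ i\<close> are tight by (A2),
  and a constant bound is at most \<open>\<epsilon> * (u * q $ i)\<close> for large
  \<open>u\<close>. This supplies the probability 1/2 in the concentration bound.\<close>

lemma all_below_likely:
  assumes S: "countable S" "S \<subseteq> T" and \<epsilon>: "0 < \<epsilon>" "\<epsilon> \<le> 1"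
  shows "eventually (\<lambda>u. 1 / 2 \<le> prob {\<omega> \<in> space M. \<forall>s\<in>S. \<forall>i. X s \<omega> $ i \<le> \<epsilon> * b u s $ i}) at_top"
proof -
  have \<epsilon>': "\<epsilon> \<in> {0<..1}" using \<epsilon> by simp
  have m: "(\<lambda>\<omega>. X s \<omega> $ i - \<epsilon> * d s $ i) \<in> borel_measurable M" if "s \<in> S" for s i
    using measurable_H[OF coordinate_in_H, of s] that S(2) by (auto intro!: borel_measurable_diff)
  have bd: "AE \<omega> in M. bdd_above ((\<lambda>s. X s \<omega> $ i - \<epsilon> * d s $ i) ` S)" for i
    using bounded[OF \<epsilon>', of i] by eventually_elim (rule bdd_above_mono, use S(2) in auto)
  define p where "p i n = prob {\<omega> \<in> space M. \<exists>s\<in>S. X s \<omega> $ i - \<epsilon> * d s $ i > real n}" for i n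
  \<comment> \<open>The level for a union bound over coordinates with total failure probability
    1/2.\<close>
  have "\<exists>n. p i n < 1 / (2 * real CARD('n))" for i
    unfolding p_def by (rule tight_countable[OF S(1) m bd]) auto
  then obtain n where n: "\<And>i. p i (n i) < 1 / (2 * real CARD('n))" by metis
  define B where "B i = {\<omega> \<in> space M. \<exists>s\<in>S. X s \<omega> $ i - \<epsilon> * d s $ i > real (n i)}" for i
  have B: "B i \<in> events" for i
    unfolding B_def using m by (intro sets.sets_Collect_countable_Ex' S) auto
  have "prob (\<Union>i. B i) \<le> (\<Sum>i\<in>UNIV. prob (B i))" using B by (intro measure_UNION_le) auto
  also have "\<dots> \<le> (\<Sum>i\<in>(UNIV :: 'n set). 1 / (2 * real CARD('n)))"
    using n by (intro sum_mono less_imp_le) (simp add: B_def p_def)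
  also have "\<dots> = 1 / 2" by simp
  finally have B_le: "prob (\<Union>i. B i) \<le> 1 / 2" .
  have "eventually (\<lambda>u. \<forall>i. real (n i) / (\<epsilon> * q $ i) \<le> u) at_top"
    by (intro eventually_all_finite eventually_ge_at_top)
  then show ?thesis
  proof eventually_elim
    case (elim u)
    then have u: "real (n i) \<le> \<epsilon> * (u * q $ i)" for i
    proof -
      have "real (n i) / (\<epsilon> * q $ i) \<le> u" using elim by blast
      then show ?thesis using \<epsilon> q[of i] by (simp add: pos_divide_le_eq mult_ac)
    qed
    have "space M - (\<Union>i. B i) \<subseteq> {\<omega> \<in> space M. \<forall>s\<in>S. \<forall>i. X s \<omega> $ i \<le> \<epsilon> * b u s $ i}"
    proof safe
      fix \<omega> s i assume "\<omega> \<in> space M" "\<omega> \<notin> (\<Union>i. B i)" "s \<in> S"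
      then have "X s \<omega> $ i - \<epsilon> * d s $ i \<le> real (n i)" by (auto simp: B_def not_less)
      then show "X s \<omega> $ i \<le> \<epsilon> * b u s $ i" using u[of i] by (simp add: b_nth algebra_simps)
    qed
    moreover have "{\<omega> \<in> space M. X s \<omega> $ i \<le> \<epsilon> * b u s $ i} \<in> events" if "s \<in> S" for s i
      using measurable_H[OF coordinate_in_H, of s i] that S(2) by (auto intro: borel_measurable_le)
    then have "{\<omega> \<in> space M. \<forall>s\<in>S. \<forall>i. X s \<omega> $ i \<le> \<epsilon> * b u s $ i} \<in> events"
      by (intro sets.sets_Collect_countable_All'[OF _ S(1)] sets.sets_Collect_countable_All)
    ultimately have "prob (space M - (\<Union>i. B i)) \<le> prob {\<omega> \<in> space M. \<forall>s\<in>S. \<forall>i. X s \<omega> $ i \<le> \<epsilon> * b u s $ i}"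
      by (intro finite_measure_mono)
    moreover have "prob (space M - (\<Union>i. B i)) = 1 - prob (\<Union>i. B i)"
      using B by (intro prob_compl) auto
    ultimately show ?case using B_le by linarith
  qed
qed

text \<open>For the minimiser \<open>x\<close> and any single coordinate, \<open>b_i^2 \<le> x_i^2
  \<le> \<Sigma>_ii * Q \<le> \<epsilon>^2 * b_i^2 * Q\<close>, hence
  \<open>Q \<ge> 1 / \<epsilon>^2\<close> uniformly in \<open>t\<close>.\<close>

lemma M_set_at_top: "filterlim (\<lambda>u. M_set M X d q u T) at_top at_top"
  unfolding filterlim_at_top_ge[where c = 1]
proof (intro allI impI)
  fix K :: real assume K: "1 \<le> K"
  \<comment> \<open>Restricting to \<open>K \<ge> 1\<close> keeps \<open>\<epsilon> \<le> 1\<close>,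
    so \<open>1 \<le> \<epsilon>\<^sup>2 * Q t x\<close> weakens to
    \<open>1 \<le> \<epsilon> * Q t x\<close>, which is \<open>2 * K \<le> Q t x\<close>.\<close>
  define \<epsilon> where "\<epsilon> = 1 / (2 * K)"
  have \<epsilon>: "0 < \<epsilon>" "\<epsilon> \<le> 1" using K by (auto simp: \<epsilon>_def)
  show "eventually (\<lambda>u. K \<le> M_set M X d q u T) at_top"
    using coordinate_deviation_small[OF \<epsilon>]
  proof eventually_elim
    case (elim u)
    have "2 * K \<le> M_point M X d q u t" if t: "t \<in> T" for t
    proof -
      fix i :: 'n
      obtain x where x: "\<And>i. b u t $ i \<le> x $ i" "Q t x = M_point M X d q u t"
        using M_point_minimizer[OF t] by metis
      have b: "0 < b u t $ i" "sqrt (\<Sigma> t $ i $ i) \<le> \<epsilon> * b u t $ i" using elim t by auto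
      have "\<Sigma> t $ i $ i = (sqrt (\<Sigma> t $ i $ i))\<^sup>2" using cov_nonneg by (simp add: \<Sigma>_nth[OF t])
      also have "\<dots> \<le> (\<epsilon> * b u t $ i)\<^sup>2" using b(2) cov_nonneg by (intro power_mono) (auto simp: \<Sigma>_nth[OF t])
      finally have \<sigma>: "\<Sigma> t $ i $ i \<le> (\<epsilon> * b u t $ i)\<^sup>2" .
      have "(b u t $ i)\<^sup>2 \<le> (x $ i)\<^sup>2" using b(1) x(1)[of i] by (intro power_mono) auto
      also have "\<dots> \<le> \<Sigma> t $ i $ i * Q t x" by (rule coordinate_sq_le[OF t])
      also have "\<dots> \<le> (\<epsilon> * b u t $ i)\<^sup>2 * Q t x" by (intro mult_right_mono \<sigma> Q_nonneg t)
      finally have "1 * (b u t $ i)\<^sup>2 \<le> (\<epsilon>\<^sup>2 * Q t x) * (b u t $ i)\<^sup>2" by (simp add: power_mult_distrib mult_ac)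
      then have "1 \<le> \<epsilon>\<^sup>2 * Q t x" using b(1) by (simp add: mult_le_cancel_right)
      also have "\<epsilon>\<^sup>2 * Q t x \<le> \<epsilon> * Q t x"
        using \<epsilon> Q_nonneg[OF t] by (intro mult_right_mono) (auto simp: power2_eq_square mult_left_le)
      finally show ?thesis using K by (simp add: \<epsilon>_def x(2) field_simps)
    qed
    then have "2 * K \<le> (INF t\<in>T. M_point M X d q u t)" by (intro cINF_greatest T)
    then show ?case by (simp add: M_set_def)
  qed
qed

section \<open>Estimates of the exceedance probability\<close>

definition E where "E u = {\<omega> \<in> space M. \<exists>t\<in>T. \<forall>i. b u t $ i < X t \<omega> $ i}"

lemma exceed_prob_eq: "exceed_prob M X d q T u = measure (completion M) (E u)"
  unfolding exceed_prob_def E_def by (simp add: b_nth less_diff_eq)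

text \<open>Exceedance means that \<open>X t \<omega> - d t\<close> leaves a finite union
  \<open>F\<close> of closed half-spaces; separability is applied to this \<open>F\<close> with
  \<open>I = UNIV\<close>. The separant is chosen before \<open>u\<close>, so one \<open>S\<close>
  serves all levels.\<close>

lemma separant:
  "\<exists>S. countable S \<and> S \<subseteq> T \<and>
    (\<forall>u. AE \<omega> in M. \<omega> \<in> E u \<longleftrightarrow> \<omega> \<in> {\<omega> \<in> space M. \<exists>t\<in>S. \<forall>i. b u t $ i < X t \<omega> $ i})"
proof -
  obtain S where S: "countable S" "S \<subseteq> T"
    and ae: "AE \<omega> in M. \<forall>I F. open I \<and> closed F \<longrightarrow>
           ((\<forall>t\<in>T \<inter> I. X t \<omega> - d t \<in> F) \<longleftrightarrow> (\<forall>s\<in>S \<inter> I. X s \<omega> - d s \<in> F))"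
    using separable unfolding separable_process_def by blast
  have "AE \<omega> in M. \<omega> \<in> E u \<longleftrightarrow> \<omega> \<in> {\<omega> \<in> space M. \<exists>t\<in>S. \<forall>i. b u t $ i < X t \<omega> $ i}" for u
    using ae
  proof eventually_elim
    case (elim \<omega>)
    define F where "F = (\<Union>i. {x :: real ^ 'n. x $ i \<le> u * q $ i})"
    have "closed F" unfolding F_def
      by (intro closed_UN finite ballI closed_Collect_le continuous_intros)
    then have "(\<forall>t\<in>T. X t \<omega> - d t \<in> F) \<longleftrightarrow> (\<forall>s\<in>S. X s \<omega> - d s \<in> F)"
      using elim[THEN spec, THEN spec, of UNIV F] by simp
    moreover have "X t \<omega> - d t \<notin> F \<longleftrightarrow> (\<forall>i. b u t $ i < X t \<omega> $ i)" for t
      by (auto simp: F_def b_nth not_le less_diff_eq)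
    ultimately show ?case unfolding E_def by blast
  qed
  with S show ?thesis by blast
qed

lemma event_measurable: "t \<in> T \<Longrightarrow> {\<omega> \<in> space M. \<forall>i. b u t $ i < X t \<omega> $ i} \<in> events"
  using measurable_H[OF coordinate_in_H, of t] by (intro sets.sets_Collect_countable_All) simp

lemma exceed_prob_separant:
  assumes "countable S" "S \<subseteq> T"
    and ae: "AE \<omega> in M. \<omega> \<in> E u \<longleftrightarrow> \<omega> \<in> {\<omega> \<in> space M. \<exists>t\<in>S. \<forall>i. b u t $ i < X t \<omega> $ i}"
  shows "E u \<in> sets (completion M)"
    and "exceed_prob M X d q T u = prob {\<omega> \<in> space M. \<exists>t\<in>S. \<forall>i. b u t $ i < X t \<omega> $ i}"
proof -
  let ?E = "{\<omega> \<in> space M. \<exists>t\<in>S. \<forall>i. b u t $ i < X t \<omega> $ i}"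
  interpret C: prob_space "completion M" by (rule prob_space_completion) 
  have E: "?E \<in> events"
    using assms(2) event_measurable by (intro sets.sets_Collect_countable_Ex' assms(1)) auto
  then have E': "?E \<in> sets (completion M)" by auto
  have ae': "AE \<omega> in completion M. \<omega> \<in> ?E \<longleftrightarrow> \<omega> \<in> E u"
    using AE_completion[OF ae] by eventually_elim auto
  show sets: "E u \<in> sets (completion M)"
    by (rule completion.in_sets_AE[OF ae' E']) (auto simp: E_def)
  have "measure (completion M) (E u) = measure (completion M) ?E"
    by (rule C.finite_measure_eq_AE[OF _ sets E']) (use ae' in auto)
  then show "exceed_prob M X d q T u = prob ?E"
    using E by (simp add: exceed_prob_eq)
qed

lemma exceed_prob_le:
  assumes l: "0 < l" "l < 1" and \<eta>: "0 < \<eta>" "\<eta> < 1"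
  shows "eventually (\<lambda>u. exceed_prob M X d q T u
    \<le> 2 powr (l / (1 - l)) * exp (- l * (1 - \<eta>)\<^sup>2 * M_set M X d q u T)) at_top"
proof -
  obtain S where S: "countable S" "S \<subseteq> T"
    and ae: "\<And>u. AE \<omega> in M. \<omega> \<in> E u \<longleftrightarrow> \<omega> \<in> {\<omega> \<in> space M. \<exists>t\<in>S. \<forall>i. b u t $ i < X t \<omega> $ i}"
    using separant by blast
  have "eventually (\<lambda>u. 1 \<le> M_set M X d q u T) at_top"
    using M_set_at_top by (simp add: filterlim_at_top)
  moreover have "\<eta> \<le> 1" using \<eta> by simp
  note all_below_likely[OF S \<eta>(1) this]
  moreover note coordinate_deviation_small[OF zero_less_one order_refl]
  ultimately show ?thesis
  proof eventually_elim
    case (elim u)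
    define m where "m = M_set M X d q u T"
    have m: "1 \<le> m" using elim(1) by (simp add: m_def)
    have "\<forall>t\<in>T. \<exists>x. Q t x = M_point M X d q u t \<and> (\<forall>i. 0 \<le> (P t *v x) $ i) \<and> Q t x \<le> (P t *v x) \<bullet> b u t"
    proof
      fix t assume t: "t \<in> T"
      show "\<exists>x. Q t x = M_point M X d q u t \<and> (\<forall>i. 0 \<le> (P t *v x) $ i) \<and> Q t x \<le> (P t *v x) \<bullet> b u t"
        by (rule M_point_minimizer[OF t, of u]) blast
    qed
    from bchoice[OF this] obtain x where x: "\<forall>t\<in>T. Q t (x t) = M_point M X d q u t
        \<and> (\<forall>i. 0 \<le> (P t *v x t) $ i) \<and> Q t (x t) \<le> (P t *v x t) \<bullet> b u t"
      by (rule exE)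
    define w where "w t = P t *v x t" for t
    define c where "c t = w t \<bullet> b u t" for t
    define Y where "Y t = (\<lambda>\<omega>. (w t \<bullet> X t \<omega>) / c t)" for t
    have w: "\<And>i. 0 \<le> w t $ i" and Qc: "Q t (x t) \<le> c t" and Qm: "2 * m \<le> Q t (x t)" if "t \<in> T" for t
      using x that M_set_le[OF that, of u] by (auto simp: w_def c_def m_def)
    have c: "0 < c t" if "t \<in> T" for t using Qc[OF that] Qm[OF that] m by linarith
    have wX: "(\<lambda>\<omega>. w t \<bullet> X t \<omega>) \<in> H" if "t \<in> T" for t by (rule linear_in_H[OF that])
    have Y: "Y t \<in> H" if "t \<in> T" for t unfolding Y_def by (intro divide wX that)
    have "cov (Y t) (Y t) \<le> (1 / sqrt (2 * m))\<^sup>2" if t: "t \<in> T" for t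
    proof -
      have "cov (Y t) (Y t) = Q t (x t) / c t / c t"
        unfolding Y_def using cov_dual(2)[OF t, of "x t"] by (simp add: cov_divide wX[OF t] divide[OF wX[OF t]] flip: w_def)
      \<comment> \<open>The variance \<open>Q / c^2\<close> is at most \<open>1 / c\<close> by
        \<open>Q \<le> c\<close>, and then at most \<open>1 / (2 * m)\<close> by
        \<open>2 * m \<le> Q \<le> c\<close>.\<close>
      also have "\<dots> \<le> c t / c t / c t"
        using Qc[OF t] c[OF t] by (intro divide_right_mono) auto
      also have "\<dots> = 1 / c t" using c[OF t] by simp
      also have "\<dots> \<le> 1 / (2 * m)" using Qc[OF t] Qm[OF t] m by (intro divide_left_mono mult_pos_pos) auto
      finally show ?thesis using m by (simp add: power_divide)
    qed
    note var = this
    have half: "1 / 2 \<le> prob {\<omega> \<in> space M. \<forall>t\<in>F. Y t \<omega> \<le> \<eta>}" if F: "finite F" "F \<subseteq> S" for F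
    proof -
      note elim(2)
      also have "prob {\<omega> \<in> space M. \<forall>s\<in>S. \<forall>i. X s \<omega> $ i \<le> \<eta> * b u s $ i} \<le> prob {\<omega> \<in> space M. \<forall>t\<in>F. Y t \<omega> \<le> \<eta>}"
      proof (intro finite_measure_mono subsetI)
        fix \<omega> assume \<omega>: "\<omega> \<in> {\<omega> \<in> space M. \<forall>s\<in>S. \<forall>i. X s \<omega> $ i \<le> \<eta> * b u s $ i}"
        have "Y t \<omega> \<le> \<eta>" if t: "t \<in> F" for t
        proof -
          have tS: "t \<in> S" "t \<in> T" using t F S by auto
          have "w t \<bullet> X t \<omega> \<le> w t \<bullet> (\<eta> *\<^sub>R b u t)"
            using \<omega> tS w[OF tS(2)] by (intro inner_mono) auto
          then show ?thesis using c[OF tS(2)] by (simp add: Y_def c_def divide_le_eq)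
        qed
        then show "\<omega> \<in> {\<omega> \<in> space M. \<forall>t\<in>F. Y t \<omega> \<le> \<eta>}" using \<omega> by auto
      next
        have "{\<omega> \<in> space M. Y t \<omega> \<le> \<eta>} \<in> events" if "t \<in> F" for t
          using measurable_H[OF Y, of t] that F S by auto
        then show "{\<omega> \<in> space M. \<forall>t\<in>F. Y t \<omega> \<le> \<eta>} \<in> events"
          using F by (intro sets.sets_Collect_finite_All) auto
      qed
      finally show ?thesis .
    qed
    have "prob {\<omega> \<in> space M. \<exists>t\<in>S. Y t \<omega> > 1} \<le> 2 powr (l / (1 - l)) * exp (- l * (1 - \<eta>)\<^sup>2 * m)"
    proof (rule prob_countable_Ex_le[OF S(1)])
      show "{\<omega> \<in> space M. Y t \<omega> > 1} \<in> events" if "t \<in> S" for t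
        using measurable_H[OF Y, of t] that S by auto
      fix F assume F: "finite F" "F \<subseteq> S"
      have "prob {\<omega> \<in> space M. \<exists>t\<in>F. Y t \<omega> > 1}
        \<le> 2 powr (l / (1 - l)) * exp (- l * (1 - \<eta>)\<^sup>2 / (2 * (1 / sqrt (2 * m))\<^sup>2))"
        using F S m by (intro concentration Y var l half \<eta>(2)) auto
      also have "- l * (1 - \<eta>)\<^sup>2 / (2 * (1 / sqrt (2 * m))\<^sup>2) = - l * (1 - \<eta>)\<^sup>2 * m"
        using m by (simp add: power_divide)
      finally show "prob {\<omega> \<in> space M. \<exists>t\<in>F. Y t \<omega> > 1} \<le> 2 powr (l / (1 - l)) * exp (- l * (1 - \<eta>)\<^sup>2 * m)" .
    qed
    moreover have "prob {\<omega> \<in> space M. \<exists>t\<in>S. \<forall>i. b u t $ i < X t \<omega> $ i} \<le> prob {\<omega> \<in> space M. \<exists>t\<in>S. Y t \<omega> > 1}"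
    proof (intro finite_measure_mono subsetI)
      fix \<omega> assume "\<omega> \<in> {\<omega> \<in> space M. \<exists>t\<in>S. \<forall>i. b u t $ i < X t \<omega> $ i}"
      then obtain t where t: "\<omega> \<in> space M" "t \<in> S" "t \<in> T" "\<And>i. b u t $ i < X t \<omega> $ i" using S by auto
      \<comment> \<open>A zero weight vector would give only equality; \<open>c t > 0\<close>
        excludes it and makes the exceedance of 1 strict.\<close>
      have "w t \<noteq> 0" using c[OF t(3)] by (auto simp: c_def)
      then have "c t < w t \<bullet> X t \<omega>" unfolding c_def using w[OF t(3)] t(4) by (intro inner_strict_mono) auto
      then have "Y t \<omega> > 1" using c[OF t(3)] by (simp add: Y_def)
      then show "\<omega> \<in> {\<omega> \<in> space M. \<exists>t\<in>S. Y t \<omega> > 1}" using t by auto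
    next
      have "{\<omega> \<in> space M. Y t \<omega> > 1} \<in> events" if "t \<in> S" for t
        using measurable_H[OF Y, of t] that S by auto
      then show "{\<omega> \<in> space M. \<exists>t\<in>S. Y t \<omega> > 1} \<in> events"
        by (intro sets.sets_Collect_countable_Ex' S(1)) auto
    qed
    ultimately show ?case unfolding exceed_prob_separant(2)[OF S ae] m_def by linarith
  qed
qed

lemma exceed_prob_ge:
  assumes \<epsilon>: "0 < \<epsilon>" "\<epsilon> \<le> 1"
  shows "eventually (\<lambda>u. std_normal_density ((1 + \<epsilon>) * sqrt ((1 + \<epsilon>) * (2 * M_set M X d q u T)) + 1) / 2
    \<le> exceed_prob M X d q T u) at_top"
proof -
  obtain S where S: "countable S" "S \<subseteq> T"
    and ae: "\<And>u. AE \<omega> in M. \<omega> \<in> E u \<longleftrightarrow> \<omega> \<in> {\<omega> \<in> space M. \<exists>t\<in>S. \<forall>i. b u t $ i < X t \<omega> $ i}"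
    using separant by blast
  \<comment> \<open>Relative deviations of size \<delta> meet the smallness condition of
    \<open>joint_exceedance_ge\<close> for \<epsilon>, since
    \<open>\<delta>\<^sup>2 = \<epsilon>\<^sup>2 / (2 * real CARD('n))\<close>.\<close>
  define \<delta> where "\<delta> = \<epsilon> / sqrt (2 * real CARD('n))"
  have card: "real CARD('n) \<ge> 1" by (simp add: Suc_leI)
  have \<delta>: "0 < \<delta>" "\<delta> \<le> 1" "\<delta>\<^sup>2 = \<epsilon>\<^sup>2 / (2 * real CARD('n))"
  proof -
    have "1 \<le> 2 * real CARD('n)" using card by linarith
    then have "1 \<le> sqrt (2 * real CARD('n))" by simp
    then have "\<epsilon> \<le> sqrt (2 * real CARD('n))" using \<epsilon> by linarith
    then show "\<delta> \<le> 1" using card by (simp add: \<delta>_def divide_le_eq)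
    show "0 < \<delta>" using \<epsilon> card by (simp add: \<delta>_def)
    show "\<delta>\<^sup>2 = \<epsilon>\<^sup>2 / (2 * real CARD('n))" using card by (simp add: \<delta>_def power_divide)
  qed
  have "eventually (\<lambda>u. 1 \<le> M_set M X d q u T) at_top"
    using M_set_at_top by (simp add: filterlim_at_top)
  moreover note coordinate_deviation_small[OF \<delta>(1,2)]
  ultimately show ?thesis
  proof eventually_elim
    case (elim u)
    define m where "m = M_set M X d q u T"
    have m: "1 \<le> m" using elim(1) by (simp add: m_def)
    have "(INF t\<in>T. M_point M X d q u t) < (1 + \<epsilon>) * (2 * m)"
    proof -
      have "(INF t\<in>T. M_point M X d q u t) = 2 * m" by (simp add: m_def M_set_def)
      also have "\<dots> < (1 + \<epsilon>) * (2 * m)" using \<epsilon> m by simp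
      finally show ?thesis .
    qed
    \<comment> \<open>The infimum over \<open>T\<close> may not be attained, so a factor 1 +
      \<epsilon> is given away.\<close>
    then obtain t where t: "t \<in> T" "M_point M X d q u t < (1 + \<epsilon>) * (2 * m)"
      using cINF_less_iff[OF T bdd_below_M_point] by blast
    obtain x where x: "\<And>i. b u t $ i \<le> x $ i" "Q t x = M_point M X d q u t"
      using M_point_minimizer[OF t(1)] by metis
    let ?W = "\<lambda>\<omega>. (P t *v x) \<bullet> X t \<omega>"
    have Q: "2 * m \<le> Q t x" "Q t x \<le> (1 + \<epsilon>) * (2 * m)"
      using t M_set_le[OF t(1), of u] by (simp_all add: x(2) m_def)
    have pos: "0 < x $ i" for i using elim(2) t(1) x(1)[of i] by (auto intro: less_le_trans)
    have "prob {\<omega> \<in> space M. \<forall>i. X t \<omega> $ i > cov (\<lambda>\<omega>. X t \<omega> $ i) ?W}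
      \<ge> std_normal_density ((1 + \<epsilon>) * sqrt (cov ?W ?W) + 1) / 2"
    proof (rule joint_exceedance_ge)
      show "(\<lambda>\<omega>. X t \<omega> $ i) \<in> H" for i by (rule coordinate_in_H[OF t(1)])
      show "?W \<in> H" by (rule linear_in_H[OF t(1)])
      show "0 < cov ?W ?W" unfolding cov_dual[OF t(1)] using Q m by linarith
      show "0 < cov (\<lambda>\<omega>. X t \<omega> $ i) ?W" for i unfolding cov_dual[OF t(1)] by (rule pos)
      show "cov (\<lambda>\<omega>. X t \<omega> $ i) (\<lambda>\<omega>. X t \<omega> $ i) \<le> (\<epsilon> * cov (\<lambda>\<omega>. X t \<omega> $ i) ?W)\<^sup>2 / (2 * real CARD('n))" for i
      proof -
        have b: "0 < b u t $ i" "sqrt (\<Sigma> t $ i $ i) \<le> \<delta> * b u t $ i" using elim t by auto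
        have "\<Sigma> t $ i $ i = (sqrt (\<Sigma> t $ i $ i))\<^sup>2" using cov_nonneg by (simp add: \<Sigma>_nth[OF t(1)])
        also have "\<dots> \<le> (\<delta> * x $ i)\<^sup>2"
        proof (rule power_mono)
          have "\<delta> * b u t $ i \<le> \<delta> * x $ i" using x(1) \<delta> by (intro mult_left_mono) auto
          then show "sqrt (\<Sigma> t $ i $ i) \<le> \<delta> * x $ i" using b by linarith
          show "0 \<le> sqrt (\<Sigma> t $ i $ i)" using cov_nonneg by (simp add: \<Sigma>_nth[OF t(1)])
        qed
        finally show ?thesis unfolding cov_dual[OF t(1)] \<Sigma>_nth[OF t(1), symmetric]
          by (simp add: power_mult_distrib \<delta>(3))
      qed
    qed (use \<epsilon> in simp)
    then have "std_normal_density ((1 + \<epsilon>) * sqrt (Q t x) + 1) / 2 \<le> prob {\<omega> \<in> space M. \<forall>i. X t \<omega> $ i > x $ i}"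
      unfolding cov_dual[OF t(1)] .
    \<comment> \<open>Since \<open>x \<ge> b u t\<close>, exceeding \<open>x\<close> forces
      exceeding \<open>b u t\<close>; aiming at the minimiser makes the exponent
      \<open>Q t x\<close> as small as possible.\<close>
    also have "prob {\<omega> \<in> space M. \<forall>i. X t \<omega> $ i > x $ i} \<le> prob {\<omega> \<in> space M. \<forall>i. b u t $ i < X t \<omega> $ i}"
      using x(1) event_measurable[OF t(1)] by (intro finite_measure_mono) (auto intro: le_less_trans)
    also have "\<dots> = measure (completion M) {\<omega> \<in> space M. \<forall>i. b u t $ i < X t \<omega> $ i}"
      using event_measurable[OF t(1)] by simp
    also have "\<dots> \<le> exceed_prob M X d q T u"
    proof -
      interpret C: prob_space "completion M" by (rule prob_space_completion)
      show ?thesis unfolding exceed_prob_eq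
        by (intro C.finite_measure_mono exceed_prob_separant(1)[OF S ae]) (use t(1) in \<open>auto simp: E_def\<close>)
    qed
    finally have "std_normal_density ((1 + \<epsilon>) * sqrt (Q t x) + 1) / 2 \<le> exceed_prob M X d q T u" .
    moreover have "std_normal_density ((1 + \<epsilon>) * sqrt ((1 + \<epsilon>) * (2 * m)) + 1) \<le> std_normal_density ((1 + \<epsilon>) * sqrt (Q t x) + 1)"
    proof -
      have "((1 + \<epsilon>) * sqrt (Q t x) + 1)\<^sup>2 \<le> ((1 + \<epsilon>) * sqrt ((1 + \<epsilon>) * (2 * m)) + 1)\<^sup>2"
        using Q \<epsilon> m by (intro power_mono add_right_mono mult_left_mono real_sqrt_le_mono) auto
      then show ?thesis by (simp add: std_normal_density_def divide_right_mono)
    qed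
    ultimately show ?case unfolding m_def by linarith
  qed
qed

section \<open>Logarithmic asymptotics\<close>

lemma neg_ln_exceed_prob_upper:
  assumes "\<kappa> > 1"
  shows "\<exists>K. eventually (\<lambda>u. - ln (exceed_prob M X d q T u) \<le> \<kappa> * M_set M X d q u T + K) at_top"
proof -
  \<comment> \<open>Two of the three factors come from pushing \<open>W\<close> beyond its variance,
    squared in the Gaussian exponent, the third from the nearly optimal \<open>t\<close>.\<close>
  have "((\<lambda>\<epsilon>. (1 + \<epsilon>) ^ 3) \<longlongrightarrow> (1 + 0 :: real) ^ 3) (at_right 0)" by (intro tendsto_intros)
  then have "eventually (\<lambda>\<epsilon>. (1 + \<epsilon>) ^ 3 < \<kappa>) (at_right (0::real))" using assms by (auto intro: order_tendstoD)
  moreover have "eventually (\<lambda>\<epsilon>. \<epsilon> \<in> {0<..<1}) (at_right (0::real))" by (intro eventually_at_right_real) simp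
  ultimately have "eventually (\<lambda>\<epsilon>::real. (1 + \<epsilon>) ^ 3 < \<kappa> \<and> \<epsilon> \<in> {0<..<1}) (at_right 0)"
    by (rule eventually_conj)
  then obtain \<epsilon> :: real where \<epsilon>: "(1 + \<epsilon>) ^ 3 < \<kappa>" "0 < \<epsilon>" "\<epsilon> < 1"
    using eventually_happens[of _ "at_right (0::real)"] by auto
  \<comment> \<open>Collects the normaliser of the density and the factor 1/2 lost to the
    residuals.\<close>
  define K where "K = ln (2 * sqrt (2 * pi))"
  have "eventually (\<lambda>m. ((1 + \<epsilon>) * sqrt ((1 + \<epsilon>) * (2 * m)) + 1)\<^sup>2 / 2 \<le> \<kappa> * m) at_top"
  proof -
    define a where "a = (1 + \<epsilon>) * sqrt ((1 + \<epsilon>) * 2)"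
    have a: "a > 0" "a\<^sup>2 / 2 = (1 + \<epsilon>) ^ 3"
      using \<epsilon>(2) by (simp_all add: a_def power_mult_distrib power2_eq_square power3_eq_cube)
    \<comment> \<open>The shift by 1 from the tail bound is of lower order than
      \<open>a * sqrt m\<close>.\<close>
    have "((\<lambda>m. (a * sqrt m + 1)\<^sup>2 / 2 / m) \<longlongrightarrow> a\<^sup>2 / 2) at_top"
      using a(1) by (real_asymp simp: power2_eq_square)
    then have "((\<lambda>m. ((1 + \<epsilon>) * sqrt ((1 + \<epsilon>) * (2 * m)) + 1)\<^sup>2 / 2 / m) \<longlongrightarrow> (1 + \<epsilon>) ^ 3) at_top"
      unfolding a(2) by (simp add: a_def real_sqrt_mult mult_ac)
    then have "eventually (\<lambda>m. ((1 + \<epsilon>) * sqrt ((1 + \<epsilon>) * (2 * m)) + 1)\<^sup>2 / 2 / m < \<kappa>) at_top"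
      using \<epsilon>(1) by (rule order_tendstoD)
    then show ?thesis using eventually_gt_at_top[of 0]
      by eventually_elim (simp add: divide_less_eq)
  qed
  then have "eventually (\<lambda>u. ((1 + \<epsilon>) * sqrt ((1 + \<epsilon>) * (2 * M_set M X d q u T)) + 1)\<^sup>2 / 2 \<le> \<kappa> * M_set M X d q u T) at_top"
    by (rule eventually_compose_filterlim[OF _ M_set_at_top])
  moreover have "\<epsilon> \<le> 1" using \<epsilon> by simp
  note exceed_prob_ge[OF \<epsilon>(2) this]
  ultimately have "eventually (\<lambda>u. - ln (exceed_prob M X d q T u) \<le> \<kappa> * M_set M X d q u T + K) at_top"
  proof eventually_elim
    case (elim u)
    define z where "z = (1 + \<epsilon>) * sqrt ((1 + \<epsilon>) * (2 * M_set M X d q u T)) + 1"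
    have "ln (std_normal_density z / 2) \<le> ln (exceed_prob M X d q T u)"
      using elim(2) normal_density_pos[of 1 0 z] by (subst ln_le_cancel_iff) (auto simp: z_def)
    moreover have "ln (std_normal_density z / 2) = - K - z\<^sup>2 / 2"
    proof -
      have "std_normal_density z / 2 = exp (- z\<^sup>2 / 2) / (2 * sqrt (2 * pi))"
        by (simp add: std_normal_density_def)
      then show ?thesis by (simp add: K_def ln_div)
    qed
    ultimately show ?case using elim(1) by (simp add: z_def)
  qed
  then show ?thesis by blast
qed

lemma neg_ln_exceed_prob_lower:
  assumes "\<kappa> < 1"
  shows "\<exists>K. eventually (\<lambda>u. \<kappa> * M_set M X d q u T - K \<le> - ln (exceed_prob M X d q T u)) at_top"
proof -
  \<comment> \<open>The choice \<open>l = 1 - \<eta>\<close> leaves a single parameter; the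
    prefactor becomes \<open>2 powr ((1 - \<eta>) / \<eta>)\<close>.\<close>
  have "((\<lambda>\<eta>. (1 - \<eta>) * (1 - \<eta>)\<^sup>2) \<longlongrightarrow> (1 - 0 :: real) * (1 - 0)\<^sup>2) (at_right 0)" by (intro tendsto_intros)
  then have "eventually (\<lambda>\<eta>. \<kappa> < (1 - \<eta>) * (1 - \<eta>)\<^sup>2) (at_right (0::real))" using assms by (auto intro: order_tendstoD)
  moreover have "eventually (\<lambda>\<eta>. \<eta> \<in> {0<..<1}) (at_right (0::real))" by (intro eventually_at_right_real) simp
  ultimately have "eventually (\<lambda>\<eta>::real. \<kappa> < (1 - \<eta>) * (1 - \<eta>)\<^sup>2 \<and> \<eta> \<in> {0<..<1}) (at_right 0)"
    by (rule eventually_conj)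
  then obtain \<eta> :: real where \<eta>: "\<kappa> < (1 - \<eta>) * (1 - \<eta>)\<^sup>2" "0 < \<eta>" "\<eta> < 1"
    using eventually_happens[of _ "at_right (0::real)"] by auto
  define K where "K = ln (2 powr ((1 - \<eta>) / \<eta>))"
  \<comment> \<open>Taking logarithms in the upper bound requires a positive probability, which the
    lower estimate provides.\<close>
  have pos: "eventually (\<lambda>u. 0 < exceed_prob M X d q T u) at_top"
    using exceed_prob_ge[OF zero_less_one order_refl]
  proof eventually_elim
    case (elim u)
    have "0 < std_normal_density x" for x by (simp add: normal_density_pos)
    from less_le_trans[OF divide_pos_pos[OF this zero_less_numeral] elim] show ?case .
  qed
  have m: "eventually (\<lambda>u. 0 \<le> M_set M X d q u T) at_top"
    using M_set_at_top by (simp add: filterlim_at_top)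
  have l: "0 < 1 - \<eta>" "1 - \<eta> < 1" using \<eta> by auto
  have "eventually (\<lambda>u. \<kappa> * M_set M X d q u T - K \<le> - ln (exceed_prob M X d q T u)) at_top"
    using pos m exceed_prob_le[OF l \<eta>(2,3)]
  proof eventually_elim
    case (elim u)
    define m where "m = M_set M X d q u T"
    have "ln (exceed_prob M X d q T u) \<le> ln (2 powr ((1 - \<eta>) / \<eta>) * exp (- (1 - \<eta>) * (1 - \<eta>)\<^sup>2 * m))"
      using elim(1,3) by (subst ln_le_cancel_iff) (auto simp: m_def)
    also have "\<dots> = K - (1 - \<eta>) * (1 - \<eta>)\<^sup>2 * m" by (simp add: K_def ln_mult algebra_simps)
    also have "\<dots> \<le> K - \<kappa> * m" using elim(2) \<eta>(1) by (auto simp: m_def intro!: mult_right_mono)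
    finally show ?case by (simp add: m_def)
  qed
  then show ?thesis by blast
qed

theorem ln_exceed_prob_asymp:
  "(\<lambda>u. ln (exceed_prob M X d q T u)) \<sim>[at_top] (\<lambda>u. - M_set M X d q u T)"
proof (rule asymp_equivI')
  have "((\<lambda>u. - ln (exceed_prob M X d q T u) / M_set M X d q u T) \<longlongrightarrow> 1) at_top"
    by (intro ratio_tendsto_1I M_set_at_top neg_ln_exceed_prob_lower neg_ln_exceed_prob_upper)
  then show "((\<lambda>u. ln (exceed_prob M X d q T u) / - M_set M X d q u T) \<longlongrightarrow> 1) at_top" by simp
qed

end

theorem theorem1:
  fixes M :: "'a measure"
    and T :: "(real ^ 'm) set"
    and X :: "real ^ 'm \<Rightarrow> 'a \<Rightarrow> real ^ 'n"
    and d :: "real ^ 'm \<Rightarrow> real ^ 'n"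
    and q :: "real ^ 'n"
  assumes "prob_space M"
    and "T \<noteq> {}"
    and "gaussian_process M T X"
    and "centered_process M T X"
    and sep: "separable_process M T X"
    and sep_drift: "separable_process M T (\<lambda>t \<omega>. X t \<omega> - d t)"
    and "\<forall>t\<in>T. invertible (cov_matrix M (X t))"
    and A1: "\<forall>i j. i \<noteq> j \<longrightarrow> (SUP t\<in>T. k_coeff M X i j t) < 1"
    and A2: "\<forall>i. \<forall>\<epsilon>\<in>{0<..1}. AE \<omega> in M. bdd_above ((\<lambda>t. X t \<omega> $ i - \<epsilon> * d t $ i) ` T)"
    and "\<forall>i. q $ i > 0"
  shows "(\<lambda>u. ln (exceed_prob M X d q T u)) \<sim>[at_top] (\<lambda>u. - M_set M X d q u T)"
proof -
  interpret drifted_gaussian_process M T X d q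
    using assms by (auto simp: drifted_gaussian_process_def drifted_gaussian_process_axioms_def)
  show ?thesis by (rule ln_exceed_prob_asymp)
qed

end
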